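(* Let $n\ge 1$, let $q$ be a prime power, and let $g \in SU_n(q)$. \begin{enumerate} \item[(1)] If $n \not\equiv 2 \pmod 4$ or $q$ is even, then $g$ is strongly real in $SU_n(q)$ if and only if $g$ is strongly real in $GU_n(q)$. \item[(2)] If $n \equiv 2 \pmod 4$ and $q$ is odd, then $g$ is strongly real in $SU_n(q)$ if and only if $g$ is strongly real in $GU_n(q)$ and $g$ has some elementary divisor of the form $(t-1)^k$ or $(t+1)^k$ with $k$ odd. \end{enumerate}
   Context: An element $g$ of a group $G$ is strongly real in $G$ if there is $h\in G$ with $hgh^{-1}=g^{-1}$ and $h^2=1$. $GU_n(q)$ is the finite unitary group: for an invertible Hermitian matrix $\eta$ over $\mathbb{F}_{q^2}$, it is the group of $g\in GL_n(\bar{\mathbb{F}}_q)$ fixed by $F_\eta(g)=\eta^{-1}({}^{\top}F(g)^{-1})\eta$, where $F((a_{ij}))=(a_{ij}^q)$; up to conjugacy in $GL_n(\bar{\mathbb{F}}_q)$ it does not depend on $\eta$, and $GU_n(q)\subset GL_n(q^2)$. $SU_n(q)$ is its subgroup of determinant $1$ elements. Elementary divisors that are powers of $t\pm1$ are the usual elementary divisors of $g$ as a matrix over $\mathbb{F}_{q^2}$. *)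

theory Defs
  imports
    "Jordan_Normal_Form.Determinant"
    "HOL-Algebra.Algebraic_Closure_Type"
    "HOL-Number_Theory.Prime_Powers"
    "HOL-Library.Cardinality"
begin

definition strongly_real :: "('g, 'b) monoid_scheme \<Rightarrow> 'g \<Rightarrow> bool" where
  "strongly_real G g \<longleftrightarrow> g \<in> carrier G \<and>
     (\<exists>h\<in>carrier G. h \<otimes>\<^bsub>G\<^esub> g \<otimes>\<^bsub>G\<^esub> inv\<^bsub>G\<^esub> h = inv\<^bsub>G\<^esub> g \<and> h \<otimes>\<^bsub>G\<^esub> h = \<one>\<^bsub>G\<^esub>)"

definition GL :: "nat \<Rightarrow> 'k :: field mat monoid" where
  "GL n = units_of (ring_mat TYPE('k) n ())"

definition frob_mat :: "nat \<Rightarrow> 'k :: field mat \<Rightarrow> 'k mat" where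
  "frob_mat q A = map_mat (\<lambda>x. x ^ q) A"

(* The field with q^2 elements is a finite field type 'a with CARD('a) = q^2. Since 'a is a
   finite extension of the field with q elements, 'a alg_closure is an algebraic closure of
   both, and to_ac is the inclusion of 'a. *)

definition invertible_hermitian :: "nat \<Rightarrow> nat \<Rightarrow> 'a :: field mat \<Rightarrow> bool" where
  "invertible_hermitian n q \<eta> \<longleftrightarrow> \<eta> \<in> carrier (GL n) \<and> transpose_mat (frob_mat q \<eta>) = \<eta>"

definition unitary_frob ::
  "nat \<Rightarrow> nat \<Rightarrow> 'a :: field mat \<Rightarrow> 'a alg_closure mat \<Rightarrow> 'a alg_closure mat" where
  "unitary_frob n q \<eta> g =
     inv\<^bsub>GL n\<^esub> (map_mat to_ac \<eta>) * transpose_mat (inv\<^bsub>GL n\<^esub> (frob_mat q g)) * map_mat to_ac \<eta>"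

definition GU :: "nat \<Rightarrow> nat \<Rightarrow> 'a :: field mat \<Rightarrow> 'a alg_closure mat monoid" where
  "GU n q \<eta> = (GL n)\<lparr>carrier := {g \<in> carrier (GL n). unitary_frob n q \<eta> g = g}\<rparr>"

definition SU :: "nat \<Rightarrow> nat \<Rightarrow> 'a :: field mat \<Rightarrow> 'a alg_closure mat monoid" where
  "SU n q \<eta> = (GU n q \<eta>)\<lparr>carrier := {g \<in> carrier (GU n q \<eta>). det g = 1}\<rparr>"

(* Matrix of multiplication by t on F[t]/(f) in the basis 1, t, ..., t^(degree f - 1), for monic f. *)
definition companion_mat :: "'a :: field poly \<Rightarrow> 'a mat" where
  "companion_mat f = mat (Polynomial.degree f) (Polynomial.degree f)
     (\<lambda>(i, j). if Suc j = Polynomial.degree f then - Polynomial.coeff f i else if i = Suc j then 1 else 0)"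

(* fs lists, with multiplicity, monic prime powers f such that F^n, with t acting as A, is
   isomorphic to the direct sum of the F[t]/(f). By the structure theorem over the principal
   ideal domain F[t] such an fs exists for every square A and is unique up to order. *)
definition elementary_divisors :: "'a :: field mat \<Rightarrow> 'a poly list \<Rightarrow> bool" where
  "elementary_divisors A fs \<longleftrightarrow>
     (\<forall>f\<in>set fs. \<exists>p k. Polynomial.lead_coeff p = 1 \<and> Factorial_Ring.irreducible p \<and> 1 \<le> k \<and> f = p ^ k) \<and>
     similar_mat A (diag_block_mat (map companion_mat fs))"

(* f is an elementary divisor of g over the base field 'a, not over its closure. The matrix A is
   unique, as to_ac is injective. *)
definition is_elementary_divisor :: "'a :: field alg_closure mat \<Rightarrow> 'a poly \<Rightarrow> bool" where
  "is_elementary_divisor g f \<longleftrightarrow>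
     (\<exists>A fs. g = map_mat to_ac A \<and> elementary_divisors A fs \<and> f \<in> set fs)"

end

theory Submission
  imports Defs "HOL-Number_Theory.Residues"
begin

unbundle no fps_syntax

text \<open>
  Only odd \<open>q\<close> needs an argument. Let \<open>h\<close> be a unitary involution inverting the unitary matrix \<open>g\<close>.

  If some \<open>(t - \<epsilon>)^k\<close> with \<open>\<epsilon> = \<plusminus>1\<close> and \<open>k\<close> odd is an elementary divisor of \<open>g\<close>, put \<open>T = g - \<epsilon>\<close>. On
  \<open>ker T^k\<close> the form \<open>\<langle>x, T^(k-1) y\<rangle>\<close> is Hermitian, invariant under \<open>h\<close> and non-zero, so by polarisation it
  does not vanish at some eigenvector \<open>z\<close> of \<open>h\<close>. The span \<open>W\<close> of \<open>z, T z, \<dots>, T^(k-1) z\<close> is then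
  non-degenerate (its Gram matrix is antitriangular) and stable under \<open>g\<close> and \<open>h\<close>. Replacing \<open>h\<close> by \<open>-h\<close> on
  \<open>W\<close> only, one gets another unitary involution inverting \<open>g\<close>, of determinant \<open>- det h\<close>.

  If there is no such elementary divisor, consider \<open>u = g - g^(-1)\<close>, which anticommutes with \<open>h\<close>. Its
  nilpotent part has only Jordan blocks of even size, so \<open>u\<close> matches the two eigenspaces of \<open>h\<close> and these
  have the same dimension. Hence \<open>n\<close> is even and \<open>det h = (-1)^(n/2)\<close>.
\<close>

section \<open>Splitting off a block of a matrix\<close>

text \<open>The odd exponent enters twice. With \<open>T = g - \<epsilon>\<close> and
  \<open>k\<close> odd, the even power \<open>T^(k-1)\<close> is its own adjoint on
  \<open>ker T^k\<close>, so the form there is Hermitian and not skew; and \<open>-1\<close> on a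
  space of odd dimension \<open>k\<close> has determinant \<open>-1\<close>. The passage to
  \<open>u\<close> treats the eigenvalues \<open>1\<close> and \<open>-1\<close> together:
  \<open>g u = g^2 - 1\<close>, where \<open>g\<close> is invertible and commutes with
  \<open>u\<close>, so a statement about \<open>(t^2 - 1)^k\<close> acting through \<open>g\<close>
  is a statement about \<open>u^k\<close>. Since \<open>u\<close> exchanges the eigenspaces of
  \<open>h\<close>, a block of even size contributes equally to both. No Jordan basis is chosen for
  this: over a finite field dimensions can be read off cardinalities, and the matching is done by
  counting graded kernels of powers of \<open>u\<close>. Elementary divisors are given by the
  existence of a decomposition. Presence of a block is therefore first turned into a vector and a
  functional, absence into a lifting property of kernels; both can be checked on companion blocks
  and transported along similarity. Using absence also requires that some decomposition exists,
  which is why the structure theorem is proved here.\<close>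

lemma mat_inverse_of_det:
  assumes A: "(A :: 'a :: field mat) \<in> carrier_mat n n" and "det A \<noteq> 0"
  obtains B where "B \<in> carrier_mat n n" "A * B = 1\<^sub>m n" "B * A = 1\<^sub>m n"
  using det_non_zero_imp_unit[OF A assms(2), of "()"]
  unfolding Units_def ring_mat_def by auto

lemma mat_inverse_of_injective:
  assumes A: "(A :: 'a :: field mat) \<in> carrier_mat n n"
    and inj: "\<And>v. v \<in> carrier_vec n \<Longrightarrow> A *\<^sub>v v = 0\<^sub>v n \<Longrightarrow> v = 0\<^sub>v n"
  obtains B where "B \<in> carrier_mat n n" "A * B = 1\<^sub>m n" "B * A = 1\<^sub>m n"
proof -
  have "det A \<noteq> 0" using det_0_iff_vec_prod_zero[OF A] inj by blast
  then show ?thesis using mat_inverse_of_det[OF A] that by blast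
qed

lemma mat_eq_by_vec:
  assumes "(A :: 'a :: semiring_1 mat) \<in> carrier_mat n m" "B \<in> carrier_mat n m"
    and "\<And>v. v \<in> carrier_vec m \<Longrightarrow> A *\<^sub>v v = B *\<^sub>v v"
  shows "A = B"
proof (rule eq_matI)
  fix i j assume "i < dim_row B" "j < dim_col B"
  with assms(1,2) have ij: "i < n" "j < m" by auto
  have "(A *\<^sub>v unit_vec m j) $ i = (B *\<^sub>v unit_vec m j) $ i" using assms(3) by simp
  then show "A $$ (i,j) = B $$ (i,j)" using ij assms(1,2) by simp
qed (use assms in auto)

text \<open>Used for the Gram matrix of \<open>z, T z, ..., T^(k-1) z\<close>. If \<open>m\<close>
  is the first index with \<open>v $ m \<noteq> 0\<close>, then coordinate \<open>k - 1 - m\<close>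
  of \<open>G *\<^sub>v v\<close> is a single antidiagonal term: smaller columns meet zeros of
  \<open>v\<close>, larger ones meet zeros of \<open>G\<close>.\<close>

lemma antitriangular_inverse:
  assumes G: "(G :: 'a :: field mat) \<in> carrier_mat k k"
    and zero: "\<And>i j. i < k \<Longrightarrow> j < k \<Longrightarrow> k \<le> i + j \<Longrightarrow> G $$ (i,j) = 0"
    and diag: "\<And>i j. i < k \<Longrightarrow> j < k \<Longrightarrow> Suc (i + j) = k \<Longrightarrow> G $$ (i,j) \<noteq> 0"
  obtains H where "H \<in> carrier_mat k k" "G * H = 1\<^sub>m k" "H * G = 1\<^sub>m k"
proof (rule mat_inverse_of_injective[OF G])
  fix v assume v: "v \<in> carrier_vec k" and Gv: "G *\<^sub>v v = 0\<^sub>v k"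
  show "v = 0\<^sub>v k"
  proof (rule ccontr)
    assume "v \<noteq> 0\<^sub>v k"
    then obtain i where "i < k" "v $ i \<noteq> 0" using v by (auto simp: vec_eq_iff)
    then obtain m where m: "m < k" "v $ m \<noteq> 0" and least: "\<And>j. j < m \<Longrightarrow> v $ j = 0"
      using exists_least_iff[of "\<lambda>i. i < k \<and> v $ i \<noteq> 0"] by (metis order.strict_trans)
    have "0 = (G *\<^sub>v v) $ (k - 1 - m)" using Gv m by simp
    also have "\<dots> = (\<Sum>j\<in>{0..<k}. G $$ (k - 1 - m, j) * v $ j)"
      using m(1) G v by (auto simp: scalar_prod_def intro!: sum.cong)
    also have "\<dots> = (\<Sum>j\<in>{m}. G $$ (k - 1 - m, j) * v $ j)"
    proof (rule sum.mono_neutral_right)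
      show "\<forall>j\<in>{0..<k} - {m}. G $$ (k - 1 - m, j) * v $ j = 0"
      proof
        fix j assume j: "j \<in> {0..<k} - {m}"
        show "G $$ (k - 1 - m, j) * v $ j = 0"
          using j least[of j] m zero[of "k - 1 - m" j] by (cases "j < m") auto
      qed
    qed (use m in auto)
    finally show False using diag[of "k - 1 - m" m] m by simp
  qed
qed (use that in auto)

text \<open>Basis extension by Steinitz exchange, kept in matrix form: in each induction step an
  invertible \<open>P\<close> takes over one more column of \<open>B\<close>. The bound
  \<open>e \<le> n\<close> comes out of the same induction.\<close>

lemma column_completion:
  assumes B: "(B :: 'a :: field mat) \<in> carrier_mat n d"
    and inj: "\<And>v. v \<in> carrier_vec d \<Longrightarrow> B *\<^sub>v v = 0\<^sub>v n \<Longrightarrow> v = 0\<^sub>v d"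
    and "e \<le> d"
  shows "e \<le> n \<and> (\<exists>P\<in>carrier_mat n n. \<exists>Q\<in>carrier_mat n n. P * Q = 1\<^sub>m n \<and> Q * P = 1\<^sub>m n
    \<and> (\<forall>j<e. col P j = col B j))"
  using \<open>e \<le> d\<close>
proof (induction e)
  case 0
  show ?case by (auto intro!: bexI[of _ "1\<^sub>m n"])
next
  case (Suc e)
  then obtain P Q where e: "e \<le> n" "e < d" and P: "P \<in> carrier_mat n n" and Q: "Q \<in> carrier_mat n n"
    and PQ: "P * Q = 1\<^sub>m n" "Q * P = 1\<^sub>m n" and colP: "\<And>j. j < e \<Longrightarrow> col P j = col B j" by auto
  define w where "w = Q *\<^sub>v col B e"
  have colB: "col B e \<in> carrier_vec n" using B e by auto
  have w: "w \<in> carrier_vec n" unfolding w_def using Q B by auto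
  have Pw: "P *\<^sub>v w = col B e"
    unfolding w_def using assoc_mult_mat_vec[OF P Q colB] PQ colB by simp
  \<comment> \<open>\<open>w\<close> holds the coordinates of the new column in the basis
    \<open>P\<close>. If they all sat below \<open>e\<close>, the new column would be a combination
    of the earlier columns of \<open>B\<close>, and \<open>y\<close> would be a nonzero vector
    killed by \<open>B\<close>.\<close>
  have "\<exists>i. e \<le> i \<and> i < n \<and> w $ i \<noteq> 0"
  proof (rule ccontr)
    assume "\<not> ?thesis"
    then have w0: "\<And>i. e \<le> i \<Longrightarrow> i < n \<Longrightarrow> w $ i = 0" by blast
    define y where "y = vec d (\<lambda>j. if j < e then w $ j else if j = e then -1 else 0)"
    have "B *\<^sub>v y = 0\<^sub>v n"
    proof (rule eq_vecI)
      fix r assume "r < dim_vec (0\<^sub>v n :: 'a vec)"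
      then have r: "r < n" by simp
      have "(B *\<^sub>v y) $ r = (\<Sum>j\<in>{0..<d}. B $$ (r,j) * y $ j)"
        using B r by (auto simp: scalar_prod_def y_def intro!: sum.cong)
      also have "\<dots> = (\<Sum>j\<in>{0..<Suc e}. B $$ (r,j) * y $ j)"
        by (rule sum.mono_neutral_right) (use e in \<open>auto simp: y_def\<close>)
      also have "\<dots> = (\<Sum>j\<in>{0..<e}. B $$ (r,j) * w $ j) - B $$ (r,e)"
        using e by (simp add: y_def)
      also have "(\<Sum>j\<in>{0..<e}. B $$ (r,j) * w $ j) = (\<Sum>j\<in>{0..<e}. P $$ (r,j) * w $ j)"
      proof (rule sum.cong)
        fix j assume j: "j \<in> {0..<e}"
        then have "col P j $ r = col B j $ r" using colP by simp
        then show "B $$ (r,j) * w $ j = P $$ (r,j) * w $ j" using j e B P r by simp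
      qed simp
      also have "\<dots> = (\<Sum>j\<in>{0..<n}. P $$ (r,j) * w $ j)"
        by (rule sum.mono_neutral_left) (use e w0 in auto)
      also have "\<dots> = (P *\<^sub>v w) $ r"
        using P r w by (auto simp: scalar_prod_def intro!: sum.cong)
      finally show "(B *\<^sub>v y) $ r = 0\<^sub>v n $ r" using Pw B r e by simp
    qed (use B in auto)
    then have "y = 0\<^sub>v d" by (intro inj) (auto simp: y_def)
    then have "y $ e = 0" using e by simp
    then show False using e by (simp add: y_def)
  qed
  then obtain i where i: "e \<le> i" "i < n" "w $ i \<noteq> 0" by blast
  \<comment> \<open>The exchange matrix: column \<open>e\<close> becomes \<open>w\<close>, column
    \<open>i\<close> (if different) becomes the displaced unit vector at \<open>e\<close>, and
    columns below \<open>e\<close> are untouched because \<open>e \<le> i\<close>. It is invertible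
    since \<open>w $ i \<noteq> 0\<close>.\<close>
  define R where "R = mat n n (\<lambda>(r,j). if j = e then w $ r
    else if j = i then (if r = e then 1 else 0) else if r = j then 1 else 0)"
  have R: "R \<in> carrier_mat n n" unfolding R_def by simp
  have en: "e < n" using i by simp
  obtain S where S: "S \<in> carrier_mat n n" "R * S = 1\<^sub>m n" "S * R = 1\<^sub>m n"
  proof (rule mat_inverse_of_injective[OF R])
    fix v assume v: "v \<in> carrier_vec n" and Rv: "R *\<^sub>v v = 0\<^sub>v n"
    have row: "0 = w $ r * v $ e + (if i \<noteq> e \<and> r = e then v $ i else 0)
        + (if r \<noteq> e \<and> r \<noteq> i then v $ r else 0)" if r: "r < n" for r
    proof -
      have "0 = (R *\<^sub>v v) $ r" using Rv r by simp
      also have "\<dots> = (\<Sum>j\<in>{0..<n}. R $$ (r,j) * v $ j)"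
        using R r v by (auto simp: scalar_prod_def intro!: sum.cong)
      also have "\<dots> = (\<Sum>j\<in>{0..<n}. (if j = e then w $ r * v $ e else 0)
          + (if j = i then (if i \<noteq> e \<and> r = e then v $ i else 0) else 0)
          + (if j = r then (if r \<noteq> e \<and> r \<noteq> i then v $ r else 0) else 0))"
        using r by (intro sum.cong) (auto simp: R_def)
      also have "\<dots> = w $ r * v $ e + (if i \<noteq> e \<and> r = e then v $ i else 0)
        + (if r \<noteq> e \<and> r \<noteq> i then v $ r else 0)"
        using r en i by (simp add: sum.distrib sum.delta)
      finally show ?thesis .
    qed
    have ve: "v $ e = 0" using row[of i] i by auto
    have vi: "v $ i = 0" using row[of e] en ve by (cases "i = e") auto
    show "v = 0\<^sub>v n"
    proof (rule eq_vecI)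
      fix r assume "r < dim_vec (0\<^sub>v n :: 'a vec)"
      then show "v $ r = 0\<^sub>v n $ r" using row[of r] ve vi by (cases "r = e \<or> r = i") auto
    qed (use v in simp)
  qed (use that in auto)
  define P' where "P' = P * R"
  define Q' where "Q' = S * Q"
  have c: "P' \<in> carrier_mat n n" "Q' \<in> carrier_mat n n" unfolding P'_def Q'_def using P Q R S by auto
  have "P' * Q' = P * (R * (S * Q))" unfolding P'_def Q'_def using P Q R S by (simp add: assoc_mult_mat[of _ n n _ n _ n])
  also have "\<dots> = 1\<^sub>m n" using assoc_mult_mat[OF R S(1) Q] S Q PQ by simp
  finally have 1: "P' * Q' = 1\<^sub>m n" .
  then have 2: "Q' * P' = 1\<^sub>m n" using mat_mult_left_right_inverse c by blast
  have "col P' j = col B j" if j: "j < Suc e" for j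
  proof -
    have "col P' j = P *\<^sub>v col R j" unfolding P'_def using col_mult2[OF P R] j en by simp
    also have "\<dots> = col B j"
    proof (cases "j = e")
      case True
      have "col R j = w" using True en w by (auto simp: R_def)
      then show ?thesis using Pw True by simp
    next
      case False
      then have "col R j = unit_vec n j" using j i en by (auto simp: R_def)
      moreover have "P *\<^sub>v unit_vec n j = col P j" using P j en by (intro eq_vecI) auto
      ultimately show ?thesis using colP False j by simp
    qed
    finally show ?thesis .
  qed
  then show ?case using c 1 2 en by auto
qed

lemma zero_mult_mat_vec:
  "(v :: 'a :: semiring_1 vec) \<in> carrier_vec m \<Longrightarrow> 0\<^sub>m n m *\<^sub>v v = 0\<^sub>v n"
  by (intro eq_vecI) auto

lemma left_inverse_of_injective:
  assumes B: "(B :: 'a :: field mat) \<in> carrier_mat n d"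
    and inj: "\<And>v. v \<in> carrier_vec d \<Longrightarrow> B *\<^sub>v v = 0\<^sub>v n \<Longrightarrow> v = 0\<^sub>v d"
  obtains L where "L \<in> carrier_mat d n" "L * B = 1\<^sub>m d"
proof -
  obtain P Q where dn: "d \<le> n" and P: "P \<in> carrier_mat n n" and Q: "Q \<in> carrier_mat n n"
    and QP: "Q * P = 1\<^sub>m n" and colP: "\<And>j. j < d \<Longrightarrow> col P j = col B j"
    using column_completion[OF B inj order.refl] by blast
  define L where "L = mat d n (\<lambda>(i,j). Q $$ (i, j))"
  have "L * B = 1\<^sub>m d"
  proof (rule eq_matI)
    fix i j assume "i < dim_row (1\<^sub>m d :: 'a mat)" "j < dim_col (1\<^sub>m d :: 'a mat)"
    then have ij: "i < d" "j < d" by auto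
    have "(L * B) $$ (i,j) = row Q i \<bullet> col B j"
      using ij dn B Q by (auto simp: L_def scalar_prod_def)
    also have "\<dots> = (Q * P) $$ (i,j)" using colP[OF ij(2)] ij dn P Q by simp
    finally show "(L * B) $$ (i,j) = 1\<^sub>m d $$ (i,j)" using QP ij dn by simp
  qed (use B in \<open>auto simp: L_def\<close>)
  then show ?thesis using that[of L] by (simp add: L_def)
qed

text \<open>\<open>B\<close> and \<open>D\<close> side by side and \<open>L\<close> on top of
  \<open>M\<close> are inverse matrices. Completing a basis gives a first complement
  \<open>D0\<close>; subtracting \<open>B * (L * D0)\<close> moves it into the kernel of
  \<open>L\<close> without changing it modulo the columns of \<open>B\<close>.\<close>

lemma complement_of_left_inverse:
  assumes B: "(B :: 'a :: field mat) \<in> carrier_mat n d" and L: "L \<in> carrier_mat d n"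
    and LB: "L * B = 1\<^sub>m d"
  obtains D M where "d \<le> n" "D \<in> carrier_mat n (n - d)" "M \<in> carrier_mat (n - d) n"
    "L * D = 0\<^sub>m d (n - d)" "M * B = 0\<^sub>m (n - d) d" "M * D = 1\<^sub>m (n - d)" "B * L + D * M = 1\<^sub>m n"
proof -
  have inj: "v = 0\<^sub>v d" if v: "v \<in> carrier_vec d" and "B *\<^sub>v v = 0\<^sub>v n" for v
  proof -
    have "v = (L * B) *\<^sub>v v" using LB v by simp
    also have "\<dots> = L *\<^sub>v (B *\<^sub>v v)" using assoc_mult_mat_vec[OF L B v] .
    also have "\<dots> = 0\<^sub>v d" using that L by (intro eq_vecI) auto
    finally show ?thesis .
  qed
  obtain P Q where dn: "d \<le> n" and P: "P \<in> carrier_mat n n" and Q: "Q \<in> carrier_mat n n"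
    and PQ: "P * Q = 1\<^sub>m n" and QP: "Q * P = 1\<^sub>m n" and colP: "\<And>j. j < d \<Longrightarrow> col P j = col B j"
    using column_completion[OF B inj order.refl] by blast
  have PB: "P $$ (r,j) = B $$ (r,j)" if "r < n" "j < d" for r j
  proof -
    have "col P j $ r = col B j $ r" using colP that by simp
    then show ?thesis using that B P dn by simp
  qed
  define D0 where "D0 = mat n (n - d) (\<lambda>(i,j). P $$ (i, d + j))"
  define L0 where "L0 = mat d n (\<lambda>(i,j). Q $$ (i, j))"
  define M where "M = mat (n - d) n (\<lambda>(i,j). Q $$ (d + i, j))"
  note c = D0_def L0_def M_def
  have D0: "D0 \<in> carrier_mat n (n - d)" and L0: "L0 \<in> carrier_mat d n"
    and M: "M \<in> carrier_mat (n - d) n" by (auto simp: c)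
  have QPe: "(\<Sum>l\<in>{0..<n}. Q $$ (i,l) * P $$ (l,j)) = (if i = j then 1 else 0)"
    if ij: "i < n" "j < n" for i j
  proof -
    have "(Q * P) $$ (i,j) = (\<Sum>l\<in>{0..<n}. Q $$ (i,l) * P $$ (l,j))"
      using ij P Q by (auto simp: scalar_prod_def intro!: sum.cong)
    then show ?thesis using QP ij by simp
  qed
  have MB: "M * B = 0\<^sub>m (n - d) d"
  proof (rule eq_matI)
    fix i j assume "i < dim_row (0\<^sub>m (n - d) d :: 'a mat)" "j < dim_col (0\<^sub>m (n - d) d :: 'a mat)"
    then have ij: "i < n - d" "j < d" by auto
    have "(M * B) $$ (i,j) = (\<Sum>l\<in>{0..<n}. Q $$ (d + i,l) * P $$ (l,j))"
      using ij M B PB by (auto simp: scalar_prod_def c intro!: sum.cong)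
    then show "(M * B) $$ (i,j) = 0\<^sub>m (n - d) d $$ (i,j)" using QPe[of "d + i" j] ij by simp
  qed (use M B in auto)
  have MD0: "M * D0 = 1\<^sub>m (n - d)"
  proof (rule eq_matI)
    fix i j assume "i < dim_row (1\<^sub>m (n - d) :: 'a mat)" "j < dim_col (1\<^sub>m (n - d) :: 'a mat)"
    then have ij: "i < n - d" "j < n - d" by auto
    have "(M * D0) $$ (i,j) = (\<Sum>l\<in>{0..<n}. Q $$ (d + i,l) * P $$ (l,d + j))"
      using ij M by (auto simp: scalar_prod_def c intro!: sum.cong)
    then show "(M * D0) $$ (i,j) = 1\<^sub>m (n - d) $$ (i,j)" using QPe[of "d + i" "d + j"] ij by simp
  qed (use M D0 in auto)
  have one0: "B * L0 + D0 * M = 1\<^sub>m n"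
  proof (rule eq_matI)
    fix i j assume "i < dim_row (1\<^sub>m n :: 'a mat)" "j < dim_col (1\<^sub>m n :: 'a mat)"
    then have ij: "i < n" "j < n" by auto
    have "(\<Sum>l\<in>{0..<n}. P $$ (i,l) * Q $$ (l,j))
        = (\<Sum>l\<in>{0..<d}. P $$ (i,l) * Q $$ (l,j)) + (\<Sum>l\<in>{d..<n}. P $$ (i,l) * Q $$ (l,j))"
      using dn by (simp add: sum.atLeastLessThan_concat)
    also have "(\<Sum>l\<in>{d..<n}. P $$ (i,l) * Q $$ (l,j))
        = (\<Sum>l\<in>{0..<n-d}. P $$ (i,d + l) * Q $$ (d + l,j))"
      using sum.shift_bounds_nat_ivl[of "\<lambda>l. P $$ (i,l) * Q $$ (l,j)" 0 d "n - d"] dn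
      by (simp add: add.commute)
    also have "(\<Sum>l\<in>{0..<d}. P $$ (i,l) * Q $$ (l,j)) = (B * L0) $$ (i,j)"
      using ij B PB by (auto simp: scalar_prod_def c intro!: sum.cong)
    also have "(\<Sum>l\<in>{0..<n-d}. P $$ (i,d + l) * Q $$ (d + l,j)) = (D0 * M) $$ (i,j)"
      using ij by (auto simp: scalar_prod_def c intro!: sum.cong)
    also have "(\<Sum>l\<in>{0..<n}. P $$ (i,l) * Q $$ (l,j)) = (P * Q) $$ (i,j)"
      using ij P Q by (auto simp: scalar_prod_def intro!: sum.cong)
    finally show "(B * L0 + D0 * M) $$ (i,j) = 1\<^sub>m n $$ (i,j)" using PQ ij B L0 D0 M by simp
  qed (use D0 M in auto)
  define D where "D = D0 - B * (L * D0)"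
  have LD0: "L * D0 \<in> carrier_mat d (n - d)" using L D0 by simp
  have BLD0: "B * (L * D0) \<in> carrier_mat n (n - d)" using B LD0 by simp
  have D: "D \<in> carrier_mat n (n - d)" unfolding D_def using BLD0 D0 by (simp add: minus_carrier_mat)
  have "L * (B * (L * D0)) = L * D0" using assoc_mult_mat[OF L B LD0] left_mult_one_mat[OF LD0] unfolding LB by simp
  then have LD: "L * D = 0\<^sub>m d (n - d)"
    unfolding D_def using mult_minus_distrib_mat[OF L D0 BLD0] LD0 by simp
  have "M * (B * (L * D0)) = 0\<^sub>m (n - d) (n - d)" by (subst assoc_mult_mat[OF M B LD0, symmetric]) (simp only: MB left_mult_zero_mat[OF LD0])
  then have MD: "M * D = 1\<^sub>m (n - d)"
    unfolding D_def using mult_minus_distrib_mat[OF M D0 BLD0] MD0 by auto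
  \<comment> \<open>Multiplying the identity for \<open>B, D0\<close> by \<open>L\<close> expresses
    \<open>L\<close> through \<open>L0\<close>; with this the correction terms in
    \<open>B * L + D * M\<close> cancel.\<close>
  have L01: "L = L0 + L * (D0 * M)"
  proof -
    have "L = L * (B * L0 + D0 * M)" using one0 L by simp
    also have "\<dots> = L * (B * L0) + L * (D0 * M)"
      by (rule mult_add_distrib_mat[OF L]) (use B L0 D0 M in auto)
    also have "L * (B * L0) = L0" using assoc_mult_mat[OF L B L0] LB L0 by simp
    finally show ?thesis .
  qed
  have X: "L * (D0 * M) \<in> carrier_mat d n" "D0 * M \<in> carrier_mat n n" using L D0 M by auto
  have BX: "B * (L * (D0 * M)) \<in> carrier_mat n n" "B * L0 \<in> carrier_mat n n" using B X L0 by auto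
  have "D * M = D0 * M - B * (L * D0) * M" unfolding D_def by (rule minus_mult_distrib_mat[OF D0 BLD0 M])
  also have "B * (L * D0) * M = B * (L * (D0 * M))"
    using assoc_mult_mat[OF B LD0 M] assoc_mult_mat[OF L D0 M] by simp
  finally have DM: "D * M = D0 * M - B * (L * (D0 * M))" .
  have "B * L = B * L0 + B * (L * (D0 * M))"
    by (subst L01) (rule mult_add_distrib_mat[OF B L0 X(1)])
  moreover have "U + V + (W - V) = U + W" if "U \<in> carrier_mat n n" "V \<in> carrier_mat n n" "W \<in> carrier_mat n n"
    for U V W :: "'a mat" using that by (intro eq_matI) auto
  ultimately have "B * L + D * M = B * L0 + D0 * M"
    unfolding DM using BX X(2) by metis
  then have one: "B * L + D * M = 1\<^sub>m n" using one0 by simp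
  show ?thesis by (rule that[OF dn D M LD MB MD one])
qed

text \<open>The column space of \<open>B\<close> and the kernel of \<open>C\<close> are both
  invariant under \<open>A\<close>, and they are complementary because \<open>C * B\<close> is
  invertible. Giving the complement as a kernel means that no basis of it has to be
  supplied.\<close>

lemma similar_block_diag_of_split:
  assumes A: "(A :: 'a :: field mat) \<in> carrier_mat n n"
    and B: "B \<in> carrier_mat n d" and C: "C \<in> carrier_mat d n"
    and A1: "A1 \<in> carrier_mat d d" and AB: "A * B = B * A1"
    and CA: "\<And>x. x \<in> carrier_vec n \<Longrightarrow> C *\<^sub>v x = 0\<^sub>v d \<Longrightarrow> C *\<^sub>v (A *\<^sub>v x) = 0\<^sub>v d"
    and H: "H \<in> carrier_mat d d" and HCB: "H * (C * B) = 1\<^sub>m d"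
  obtains A' where "d \<le> n" "A' \<in> carrier_mat (n - d) (n - d)"
    "similar_mat A (four_block_mat A1 (0\<^sub>m d (n - d)) (0\<^sub>m (n - d) d) A')"
proof -
  define L where "L = H * C"
  have L: "L \<in> carrier_mat d n" unfolding L_def using H C by simp
  have LB: "L * B = 1\<^sub>m d" unfolding L_def using assoc_mult_mat[OF H C B] HCB by simp
  obtain D M where dn: "d \<le> n" and D: "D \<in> carrier_mat n (n - d)" and M: "M \<in> carrier_mat (n - d) n"
    and LD: "L * D = 0\<^sub>m d (n - d)" and MB: "M * B = 0\<^sub>m (n - d) d" and MD: "M * D = 1\<^sub>m (n - d)"
    and one: "B * L + D * M = 1\<^sub>m n"
    by (rule complement_of_left_inverse[OF B L LB])
  define m where "m = n - d"
  have nm: "n = d + m" using dn m_def by simp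
  note D = D[folded m_def] and M = M[folded m_def] and LD = LD[folded m_def]
    and MB = MB[folded m_def] and MD = MD[folded m_def]
  \<comment> \<open>The lower blocks have no rows, so this is \<open>B\<close> and \<open>D\<close>
    side by side in a shape to which block multiplication applies; \<open>Q\<close> stacks
    \<open>L\<close> on \<open>M\<close> in the same way.\<close>
  define P where "P = four_block_mat B D (0\<^sub>m 0 d) (0\<^sub>m 0 m)"
  define Q where "Q = four_block_mat L (0\<^sub>m d 0) M (0\<^sub>m m 0)"
  define A' where "A' = M * (A * D)"
  let ?A = "four_block_mat A1 (0\<^sub>m d m) (0\<^sub>m m d) A'"
  have z: "0\<^sub>m 0 d \<in> carrier_mat 0 d" "0\<^sub>m 0 m \<in> carrier_mat 0 m" "0\<^sub>m d 0 \<in> carrier_mat d 0"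
    "0\<^sub>m m 0 \<in> carrier_mat m 0" "0\<^sub>m d m \<in> carrier_mat d m" "0\<^sub>m m d \<in> carrier_mat m d" by auto
  have A': "A' \<in> carrier_mat m m" unfolding A'_def using A M D by simp
  have P: "P \<in> carrier_mat n n" unfolding P_def using four_block_carrier_mat[OF B z(2)] nm by simp
  have Q: "Q \<in> carrier_mat n n" unfolding Q_def using four_block_carrier_mat[OF L z(4)] nm by simp
  have A4: "?A \<in> carrier_mat n n" using A1 A' nm by auto
  have PQ: "P * Q = 1\<^sub>m n"
  proof -
    have "P * Q = four_block_mat (1\<^sub>m n) (0\<^sub>m n 0) (0\<^sub>m 0 n) (0\<^sub>m 0 0)"
      unfolding P_def Q_def mult_four_block_mat[OF B D z(1,2) L z(3) M z(4)] one
      by (rule cong_four_block_mat) (use B D L M in \<open>auto intro!: eq_matI\<close>)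
    also have "\<dots> = 1\<^sub>m n" by (intro eq_matI) auto
    finally show ?thesis .
  qed
  have QP: "Q * P = 1\<^sub>m n" using mat_mult_left_right_inverse[OF P Q PQ] .
  \<comment> \<open>\<open>L * A * D\<close> vanishes because the kernel of \<open>C\<close> is invariant under \<open>A\<close>.\<close>
  have BA1: "B * A1 + D * 0\<^sub>m m d = A * B" using AB B A1 D by simp
  have AD: "D * A' = A * D"
  proof -
    have AD: "A * D \<in> carrier_mat n m" using A D by simp
    have CB: "C * B \<in> carrier_mat d d" and CD: "C * D \<in> carrier_mat d m" using C B D by auto
    have CBH: "(C * B) * H = 1\<^sub>m d" by (rule mat_mult_left_right_inverse[OF H CB HCB])
    have "C * D = (C * B) * H * (C * D)" unfolding CBH left_mult_one_mat[OF CD] ..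
    also have "\<dots> = (C * B) * (H * (C * D))" by (rule assoc_mult_mat[OF CB H CD])
    also have "H * (C * D) = 0\<^sub>m d m" using LD unfolding L_def assoc_mult_mat[OF H C D] .
    finally have CD0: "C * D = 0\<^sub>m d m" unfolding right_mult_zero_mat[OF CB] .
    have "C * (A * D) = 0\<^sub>m d m"
    proof (rule mat_eq_by_vec)
      fix x assume x: "(x :: 'a vec) \<in> carrier_vec m"
      have Dx: "D *\<^sub>v x \<in> carrier_vec n" using D x by simp
      have "C *\<^sub>v (D *\<^sub>v x) = 0\<^sub>v d"
        using assoc_mult_mat_vec[OF C D x] x unfolding CD0 by (auto simp: zero_mult_mat_vec)
      then have "C *\<^sub>v (A *\<^sub>v (D *\<^sub>v x)) = 0\<^sub>v d" by (rule CA[OF Dx])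
      then show "(C * (A * D)) *\<^sub>v x = 0\<^sub>m d m *\<^sub>v x"
        using assoc_mult_mat_vec[OF C AD x] assoc_mult_mat_vec[OF A D x] x by (simp add: zero_mult_mat_vec)
    qed (use C AD in auto)
    then have "L * (A * D) = 0\<^sub>m d m"
      unfolding L_def assoc_mult_mat[OF H C AD] using right_mult_zero_mat[OF H] by metis
    then have LAD: "B * (L * (A * D)) = 0\<^sub>m n m" by (metis right_mult_zero_mat[OF B])
    have "A * D = (B * L + D * M) * (A * D)" unfolding one left_mult_one_mat[OF AD] ..
    also have "\<dots> = B * L * (A * D) + D * M * (A * D)"
      using add_mult_distrib_mat[of "B * L" n n "D * M", OF _ _ AD] B L D M by simp
    also have "\<dots> = B * (L * (A * D)) + D * A'"
      unfolding A'_def assoc_mult_mat[OF B L AD] assoc_mult_mat[OF D M AD] by (rule refl)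
    also have "\<dots> = D * A'"
      unfolding LAD by (rule left_add_zero_mat) (use D A' in simp)
    finally have "A * D = D * A'" .
    then show ?thesis by (rule sym)
  qed
  have PA: "P * ?A = A * P"
  proof -
    have "P * ?A = four_block_mat (A * B) (A * D) (0\<^sub>m 0 d) (0\<^sub>m 0 m)"
      unfolding P_def mult_four_block_mat[OF B D z(1,2) A1 z(5,6) A'] BA1
    proof (rule cong_four_block_mat)
      show "B * 0\<^sub>m d m + D * A' = A * D" unfolding AD using B A D by simp
    qed (use A1 A' in \<open>auto intro!: eq_matI\<close>)
    also have "\<dots> = four_block_mat A (0\<^sub>m n 0) (0\<^sub>m 0 n) (0\<^sub>m 0 0) * P"
      unfolding P_def
    proof (subst mult_four_block_mat[OF A _ _ _ B D z(1,2)])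
      show "four_block_mat (A * B) (A * D) (0\<^sub>m 0 d) (0\<^sub>m 0 m) =
        four_block_mat (A * B + 0\<^sub>m n 0 * 0\<^sub>m 0 d) (A * D + 0\<^sub>m n 0 * 0\<^sub>m 0 m)
          (0\<^sub>m 0 n * B + 0\<^sub>m 0 0 * 0\<^sub>m 0 d) (0\<^sub>m 0 n * D + 0\<^sub>m 0 0 * 0\<^sub>m 0 m)"
        by (rule cong_four_block_mat) (use A B D in \<open>auto intro!: eq_matI\<close>)
    qed auto
    also have "four_block_mat A (0\<^sub>m n 0) (0\<^sub>m 0 n) (0\<^sub>m 0 0) = A" using A by (intro eq_matI) auto
    finally show ?thesis .
  qed
  have "A = P * ?A * Q"
    unfolding PA assoc_mult_mat[OF A P Q] PQ right_mult_one_mat[OF A] ..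
  then have "similar_mat A ?A"
    using similar_matI[of A ?A P Q n] A A4 P Q PQ QP by simp
  then show ?thesis using that[OF dn, of A'] A' unfolding m_def by simp
qed

section \<open>The action of polynomials on vectors\<close>

text \<open>The \<open>F[t]\<close>-module structure on \<open>F^n\<close> with \<open>t\<close>
  acting as \<open>A\<close>, evaluated by Horner's rule on a vector so that no power of a matrix is
  formed.\<close>

definition poly_act :: "'a :: field mat \<Rightarrow> 'a poly \<Rightarrow> 'a vec \<Rightarrow> 'a vec" where
  "poly_act A p v = fold_coeffs (\<lambda>a w. a \<cdot>\<^sub>v v + A *\<^sub>v w) p (0\<^sub>v (dim_row A))"

context
  fixes A :: "'a :: field mat" and n :: nat
  assumes A: "A \<in> carrier_mat n n"
begin

lemma zero_smult_vec: "v \<in> carrier_vec n \<Longrightarrow> (0 :: 'a) \<cdot>\<^sub>v v = 0\<^sub>v n"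
  by (intro eq_vecI) auto

lemma mult_mat_zero_vec: "A *\<^sub>v 0\<^sub>v n = 0\<^sub>v n"
  using A by (intro eq_vecI) auto

lemma poly_act_0: "poly_act A 0 v = 0\<^sub>v n"
  using A by (simp add: poly_act_def)

lemma poly_act_pCons:
  assumes v: "v \<in> carrier_vec n"
  shows "poly_act A (pCons a p) v = a \<cdot>\<^sub>v v + A *\<^sub>v poly_act A p v"
proof (cases "p = 0 \<and> a = 0")
  case True
  then show ?thesis using v A mult_mat_zero_vec by (simp add: poly_act_0 zero_smult_vec)
next
  case False
  then show ?thesis using A by (auto simp: poly_act_def)
qed

lemma poly_act_closed [simp]:
  assumes v: "v \<in> carrier_vec n"
  shows "poly_act A p v \<in> carrier_vec n"
  using A v by (induction p) (simp_all add: poly_act_0 poly_act_pCons)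

lemma poly_act_add:
  assumes v: "v \<in> carrier_vec n"
  shows "poly_act A (p + r) v = poly_act A p v + poly_act A r v"
proof (induction p r rule: poly_induct2)
  case 0
  then show ?case by (simp add: poly_act_0)
next
  case (pCons a p b r)
  have "poly_act A (pCons a p + pCons b r) v = (a + b) \<cdot>\<^sub>v v + (A *\<^sub>v poly_act A p v + A *\<^sub>v poly_act A r v)"
    using pCons mult_add_distrib_mat_vec[OF A] v by (simp add: poly_act_pCons)
  moreover have "A *\<^sub>v poly_act A p v \<in> carrier_vec n" "A *\<^sub>v poly_act A r v \<in> carrier_vec n"
    using A v by (auto intro: mult_mat_vec_carrier)
  ultimately show ?case
    using v A by (simp add: poly_act_pCons) (rule eq_vecI, auto simp: algebra_simps)
qed

lemma poly_act_smult:
  assumes v: "v \<in> carrier_vec n"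
  shows "poly_act A (Polynomial.smult c p) v = c \<cdot>\<^sub>v poly_act A p v"
proof (induction p)
  case 0
  then show ?case by (auto simp add: poly_act_0)
next
  case (pCons a p)
  have "A *\<^sub>v poly_act A p v \<in> carrier_vec n" using A v by (auto intro: mult_mat_vec_carrier)
  then show ?case
    using pCons v A mult_mat_vec[OF A poly_act_closed[OF v]]
    by (simp add: poly_act_pCons) (rule eq_vecI, auto simp: algebra_simps)
qed

lemma poly_act_mult:
  assumes v: "v \<in> carrier_vec n"
  shows "poly_act A (p * r) v = poly_act A p (poly_act A r v)"
proof (induction p)
  case 0
  then show ?case by (simp add: poly_act_0)
next
  case (pCons a p)
  have "A *\<^sub>v poly_act A p (poly_act A r v) \<in> carrier_vec n"
    using A v by (auto intro: mult_mat_vec_carrier)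
  then show ?case
    using pCons v by (simp add: poly_act_pCons mult_pCons_left poly_act_add poly_act_smult zero_smult_vec)
qed

lemma poly_act_commute:
  assumes v: "v \<in> carrier_vec n"
  shows "poly_act A p (poly_act A r v) = poly_act A r (poly_act A p v)"
  using poly_act_mult[OF v, of p r] poly_act_mult[OF v, of r p] by (simp add: mult.commute)

lemma poly_act_const:
  assumes v: "v \<in> carrier_vec n"
  shows "poly_act A [:c:] v = c \<cdot>\<^sub>v v"
  using v mult_mat_zero_vec by (simp add: poly_act_pCons poly_act_0)

lemma poly_act_1:
  assumes v: "v \<in> carrier_vec n"
  shows "poly_act A 1 v = v"
  using poly_act_const[OF v, of 1] v by (simp add: one_pCons)

lemma poly_act_diff:
  assumes v: "v \<in> carrier_vec n"
  shows "poly_act A (p - r) v = poly_act A p v - poly_act A r v"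
  using poly_act_add[OF v, of p "Polynomial.smult (-1) r"] poly_act_smult[OF v, of "-1" r] v
  by (simp add: ) (auto intro!: eq_vecI)

lemma poly_act_linear:
  assumes v: "v \<in> carrier_vec n"
  shows "poly_act A [:c, 1:] v = c \<cdot>\<^sub>v v + A *\<^sub>v v"
  using v A mult_mat_zero_vec by (simp add: poly_act_pCons poly_act_0)

lemma poly_act_zero_vec: "poly_act A p (0\<^sub>v n) = 0\<^sub>v n"
  using mult_mat_zero_vec by (induction p) (auto simp: poly_act_0 poly_act_pCons)

lemma poly_act_add_vec:
  assumes v: "v \<in> carrier_vec n" "w \<in> carrier_vec n"
  shows "poly_act A p (v + w) = poly_act A p v + poly_act A p w"
proof (induction p)
  case 0
  then show ?case by (simp add: poly_act_0)
next
  case (pCons a p)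
  have "A *\<^sub>v poly_act A p v \<in> carrier_vec n" "A *\<^sub>v poly_act A p w \<in> carrier_vec n"
    using A v by (auto intro: mult_mat_vec_carrier)
  then show ?case
    using pCons v A mult_add_distrib_mat_vec[OF A, of "poly_act A p v" "poly_act A p w"]
    by (simp add: poly_act_pCons) (rule eq_vecI, auto simp: algebra_simps)
qed

lemma poly_act_smult_vec:
  assumes v: "v \<in> carrier_vec n"
  shows "poly_act A p (c \<cdot>\<^sub>v v) = c \<cdot>\<^sub>v poly_act A p v"
  using poly_act_commute[OF v, of p "[:c:]"] v by (simp add: poly_act_const)

text \<open>The bound \<open>d\<close> may exceed the degree, so that every residue modulo a
  polynomial of degree \<open>d\<close> is expanded over the same \<open>d\<close> vectors.\<close>

lemma poly_act_eq_sum: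
  assumes v: "v \<in> carrier_vec n" and i: "i < n"
  shows "(\<And>j. d \<le> j \<Longrightarrow> Polynomial.coeff p j = 0) \<Longrightarrow>
    poly_act A p v $ i = (\<Sum>j\<in>{0..<d}. Polynomial.coeff p j * poly_act A (Polynomial.monom 1 j) v $ i)"
  using i
proof (induction d arbitrary: p i)
  case 0
  then have "p = 0" by (intro poly_eqI) simp
  then show ?case using 0 by (simp add: poly_act_0)
next
  case (Suc d)
  obtain a r where p: "p = pCons a r" by (cases p)
  have r: "Polynomial.coeff r j = 0" if "d \<le> j" for j using Suc.prems(1)[of "Suc j"] p that by simp
  have Ar: "(A *\<^sub>v poly_act A r v) $ i = (\<Sum>j\<in>{0..<d}. Polynomial.coeff r j * (A *\<^sub>v poly_act A (Polynomial.monom 1 j) v) $ i)"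
  proof -
    have "(A *\<^sub>v poly_act A r v) $ i = (\<Sum>l\<in>{0..<n}. A $$ (i,l) * poly_act A r v $ l)"
      using A Suc.prems(2) poly_act_closed[OF v, of r] by (auto simp: scalar_prod_def intro!: sum.cong)
    also have "\<dots> = (\<Sum>l\<in>{0..<n}. A $$ (i,l) * (\<Sum>j\<in>{0..<d}. Polynomial.coeff r j * poly_act A (Polynomial.monom 1 j) v $ l))"
      using Suc.IH[of r] r by (intro sum.cong) auto
    also have "\<dots> = (\<Sum>j\<in>{0..<d}. \<Sum>l\<in>{0..<n}. A $$ (i,l) * (Polynomial.coeff r j * poly_act A (Polynomial.monom 1 j) v $ l))"
      unfolding sum_distrib_left by (rule sum.swap)
    also have "\<dots> = (\<Sum>j\<in>{0..<d}. Polynomial.coeff r j * (A *\<^sub>v poly_act A (Polynomial.monom 1 j) v) $ i)"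
    proof (rule sum.cong)
      fix j
      have "dim_vec (poly_act A (Polynomial.monom 1 j) v) = n" using poly_act_closed[OF v] carrier_vecD by blast
      then show "(\<Sum>l\<in>{0..<n}. A $$ (i,l) * (Polynomial.coeff r j * poly_act A (Polynomial.monom 1 j) v $ l))
          = Polynomial.coeff r j * (A *\<^sub>v poly_act A (Polynomial.monom 1 j) v) $ i"
        using A Suc.prems(2) by (auto simp: scalar_prod_def sum_distrib_left intro!: sum.cong)
    qed simp
    finally show ?thesis .
  qed
  have m: "poly_act A (Polynomial.monom 1 (Suc j)) v = A *\<^sub>v poly_act A (Polynomial.monom 1 j) v" for j
    using v A by (simp add: monom_Suc poly_act_pCons) (intro eq_vecI, auto)
  have "poly_act A p v $ i = a * v $ i + (A *\<^sub>v poly_act A r v) $ i"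
    using v A Suc.prems(2) p by (simp add: poly_act_pCons)
  moreover have "poly_act A (Polynomial.monom 1 0) v = v" using poly_act_1[OF v] by (simp add: monom_0 one_pCons)
  ultimately show ?case
    by (simp only: sum.atLeast0_lessThan_Suc_shift m Ar) (simp add: p m)
qed

end

lemma poly_act_similar:
  assumes A: "A \<in> carrier_mat n n" and D: "D \<in> carrier_mat n n" and P: "P \<in> carrier_mat n m"
    and B: "B \<in> carrier_mat m m"
    and AP: "A * P = P * B" and v: "v \<in> carrier_vec m"
  shows "poly_act A p (P *\<^sub>v v) = P *\<^sub>v poly_act B p v"
proof (induction p)
  case 0
  then show ?case using P by (auto simp: poly_act_0[OF A] poly_act_0[OF B] intro!: eq_vecI)
next
  case (pCons a p)
  have Pv: "P *\<^sub>v v \<in> carrier_vec n" using P v by simp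
  have w: "poly_act B p v \<in> carrier_vec m" by (rule poly_act_closed[OF B v])
  have "A *\<^sub>v (P *\<^sub>v poly_act B p v) = P *\<^sub>v (B *\<^sub>v poly_act B p v)"
    using assoc_mult_mat_vec[OF A P w] assoc_mult_mat_vec[OF P B w] AP by simp
  then have "poly_act A (pCons a p) (P *\<^sub>v v) = a \<cdot>\<^sub>v (P *\<^sub>v v) + P *\<^sub>v (B *\<^sub>v poly_act B p v)"
    using pCons by (simp add: poly_act_pCons[OF A Pv])
  also have "\<dots> = P *\<^sub>v (a \<cdot>\<^sub>v v + B *\<^sub>v poly_act B p v)"
    using mult_add_distrib_mat_vec[OF P, of "a \<cdot>\<^sub>v v" "B *\<^sub>v poly_act B p v"] mult_mat_vec[OF P v] v B w
    by (simp add: mult_mat_vec_carrier)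
  finally show ?case by (simp add: poly_act_pCons[OF B v])
qed

lemma poly_act_four_block:
  assumes A: "A \<in> carrier_mat n n" and B: "B \<in> carrier_mat m m"
    and v: "v \<in> carrier_vec n" and w: "w \<in> carrier_vec m"
  shows "poly_act (four_block_mat A (0\<^sub>m n m) (0\<^sub>m m n) B) p (v @\<^sub>v w) = poly_act A p v @\<^sub>v poly_act B p w"
proof -
  let ?M = "four_block_mat A (0\<^sub>m n m) (0\<^sub>m m n) B"
  have M: "?M \<in> carrier_mat (n + m) (n + m)" using A B by simp
  have vw: "v @\<^sub>v w \<in> carrier_vec (n + m)" using v w by simp
  show ?thesis
  proof (induction p)
    case 0
    then show ?case by (auto simp: poly_act_0[OF A] poly_act_0[OF B] poly_act_0[OF M])
  next
    case (pCons a p)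
    have c: "poly_act A p v \<in> carrier_vec n" "poly_act B p w \<in> carrier_vec m"
      using poly_act_closed[OF A v] poly_act_closed[OF B w] by auto
    have "poly_act ?M (pCons a p) (v @\<^sub>v w) = a \<cdot>\<^sub>v (v @\<^sub>v w) + (A *\<^sub>v poly_act A p v @\<^sub>v B *\<^sub>v poly_act B p w)"
      using pCons mult_mat_vec_split[OF A B c] by (simp add: poly_act_pCons[OF M vw])
    also have "a \<cdot>\<^sub>v (v @\<^sub>v w) = a \<cdot>\<^sub>v v @\<^sub>v a \<cdot>\<^sub>v w" using v w by (intro eq_vecI) auto
    also have "\<dots> + (A *\<^sub>v poly_act A p v @\<^sub>v B *\<^sub>v poly_act B p w)
        = (a \<cdot>\<^sub>v v + A *\<^sub>v poly_act A p v) @\<^sub>v (a \<cdot>\<^sub>v w + B *\<^sub>v poly_act B p w)"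
      by (rule append_vec_add) (use v w A B c in \<open>auto intro: mult_mat_vec_carrier\<close>)
    finally show ?case by (simp add: poly_act_pCons[OF A v] poly_act_pCons[OF B w])
  qed
qed

section \<open>Companion matrices and cyclic subspaces\<close>

lemma scalar_prod_poly_act:
  assumes A: "(A :: 'a :: field mat) \<in> carrier_mat n n" and v: "v \<in> carrier_vec n"
    and f: "f \<in> carrier_vec n" and d: "\<And>j. d \<le> j \<Longrightarrow> Polynomial.coeff p j = 0"
  shows "f \<bullet> poly_act A p v = (\<Sum>j\<in>{0..<d}. Polynomial.coeff p j * (f \<bullet> poly_act A (Polynomial.monom 1 j) v))"
proof -
  have dim: "dim_vec (poly_act A r v) = n" for r using poly_act_closed[OF A v] carrier_vecD by blast
  have "f \<bullet> poly_act A p v = (\<Sum>i\<in>{0..<n}. \<Sum>j\<in>{0..<d}. f $ i * (Polynomial.coeff p j * poly_act A (Polynomial.monom 1 j) v $ i))"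
    unfolding scalar_prod_def dim by (intro sum.cong refl) (simp add: poly_act_eq_sum[OF A v _ d] sum_distrib_left)
  also have "\<dots> = (\<Sum>j\<in>{0..<d}. \<Sum>i\<in>{0..<n}. f $ i * (Polynomial.coeff p j * poly_act A (Polynomial.monom 1 j) v $ i))"
    by (rule sum.swap)
  also have "\<dots> = (\<Sum>j\<in>{0..<d}. Polynomial.coeff p j * (f \<bullet> poly_act A (Polynomial.monom 1 j) v))"
    unfolding scalar_prod_def dim by (intro sum.cong refl) (simp add: sum_distrib_left mult.left_commute)
  finally show ?thesis .
qed

text \<open>The matrix \<open>p(A)\<close> itself is required when a functional is composed with
  \<open>p(A)\<close> by means of a transpose.\<close>

lemma poly_act_mat:
  assumes A: "(A :: 'a :: field mat) \<in> carrier_mat n n"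
  shows "\<exists>N\<in>carrier_mat n n. \<forall>x\<in>carrier_vec n. N *\<^sub>v x = poly_act A p x"
proof (induction p)
  case 0
  show ?case by (rule bexI[of _ "0\<^sub>m n n"]) (auto simp: poly_act_0[OF A] zero_mult_mat_vec)
next
  case (pCons a p)
  then obtain N where N: "N \<in> carrier_mat n n" and Nx: "\<And>x. x \<in> carrier_vec n \<Longrightarrow> N *\<^sub>v x = poly_act A p x" by auto
  have AN: "A * N \<in> carrier_mat n n" using A N by simp
  show ?case
  proof (rule bexI[of _ "a \<cdot>\<^sub>m 1\<^sub>m n + A * N"], intro ballI)
    fix x :: "'a vec" assume x: "x \<in> carrier_vec n"
    have "(a \<cdot>\<^sub>m 1\<^sub>m n) *\<^sub>v x = a \<cdot>\<^sub>v x" using x by (intro eq_vecI) auto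
    then show "(a \<cdot>\<^sub>m 1\<^sub>m n + A * N) *\<^sub>v x = poly_act A (pCons a p) x"
      using add_mult_distrib_mat_vec[OF _ AN x, of "a \<cdot>\<^sub>m 1\<^sub>m n"] assoc_mult_mat_vec[OF A N x] Nx[OF x]
      by (simp add: poly_act_pCons[OF A x])
  qed (use AN in simp)
qed

text \<open>Coordinates of the class of \<open>r\<close> in \<open>F[t]/(f)\<close>. Through this
  identification statements about companion matrices become divisibility statements modulo
  \<open>f\<close>.\<close>

definition residue_vec :: "'a :: field poly \<Rightarrow> 'a poly \<Rightarrow> 'a vec" where
  "residue_vec f r = vec (Polynomial.degree f) (Polynomial.coeff (r mod f))"

lemma residue_vec_closed [simp]: "residue_vec f r \<in> carrier_vec (Polynomial.degree f)"
  by (simp add: residue_vec_def)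

lemma coeff_mod_eq_0: "f \<noteq> 0 \<Longrightarrow> Polynomial.degree f \<le> j \<Longrightarrow> Polynomial.coeff (r mod f) j = (0 :: 'a :: field)"
  by (metis coeff_eq_0 degree_mod_less coeff_0 less_le_trans)

lemma residue_vec_add: "residue_vec f (r + s) = residue_vec f r + residue_vec f s"
  by (auto simp: residue_vec_def poly_mod_add_left)

lemma residue_vec_smult: "residue_vec f (Polynomial.smult c r) = c \<cdot>\<^sub>v residue_vec f r"
  by (auto simp: residue_vec_def mod_smult_left)

lemma residue_vec_eq_0_iff:
  assumes f: "f \<noteq> 0"
  shows "residue_vec f r = 0\<^sub>v (Polynomial.degree f) \<longleftrightarrow> f dvd r"
proof
  assume eq: "residue_vec f r = 0\<^sub>v (Polynomial.degree f)"
  have "r mod f = 0"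
  proof (rule poly_eqI)
    fix j
    show "Polynomial.coeff (r mod f) j = Polynomial.coeff 0 j"
    proof (cases "j < Polynomial.degree f")
      case True
      then have "residue_vec f r $ j = 0" using eq by simp
      then show ?thesis using True by (simp add: residue_vec_def)
    qed (use coeff_mod_eq_0[OF f] in simp)
  qed
  then show "f dvd r" by (simp add: dvd_eq_mod_eq_0)
qed (auto simp: residue_vec_def)

lemma residue_vec_surj:
  assumes v: "(v :: 'a :: field vec) \<in> carrier_vec (Polynomial.degree f)"
  obtains r where "v = residue_vec f r"
proof (cases "Polynomial.degree f = 0")
  case True
  then have "v = residue_vec f 0" using v by (auto simp: residue_vec_def)
  then show ?thesis by (rule that)
next
  case False
  define r where "r = Poly (list_of_vec v)"
  have c: "Polynomial.coeff r j = (if j < Polynomial.degree f then v $ j else 0)" for j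
    using v by (simp add: r_def nth_default_def list_of_vec_index)
  have "Polynomial.degree r < Polynomial.degree f"
    using False c by (intro degree_lessI) auto
  then have "r mod f = r" by (rule mod_poly_less)
  then have "v = residue_vec f r" using v c by (auto simp: residue_vec_def)
  then show ?thesis by (rule that)
qed

lemma companion_mat_closed [simp]:
  "companion_mat f \<in> carrier_mat (Polynomial.degree f) (Polynomial.degree f)"
  by (simp add: companion_mat_def)

lemma companion_mat_residue_vec:
  assumes f: "Polynomial.lead_coeff f = 1"
  shows "companion_mat f *\<^sub>v residue_vec f r = residue_vec f (pCons 0 r)"
proof (rule eq_vecI)
  fix i assume "i < dim_vec (residue_vec f (pCons 0 r))"
  then have i: "i < Polynomial.degree f" by (simp add: residue_vec_def)
  define d where "d = Polynomial.degree f - 1"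
  have d: "Polynomial.degree f = Suc d" using i d_def by simp
  have f0: "f \<noteq> 0" using f by auto
  define s where "s = r mod f"
  have "(companion_mat f *\<^sub>v residue_vec f r) $ i
      = (\<Sum>j\<in>{0..<Suc d}. (if j = d then - Polynomial.coeff f i else if i = Suc j then 1 else 0) * Polynomial.coeff s j)"
    using i d by (auto simp: companion_mat_def residue_vec_def scalar_prod_def s_def intro!: sum.cong)
  also have "\<dots> = (\<Sum>j\<in>{0..<d}. if i = Suc j then Polynomial.coeff s j else 0) - Polynomial.coeff f i * Polynomial.coeff s d"
    by (simp add: if_distrib[of "\<lambda>x. x * _"] cong: if_cong)
  also have "(\<Sum>j\<in>{0..<d}. if i = Suc j then Polynomial.coeff s j else 0) = Polynomial.coeff (pCons 0 s) i"
    using i d by (cases i) (auto simp: sum.delta)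
  finally show "(companion_mat f *\<^sub>v residue_vec f r) $ i = residue_vec f (pCons 0 r) $ i"
    using i f d by (simp add: residue_vec_def mod_pCons[OF f0] s_def[symmetric] mult.commute)
qed (simp add: companion_mat_def residue_vec_def)

lemma poly_act_companion_mat:
  assumes f: "Polynomial.lead_coeff f = 1"
  shows "poly_act (companion_mat f) p (residue_vec f r) = residue_vec f (p * r)"
proof (induction p)
  case 0
  then show ?case by (auto simp: poly_act_0[OF companion_mat_closed] residue_vec_def)
next
  case (pCons a p)
  then show ?case
    by (simp add: poly_act_pCons[OF companion_mat_closed] companion_mat_residue_vec[OF f]
        mult_pCons_left residue_vec_add residue_vec_smult)
qed

text \<open>If \<open>f\<close> has degree \<open>d\<close> and kills \<open>v\<close>, this is the
  matrix of the module map from \<open>F[t]/(f)\<close> to \<open>F^n\<close> that sends the class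
  of \<open>1\<close> to \<open>v\<close>.\<close>

definition krylov_mat :: "'a :: field mat \<Rightarrow> nat \<Rightarrow> 'a vec \<Rightarrow> 'a mat" where
  "krylov_mat A d v = mat (dim_row A) d (\<lambda>(i,j). poly_act A (Polynomial.monom 1 j) v $ i)"

lemma krylov_mat_residue_vec:
  assumes A: "A \<in> carrier_mat n n" and v: "v \<in> carrier_vec n"
    and f: "f \<noteq> 0" and fv: "poly_act A f v = 0\<^sub>v n"
  shows "krylov_mat A (Polynomial.degree f) v *\<^sub>v residue_vec f r = poly_act A r v"
proof -
  have "poly_act A r v = poly_act A (r div f * f + r mod f) v" by simp
  also have "\<dots> = poly_act A (r mod f) v"
    unfolding poly_act_add[OF A v] poly_act_mult[OF A v] fv poly_act_zero_vec[OF A]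
    using poly_act_closed[OF A v] by simp
  finally have r: "poly_act A r v = poly_act A (r mod f) v" .
  show ?thesis
  proof (rule eq_vecI)
    fix i assume "i < dim_vec (poly_act A r v)"
    then have i: "i < n" using poly_act_closed[OF A v] carrier_vecD by metis
    have "poly_act A r v $ i = (\<Sum>j\<in>{0..<Polynomial.degree f}.
        Polynomial.coeff (r mod f) j * poly_act A (Polynomial.monom 1 j) v $ i)"
      unfolding r by (rule poly_act_eq_sum[OF A v i]) (rule coeff_mod_eq_0[OF f])
    then show "(krylov_mat A (Polynomial.degree f) v *\<^sub>v residue_vec f r) $ i = poly_act A r v $ i"
      using i A by (auto simp: krylov_mat_def residue_vec_def scalar_prod_def mult.commute intro!: sum.cong)
  qed (use A carrier_vecD[OF poly_act_closed[OF A v]] in \<open>simp add: krylov_mat_def\<close>)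
qed

lemma krylov_mat_closed:
  "A \<in> carrier_mat n n \<Longrightarrow> krylov_mat A d v \<in> carrier_mat n d"
  by (simp add: krylov_mat_def)

lemma krylov_mat_companion:
  assumes A: "A \<in> carrier_mat n n" and v: "v \<in> carrier_vec n"
    and f: "Polynomial.lead_coeff f = 1" and fv: "poly_act A f v = 0\<^sub>v n"
  shows "A * krylov_mat A (Polynomial.degree f) v = krylov_mat A (Polynomial.degree f) v * companion_mat f"
proof (rule mat_eq_by_vec)
  have f0: "f \<noteq> 0" using f by auto
  let ?d = "Polynomial.degree f"
  let ?B = "krylov_mat A ?d v"
  have B: "?B \<in> carrier_mat n ?d" by (rule krylov_mat_closed[OF A])
  show "A * ?B \<in> carrier_mat n ?d" "?B * companion_mat f \<in> carrier_mat n ?d"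
    using A B companion_mat_closed by (auto intro: mult_carrier_mat)
  fix x :: "'a vec" assume x: "x \<in> carrier_vec ?d"
  then obtain r where r: "x = residue_vec f r" using residue_vec_surj by blast
  have "A *\<^sub>v poly_act A r v = poly_act A (pCons 0 r) v"
    using v A by (simp add: poly_act_pCons[OF A v]) (auto intro!: eq_vecI)
  then show "(A * ?B) *\<^sub>v x = (?B * companion_mat f) *\<^sub>v x"
    using assoc_mult_mat_vec[OF A B x] assoc_mult_mat_vec[OF B companion_mat_closed x]
    by (simp add: r companion_mat_residue_vec[OF f] krylov_mat_residue_vec[OF A v f0 fv])
qed

section \<open>Existence of elementary divisors\<close>

text \<open>A divisor of least positive degree is irreducible; it is then scaled to be
  monic.\<close>

lemma exists_irreducible_monic_factor:
  assumes "0 < Polynomial.degree (f :: 'a :: field poly)"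
  obtains p where "Factorial_Ring.irreducible p" "Polynomial.lead_coeff p = 1" "p dvd f"
proof -
  define P where "P = (\<lambda>p. p dvd f \<and> 0 < Polynomial.degree p)"
  have "P f" using assms by (simp add: P_def)
  define p where "p = arg_min Polynomial.degree P"
  have p: "P p" unfolding p_def using \<open>P f\<close> by (rule arg_min_natI)
  have least: "Polynomial.degree p \<le> Polynomial.degree r" if "P r" for r
    unfolding p_def by (rule arg_min_nat_le[of P r Polynomial.degree, OF that])
  have p0: "p \<noteq> 0" using p by (auto simp: P_def)
  have irr: "Factorial_Ring.irreducible p"
  proof (rule Factorial_Ring.irreducibleI)
    show "\<not> p dvd 1" using p p0 by (simp add: P_def is_unit_iff_degree)
    fix a b assume ab: "p = a * b"
    show "a dvd 1 \<or> b dvd 1"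
    proof (rule ccontr)
      assume "\<not> ?thesis"
      moreover have "a \<noteq> 0" "b \<noteq> 0" using p0 ab by auto
      ultimately have "0 < Polynomial.degree a" "0 < Polynomial.degree b" by (simp_all add: is_unit_iff_degree)
      moreover have "P a" using p ab \<open>0 < Polynomial.degree a\<close> by (auto simp: P_def intro: dvd_trans)
      ultimately show False
        using least[of a] ab \<open>a \<noteq> 0\<close> \<open>b \<noteq> 0\<close> by (simp add: degree_mult_eq)
    qed
  qed fact
  define c where "c = inverse (Polynomial.lead_coeff p)"
  have c: "c \<noteq> 0" using p0 by (simp add: c_def)
  have u: "[:c:] dvd 1" using c by (simp add: is_unit_const_poly_iff dvd_field_iff)
  have eq: "Polynomial.smult c p = [:c:] * p" by simp
  have "Factorial_Ring.irreducible (Polynomial.smult c p)"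
    unfolding eq using irr u by (simp only: Factorial_Ring.irreducible_mult_unit_left)
  moreover have "Polynomial.lead_coeff (Polynomial.smult c p) = 1" using p0 by (simp add: c_def)
  moreover have "Polynomial.smult c p dvd f" using p c by (simp add: P_def smult_dvd_iff)
  ultimately show ?thesis by (rule that)
qed

text \<open>The annihilator of \<open>y\<close> is an ideal with generator \<open>a\<close>, proper
  because \<open>y\<close> is nonzero. It contains \<open>p\<close>, so \<open>a\<close> is a
  non-unit divisor of the irreducible \<open>p\<close>, hence a multiple of
  \<open>p\<close>.\<close>

lemma irreducible_dvd_annihilator:
  assumes A: "(A :: 'a :: field mat) \<in> carrier_mat n n" and y: "y \<in> carrier_vec n" "y \<noteq> 0\<^sub>v n"
    and p: "Factorial_Ring.irreducible p" and py: "poly_act A p y = 0\<^sub>v n" and ry: "poly_act A r y = 0\<^sub>v n"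
  shows "p dvd r"
proof -
  define P where "P = (\<lambda>a. a \<noteq> 0 \<and> poly_act A a y = 0\<^sub>v n)"
  have "P p" using py p by (auto simp: P_def)
  define a where "a = arg_min Polynomial.degree P"
  have a: "P a" unfolding a_def using \<open>P p\<close> by (rule arg_min_natI)
  have dvd: "a dvd s" if s: "poly_act A s y = 0\<^sub>v n" for s
  proof (rule ccontr)
    assume nd: "\<not> a dvd s"
    have "poly_act A (s - s div a * a) y = 0\<^sub>v n"
      using a s y by (simp add: P_def poly_act_diff[OF A] poly_act_mult[OF A] poly_act_zero_vec[OF A])
    then have "P (s mod a)" using nd by (simp add: P_def minus_div_mult_eq_mod dvd_eq_mod_eq_0)
    then have "Polynomial.degree a \<le> Polynomial.degree (s mod a)"
      unfolding a_def by (rule arg_min_nat_le)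
    then show False using degree_mod_less_degree[of a s] nd a by (auto simp: P_def)
  qed
  have "\<not> a dvd 1"
  proof
    assume "a dvd 1"
    then obtain c where c: "1 = c * a" by (metis dvdE mult.commute)
    have "y = poly_act A (c * a) y" using poly_act_1[OF A y(1)] c by simp
    also have "\<dots> = 0\<^sub>v n" using a y by (simp add: poly_act_mult[OF A] P_def poly_act_zero_vec[OF A])
    finally show False using y by simp
  qed
  then have "p dvd a" using Factorial_Ring.irreducibleD'[OF p dvd[OF py]] by blast
  then show ?thesis using dvd[OF ry] by (rule dvd_trans)
qed

text \<open>The factor \<open>p\<close> is split off one power at a time: if
  \<open>r = p^i s\<close> with \<open>i \<le> m\<close>, then applying
  \<open>p^(m-i) r = p^m s\<close> to \<open>w\<close> shows that \<open>s\<close> kills the nonzero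
  vector \<open>p^m w\<close>, which \<open>p\<close> kills too; hence \<open>p\<close> divides
  \<open>s\<close>.\<close>

lemma prime_power_dvd_annihilator:
  assumes A: "(A :: 'a :: field mat) \<in> carrier_mat n n" and w: "w \<in> carrier_vec n"
    and p: "Factorial_Ring.irreducible p" and pw: "poly_act A (p ^ Suc m) w = 0\<^sub>v n"
    and pw': "poly_act A (p ^ m) w \<noteq> 0\<^sub>v n" and rw: "poly_act A r w = 0\<^sub>v n"
  shows "p ^ Suc m dvd r"
proof -
  have "i \<le> Suc m \<Longrightarrow> p ^ i dvd r" for i
  proof (induction i)
    case 0
    show ?case by simp
  next
    case (Suc i)
    then obtain s where s: "r = p ^ i * s" by auto
    have im: "m = (m - i) + i" using Suc by simp
    have "poly_act A s (poly_act A (p ^ m) w) = poly_act A (p ^ (m - i) * r) w"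
      by (subst im) (simp add: power_add s poly_act_mult[OF A w, symmetric] mult_ac)
    also have "\<dots> = 0\<^sub>v n" using rw by (simp add: poly_act_mult[OF A w] poly_act_zero_vec[OF A])
    finally have s0: "poly_act A s (poly_act A (p ^ m) w) = 0\<^sub>v n" .
    have "poly_act A p (poly_act A (p ^ m) w) = 0\<^sub>v n"
      using pw by (simp add: poly_act_mult[OF A w])
    then have "p dvd s" by (rule irreducible_dvd_annihilator[OF A poly_act_closed[OF A w] pw' p _ s0])
    then show ?case by (simp add: s mult_dvd_mono mult.commute)
  qed
  then show ?thesis by blast
qed

section \<open>Vectors over a finite field and their cyclic subspaces\<close>

lemma carrier_vec_eq_image: "carrier_vec n = vec_of_list ` {xs. set xs \<subseteq> UNIV \<and> length xs = n}"
proof (intro equalityI subsetI)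
  fix v :: "'a vec" assume v: "v \<in> carrier_vec n"
  then have "list_of_vec v \<in> {xs. set xs \<subseteq> UNIV \<and> length xs = n}" by simp
  then show "v \<in> vec_of_list ` {xs. set xs \<subseteq> UNIV \<and> length xs = n}"
    by (rule rev_image_eqI) (simp add: vec_list)
next
  fix v :: "'a vec" assume "v \<in> vec_of_list ` {xs. set xs \<subseteq> UNIV \<and> length xs = n}"
  then show "v \<in> carrier_vec n" by (auto intro: carrier_vecI)
qed

lemma finite_carrier_vec [simp]: "finite (carrier_vec n :: 'a :: finite vec set)"
  unfolding carrier_vec_eq_image by (intro finite_imageI finite_lists_length_eq) simp

lemma card_carrier_vec: "card (carrier_vec n :: 'a :: finite vec set) = CARD('a) ^ n"
proof -
  have "inj_on (vec_of_list :: 'a list \<Rightarrow> _) {xs. set xs \<subseteq> UNIV \<and> length xs = n}"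
    by (rule inj_on_inverseI[of _ list_of_vec]) (rule list_vec)
  then show ?thesis
    unfolding carrier_vec_eq_image using card_lists_length_eq[of "UNIV :: 'a set" n] by (simp add: card_image)
qed

text \<open>Pigeonhole: the powers of \<open>A\<close> are maps of a finite set into itself, so two
  of them coincide and the difference of the two monomials annihilates everything.\<close>

lemma exists_annihilating_poly:
  assumes A: "(A :: 'a :: {field, finite} mat) \<in> carrier_mat n n"
  shows "\<exists>f. f \<noteq> 0 \<and> (\<forall>v\<in>carrier_vec n. poly_act A f v = 0\<^sub>v n)"
proof -
  define F where "F i = restrict (poly_act A (Polynomial.monom 1 i)) (carrier_vec n)" for i
  let ?S = "(carrier_vec n :: 'a vec set) \<rightarrow>\<^sub>E (carrier_vec n :: 'a vec set)"
  have "F i \<in> ?S" for i unfolding F_def using poly_act_closed[OF A] by (simp add: PiE_iff)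
  then have "range F \<subseteq> ?S" by blast
  moreover have "finite ?S" by (rule finite_PiE) (rule finite_carrier_vec)+
  ultimately have "finite (range F)" using finite_subset by blast
  then have "\<not> inj F" using finite_imageD infinite_UNIV_nat by blast
  then obtain i j where ij: "i \<noteq> j" "F i = F j" unfolding inj_def by blast
  show ?thesis
  proof (intro exI conjI ballI)
    show "Polynomial.monom (1 :: 'a) i - Polynomial.monom 1 j \<noteq> 0"
      using ij by (simp add: monom_eq_iff')
    fix v :: "'a vec" assume v: "v \<in> carrier_vec n"
    have "F i v = F j v" using ij by simp
    then show "poly_act A (Polynomial.monom 1 i - Polynomial.monom 1 j) v = 0\<^sub>v n"
      using v poly_act_closed[OF A v] by (simp add: F_def poly_act_diff[OF A v])
  qed
qed

text \<open>With \<open>f\<close> the minimal polynomial and \<open>h\<close> the exact power of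
  \<open>p\<close> in it, a vector of order \<open>h\<close> spans a cyclic subspace that splits
  off. The reason is that \<open>F[t]/(h)\<close> is self-dual: the top coefficient of a product
  modulo \<open>h\<close> is a nondegenerate pairing, and a functional inducing it cuts out an
  invariant complement.\<close>

lemma prime_power_cyclic_summand:
  assumes A: "(A :: 'a :: {field, finite} mat) \<in> carrier_mat n n" and n: "0 < n"
  obtains p m A' where "Factorial_Ring.irreducible p" "Polynomial.lead_coeff p = 1"
    "Polynomial.degree (p ^ Suc m) \<le> n" "0 < Polynomial.degree (p ^ Suc m)"
    "A' \<in> carrier_mat (n - Polynomial.degree (p ^ Suc m)) (n - Polynomial.degree (p ^ Suc m))"
    "similar_mat A (four_block_mat (companion_mat (p ^ Suc m))
      (0\<^sub>m (Polynomial.degree (p ^ Suc m)) (n - Polynomial.degree (p ^ Suc m)))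
      (0\<^sub>m (n - Polynomial.degree (p ^ Suc m)) (Polynomial.degree (p ^ Suc m))) A')"
proof -
  define P where "P = (\<lambda>f. f \<noteq> 0 \<and> (\<forall>v\<in>carrier_vec n. poly_act A f v = 0\<^sub>v n))"
  obtain f0 where "P f0" using exists_annihilating_poly[OF A] unfolding P_def by blast
  define f where "f = arg_min Polynomial.degree P"
  have Pf: "P f" unfolding f_def using \<open>P f0\<close> by (rule arg_min_natI)
  have least: "Polynomial.degree f \<le> Polynomial.degree r" if "P r" for r
    unfolding f_def by (rule arg_min_nat_le[of P r Polynomial.degree, OF that])
  have f: "f \<noteq> 0" and fv: "\<And>v. v \<in> carrier_vec n \<Longrightarrow> poly_act A f v = 0\<^sub>v n" using Pf by (auto simp: P_def)
  have "Polynomial.degree f \<noteq> 0"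
  proof
    assume "Polynomial.degree f = 0"
    then obtain c where c: "f = [:c:]" "c \<noteq> 0" using f by (cases f) (auto split: if_splits)
    have "c \<cdot>\<^sub>v unit_vec n 0 = 0\<^sub>v n" using fv[of "unit_vec n 0"] c poly_act_const[OF A, of "unit_vec n 0"] by simp
    then have "(c \<cdot>\<^sub>v unit_vec n 0) $ 0 = (0\<^sub>v n :: 'a vec) $ 0" by simp
    then show False using c n by simp
  qed
  then have "0 < Polynomial.degree f" by simp
  then obtain p where p: "Factorial_Ring.irreducible p" and monic: "Polynomial.lead_coeff p = 1" and "p dvd f"
    by (rule exists_irreducible_monic_factor)
  then obtain f1 where f1: "f = p * f1" by auto
  have p0: "p \<noteq> 0" using monic by auto
  have deg_p: "0 < Polynomial.degree p"
    using is_unit_iff_degree[OF p0] Factorial_Ring.irreducible_not_unit[OF p] by simp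
  define Q where "Q = (\<lambda>m. p ^ Suc m dvd f)"
  have Q0: "Q 0" using f1 by (simp add: Q_def)
  have Qle: "m \<le> Polynomial.degree f" if "Q m" for m
  proof -
    have "Polynomial.degree (p ^ Suc m) \<le> Polynomial.degree f"
      using that f unfolding Q_def by (rule dvd_imp_degree_le)
    moreover have "Suc m \<le> Polynomial.degree (p ^ Suc m)"
      using mult_le_mono2[of 1 "Polynomial.degree p" "Suc m"] deg_p
      by (simp add: degree_power_eq[OF p0] del: power_Suc)
    ultimately show ?thesis by simp
  qed
  define m where "m = Greatest Q"
  have Qm: "Q m" unfolding m_def by (rule GreatestI_nat[of Q, OF Q0]) (rule Qle)
  have Qmax: "\<not> Q (Suc m)" using Greatest_le_nat[of Q "Suc m" "Polynomial.degree f"] Qle unfolding m_def by force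
  define h where "h = p ^ Suc m"
  obtain b where b: "f = h * b" using Qm by (auto simp: Q_def h_def)
  have pb: "\<not> p dvd b"
  proof
    assume "p dvd b"
    then have "p ^ Suc (Suc m) dvd f" unfolding b h_def power_Suc2[of p "Suc m"] by (rule mult_dvd_mono[OF dvd_refl])
    then show False using Qmax by (simp add: Q_def)
  qed
  have h_monic: "Polynomial.lead_coeff h = 1" unfolding h_def using monic by (simp only: lead_coeff_power power_one)
  have h0: "h \<noteq> 0" using h_monic by auto
  define d where "d = Polynomial.degree h"
  have d: "0 < d" unfolding d_def h_def using deg_p by (simp add: degree_power_eq[OF p0] del: power_Suc)
  have "\<not> P (p ^ m * b)"
  proof
    assume P: "P (p ^ m * b)"
    have "f = p * (p ^ m * b)" by (simp add: b h_def mult.assoc)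
    then have "Polynomial.degree f = Polynomial.degree p + Polynomial.degree (p ^ m * b)"
      using P p0 degree_mult_eq[of p "p ^ m * b"] by (simp add: P_def)
    then show False using least[OF P] deg_p by simp
  qed
  moreover have "p ^ m * b \<noteq> 0" using f p0 b by auto
  ultimately obtain v0 where v0: "v0 \<in> carrier_vec n" and nz: "poly_act A (p ^ m * b) v0 \<noteq> 0\<^sub>v n"
    by (auto simp: P_def)
  \<comment> \<open>By minimality of \<open>f\<close> some \<open>v0\<close> survives
    \<open>p^m b\<close>; so \<open>v\<close> is killed by \<open>h = p^(m+1)\<close> but not by
    \<open>p^m\<close>. Applying \<open>b\<close> once more gives \<open>w\<close> of the same
    order, because \<open>b\<close> is prime to \<open>p\<close>.\<close>
  define v where "v = poly_act A b v0"
  define w where "w = poly_act A b v"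
  have v: "v \<in> carrier_vec n" unfolding v_def by (rule poly_act_closed[OF A v0])
  have w: "w \<in> carrier_vec n" unfolding w_def by (rule poly_act_closed[OF A v])
  have hv: "poly_act A h v = 0\<^sub>v n" using fv[OF v0] by (simp add: v_def b poly_act_mult[OF A v0])
  have hw: "poly_act A h w = 0\<^sub>v n"
    by (simp add: w_def poly_act_commute[OF A v, of h b] hv poly_act_zero_vec[OF A])
  have pv: "poly_act A (p ^ m) v \<noteq> 0\<^sub>v n" using nz by (simp add: v_def poly_act_mult[OF A v0])
  have pw: "poly_act A (p ^ m) w \<noteq> 0\<^sub>v n"
  proof
    assume "poly_act A (p ^ m) w = 0\<^sub>v n"
    then have z: "poly_act A b (poly_act A (p ^ m) v) = 0\<^sub>v n"
      by (simp add: w_def poly_act_commute[OF A v, of b])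
    have "poly_act A p (poly_act A (p ^ m) v) = 0\<^sub>v n"
      using hv by (simp add: h_def poly_act_mult[OF A v])
    from irreducible_dvd_annihilator[OF A poly_act_closed[OF A v] pv p this z] pb show False by simp
  qed
  have ann: "h dvd r" if "poly_act A r w = 0\<^sub>v n" for r
    unfolding h_def by (rule prime_power_dvd_annihilator[OF A w p hw[unfolded h_def] pw that])
  let ?Bw = "krylov_mat A d w"
  let ?B = "krylov_mat A d v"
  have Bw: "?Bw \<in> carrier_mat n d" and B: "?B \<in> carrier_mat n d" using krylov_mat_closed[OF A] by auto
  have Bwr: "?Bw *\<^sub>v residue_vec h r = poly_act A r w" for r
    unfolding d_def by (rule krylov_mat_residue_vec[OF A w h0 hw])
  obtain L where L: "L \<in> carrier_mat d n" and LB: "L * ?Bw = 1\<^sub>m d"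
  proof (rule left_inverse_of_injective[OF Bw])
    fix x :: "'a vec" assume x: "x \<in> carrier_vec d" and z: "?Bw *\<^sub>v x = 0\<^sub>v n"
    obtain r where r: "x = residue_vec h r" using x unfolding d_def by (rule residue_vec_surj)
    have "h dvd r" using z unfolding r Bwr by (rule ann)
    then show "x = 0\<^sub>v d" using residue_vec_eq_0_iff[OF h0, of r] by (simp add: r d_def)
  qed
  \<comment> \<open>On the cyclic space of \<open>w\<close>, identified with
    \<open>F[t]/(h)\<close>, this functional reads the coefficient of \<open>t^(d-1)\<close>; the
    left inverse \<open>L\<close> extends it to all vectors.\<close>
  define \<phi> where "\<phi> = row L (d - 1)"
  have phi: "\<phi> \<in> carrier_vec n" unfolding \<phi>_def using row_carrier[of L "d - 1"] carrier_matD(2)[OF L] by simp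
  have phi_w: "\<phi> \<bullet> poly_act A r w = Polynomial.coeff (r mod h) (d - 1)" for r
  proof -
    have rd: "residue_vec h r \<in> carrier_vec d" by (simp add: d_def)
    have "\<phi> \<bullet> poly_act A r w = (L *\<^sub>v (?Bw *\<^sub>v residue_vec h r)) $ (d - 1)"
      unfolding Bwr using L d by (simp add: \<phi>_def)
    also have "\<dots> = residue_vec h r $ (d - 1)"
      unfolding assoc_mult_mat_vec[OF L Bw rd, symmetric] LB using rd by simp
    finally show ?thesis using d by (simp add: residue_vec_def d_def)
  qed
  \<comment> \<open>\<open>\<phi> \<circ> b(A)\<close> is a functional annihilated by \<open>h(A)\<close>; \<open>C\<close> collects its first \<open>d\<close> iterates, and the
    common kernel of these is an invariant complement of the cyclic subspace generated by \<open>v\<close>.\<close>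
  have "\<forall>r. \<exists>N. N \<in> carrier_mat n n \<and> (\<forall>x\<in>carrier_vec n. N *\<^sub>v x = poly_act A r x)"
    using poly_act_mat[OF A] by blast
  then obtain N where N: "\<And>r. N r \<in> carrier_mat n n"
    and Nx: "\<And>r x. x \<in> carrier_vec n \<Longrightarrow> N r *\<^sub>v x = poly_act A r x" by metis
  define C where "C = mat\<^sub>r d n (\<lambda>i. transpose_mat (N (Polynomial.monom 1 i * b)) *\<^sub>v \<phi>)"
  have C: "C \<in> carrier_mat d n" by (simp add: C_def)
  have Cx: "(C *\<^sub>v x) $ i = \<phi> \<bullet> poly_act A (Polynomial.monom 1 i) (poly_act A b x)"
    if x: "x \<in> carrier_vec n" and i: "i < d" for x i
  proof -
    have "(C *\<^sub>v x) $ i = (transpose_mat (N (Polynomial.monom 1 i * b)) *\<^sub>v \<phi>) \<bullet> x"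
      using i N[of "Polynomial.monom 1 i * b"] by (simp add: C_def)
    also have "\<dots> = \<phi> \<bullet> poly_act A (Polynomial.monom 1 i * b) x"
      using transpose_vec_mult_scalar[OF N x phi] Nx[OF x] by simp
    finally show ?thesis by (simp add: poly_act_mult[OF A x])
  qed
  have Cker: "\<phi> \<bullet> poly_act A r (poly_act A b x) = 0"
    if x: "x \<in> carrier_vec n" and Cx0: "C *\<^sub>v x = 0\<^sub>v d" for x r
  proof -
    have y: "poly_act A b x \<in> carrier_vec n" by (rule poly_act_closed[OF A x])
    have hy: "poly_act A h (poly_act A b x) = 0\<^sub>v n"
      using fv[OF x] by (simp add: b poly_act_mult[OF A x])
    have "poly_act A r (poly_act A b x) = poly_act A (r div h * h + r mod h) (poly_act A b x)" by simp
    also have "\<dots> = poly_act A (r mod h) (poly_act A b x)"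
      unfolding poly_act_add[OF A y] poly_act_mult[OF A y] hy poly_act_zero_vec[OF A]
      using poly_act_closed[OF A y] by simp
    finally have "\<phi> \<bullet> poly_act A r (poly_act A b x) = (\<Sum>j\<in>{0..<d}.
        Polynomial.coeff (r mod h) j * (\<phi> \<bullet> poly_act A (Polynomial.monom 1 j) (poly_act A b x)))"
      using scalar_prod_poly_act[OF A y phi, of d "r mod h"] coeff_mod_eq_0[OF h0, of _ r] by (simp add: d_def)
    also have "\<dots> = 0"
    proof (rule sum.neutral, rule ballI)
      fix j assume "j \<in> {0..<d}"
      then show "Polynomial.coeff (r mod h) j * (\<phi> \<bullet> poly_act A (Polynomial.monom 1 j) (poly_act A b x)) = 0"
        using Cx[OF x, of j] Cx0 by simp
    qed
    finally show ?thesis .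
  qed
  have CA: "C *\<^sub>v (A *\<^sub>v x) = 0\<^sub>v d" if x: "x \<in> carrier_vec n" and Cx0: "C *\<^sub>v x = 0\<^sub>v d" for x
  proof (rule eq_vecI)
    fix i assume "i < dim_vec (0\<^sub>v d :: 'a vec)"
    then have i: "i < d" by simp
    have Ax: "A *\<^sub>v x \<in> carrier_vec n" using A x by simp
    have Ax': "A *\<^sub>v x = poly_act A [:0, 1:] x" using poly_act_linear[OF A x, of 0] Ax x zero_smult_vec[OF A x] by simp
    have "poly_act A (Polynomial.monom 1 i) (poly_act A b (A *\<^sub>v x))
        = poly_act A (Polynomial.monom 1 i * [:0, 1:]) (poly_act A b x)"
      unfolding Ax' poly_act_mult[OF A poly_act_closed[OF A x]] poly_act_commute[OF A x, of b "[:0,1:]"] by (rule refl)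
    then show "(C *\<^sub>v (A *\<^sub>v x)) $ i = 0\<^sub>v d $ i"
      using Cx[OF Ax i] Cker[OF x Cx0] i by simp
  qed (use C in simp)
  have CB: "C * ?B \<in> carrier_mat d d" using C B by simp
  obtain H where H: "H \<in> carrier_mat d d" and HCB: "H * (C * ?B) = 1\<^sub>m d"
  proof (rule mat_inverse_of_injective[OF CB])
    fix x :: "'a vec" assume x: "x \<in> carrier_vec d" and z: "(C * ?B) *\<^sub>v x = 0\<^sub>v d"
    obtain r where r: "x = residue_vec h r" using x unfolding d_def by (rule residue_vec_surj)
    have Bx: "?B *\<^sub>v x = poly_act A r v"
      unfolding r d_def by (rule krylov_mat_residue_vec[OF A v h0 hv])
    have rv: "poly_act A r v \<in> carrier_vec n" by (rule poly_act_closed[OF A v])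
    have "C *\<^sub>v poly_act A r v = 0\<^sub>v d" using z assoc_mult_mat_vec[OF C B x] Bx by simp
    then have zero: "\<phi> \<bullet> poly_act A s (poly_act A b (poly_act A r v)) = 0" for s
      by (rule Cker[OF rv])
    have c0: "Polynomial.coeff ((s * r) mod h) (d - 1) = 0" for s
    proof -
      have "poly_act A s (poly_act A b (poly_act A r v)) = poly_act A (s * r) w"
        by (simp add: w_def poly_act_commute[OF A v, of b r] poly_act_mult[OF A poly_act_closed[OF A v]])
      then show ?thesis using zero[of s] phi_w[of "s * r"] by simp
    qed
    have "r mod h = 0"
    proof (rule ccontr)
      assume nz: "r mod h \<noteq> 0"
      \<comment> \<open>Multiplication by \<open>t^(d-1-e)\<close> moves the leading coefficient of
        \<open>r mod h\<close> to degree \<open>d - 1\<close> without any reduction modulo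
        \<open>h\<close>, where \<open>\<phi>\<close> sees it. This is the nondegeneracy of the
        pairing.\<close>
      define e where "e = Polynomial.degree (r mod h)"
      have e: "e < d" unfolding e_def d_def using degree_mod_less'[OF h0 nz] .
      define s where "s = Polynomial.monom (1 :: 'a) (d - 1 - e)"
      have "Polynomial.degree (s * (r mod h)) = d - 1"
        using nz e by (simp add: s_def degree_mult_eq monom_eq_0_iff degree_monom_eq flip: e_def)
      then have "(s * (r mod h)) mod h = s * (r mod h)" using d by (intro mod_poly_less) (simp add: d_def)
      moreover have "(s * r) mod h = (s * (r mod h)) mod h" by (simp add: mod_mult_right_eq)
      moreover have "Polynomial.coeff (s * (r mod h)) (d - 1) = Polynomial.coeff (r mod h) e"
        using e by (simp add: s_def coeff_monom_mult)
      ultimately show False using c0[of s] nz by (simp add: e_def)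
    qed
    then show "x = 0\<^sub>v d" using residue_vec_eq_0_iff[OF h0, of r] by (simp add: r d_def dvd_eq_mod_eq_0)
  qed
  have AB: "A * ?B = ?B * companion_mat h"
    unfolding d_def by (rule krylov_mat_companion[OF A v h_monic hv])
  have comp: "companion_mat h \<in> carrier_mat d d" by (simp add: d_def)
  obtain A' where A': "d \<le> n" "A' \<in> carrier_mat (n - d) (n - d)"
    "similar_mat A (four_block_mat (companion_mat h) (0\<^sub>m d (n - d)) (0\<^sub>m (n - d) d) A')"
    using similar_block_diag_of_split[OF A B C comp AB CA H HCB] by blast
  show ?thesis
    by (rule that[of p m A', folded h_def, folded d_def]) (use p monic A' d in auto)
qed

text \<open>Needed to exploit the absence of a block, which says something only about lists that
  exist, and to diagonalise an involution.\<close>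

theorem elementary_divisors_exist:
  assumes "(A :: 'a :: {field, finite} mat) \<in> carrier_mat n n"
  shows "\<exists>fs. elementary_divisors A fs"
  using assms
proof (induction n arbitrary: A rule: less_induct)
  case (less n A)
  show ?case
  proof (cases "n = 0")
    case True
    then have "A = 0\<^sub>m 0 0" using less.prems by auto
    then have "elementary_divisors A []"
      unfolding elementary_divisors_def using similar_mat_refl[OF less.prems] by simp
    then show ?thesis ..
  next
    case False
    then have "0 < n" by simp
    then obtain p m A' where p: "Factorial_Ring.irreducible p" "Polynomial.lead_coeff p = 1"
      and le: "Polynomial.degree (p ^ Suc m) \<le> n" "0 < Polynomial.degree (p ^ Suc m)"
      and A': "A' \<in> carrier_mat (n - Polynomial.degree (p ^ Suc m)) (n - Polynomial.degree (p ^ Suc m))"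
      and sim: "similar_mat A (four_block_mat (companion_mat (p ^ Suc m))
        (0\<^sub>m (Polynomial.degree (p ^ Suc m)) (n - Polynomial.degree (p ^ Suc m)))
        (0\<^sub>m (n - Polynomial.degree (p ^ Suc m)) (Polynomial.degree (p ^ Suc m))) A')"
      by (rule prime_power_cyclic_summand[OF less.prems])
    define h where "h = p ^ Suc m"
    define d where "d = Polynomial.degree h"
    have "n - d < n" using le(2) \<open>0 < n\<close> by (simp add: d_def h_def)
    then obtain fs where fs: "elementary_divisors A' fs"
      using less.IH[of "n - d" A'] A' unfolding d_def h_def by blast
    let ?D = "diag_block_mat (map companion_mat fs)"
    have simA': "similar_mat A' ?D" using fs by (simp add: elementary_divisors_def)
    then have D: "?D \<in> carrier_mat (n - d) (n - d)"
      using similar_matD[OF simA'] A' unfolding d_def h_def by fastforce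
    have comp: "companion_mat h \<in> carrier_mat d d" by (simp add: d_def)
    have A'': "A' \<in> carrier_mat (n - d) (n - d)" using A' unfolding d_def h_def .
    have "similar_mat A (four_block_mat (companion_mat h) (0\<^sub>m d (n - d)) (0\<^sub>m (n - d) d) ?D)"
      using similar_mat_trans[OF sim[folded h_def, folded d_def]
        similar_mat_four_block_0_0[OF similar_mat_refl[OF comp] simA' comp A'']] .
    moreover have "diag_block_mat (map companion_mat (h # fs))
        = four_block_mat (companion_mat h) (0\<^sub>m d (n - d)) (0\<^sub>m (n - d) d) ?D"
      using D comp by (simp add: Let_def)
    moreover have "\<exists>p k. Polynomial.lead_coeff p = 1 \<and> Factorial_Ring.irreducible p \<and> 1 \<le> k \<and> f = p ^ k"
      if "f \<in> set (h # fs)" for f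
    proof (cases "f = h")
      case True
      then show ?thesis using p by (intro exI[of _ p] exI[of _ "Suc m"]) (simp add: h_def)
    next
      case False
      then show ?thesis using that fs unfolding elementary_divisors_def by simp
    qed
    ultimately have "elementary_divisors A (h # fs)"
      unfolding elementary_divisors_def by metis
    then show ?thesis ..
  qed
qed

section \<open>Elementary divisors of a linear factor\<close>

lemma similar_mat_intertwiner:
  assumes "similar_mat A (B :: 'a :: field mat)"
  obtains n P Q where "A \<in> carrier_mat n n" "B \<in> carrier_mat n n" "P \<in> carrier_mat n n" "Q \<in> carrier_mat n n"
    "A * P = P * B" "B * Q = Q * A" "\<And>v. v \<in> carrier_vec n \<Longrightarrow> P *\<^sub>v (Q *\<^sub>v v) = v"
    "\<And>v. v \<in> carrier_vec n \<Longrightarrow> Q *\<^sub>v (P *\<^sub>v v) = v"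
proof -
  obtain n P Q where c: "{A, B, P, Q} \<subseteq> carrier_mat n n" and PQ: "P * Q = 1\<^sub>m n" "Q * P = 1\<^sub>m n"
    and AB: "A = P * B * Q" using similar_matD[OF assms] by blast
  then have A: "A \<in> carrier_mat n n" and B: "B \<in> carrier_mat n n" and P: "P \<in> carrier_mat n n"
    and Q: "Q \<in> carrier_mat n n" by auto
  have PB: "P * B \<in> carrier_mat n n" and BQ: "B * Q \<in> carrier_mat n n" using P B Q by auto
  have AP: "A * P = P * B"
    unfolding AB assoc_mult_mat[OF PB Q P] PQ by (rule right_mult_one_mat[OF PB])
  have QA: "Q * A = B * Q"
    unfolding AB assoc_mult_mat[OF P B Q] assoc_mult_mat[OF Q P BQ, symmetric] PQ by (rule left_mult_one_mat[OF BQ])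
  have "P *\<^sub>v (Q *\<^sub>v v) = v" "Q *\<^sub>v (P *\<^sub>v v) = v" if v: "v \<in> carrier_vec n" for v
    unfolding assoc_mult_mat_vec[OF P Q v, symmetric] assoc_mult_mat_vec[OF Q P v, symmetric] PQ
    using v by simp_all
  then show ?thesis using that[OF A B P Q AP QA[symmetric]] by blast
qed

text \<open>The vector \<open>x\<close> and the functional \<open>r\<close> detect a direct summand \<open>F[t]/((t - c)^k)\<close>.\<close>

definition jordan_block_witness :: "'a :: field mat \<Rightarrow> 'a \<Rightarrow> nat \<Rightarrow> bool" where
  "jordan_block_witness A c k \<longleftrightarrow> (\<exists>x\<in>carrier_vec (dim_row A). \<exists>r\<in>carrier_vec (dim_row A).
     poly_act A ([:- c, 1:] ^ k) x = 0\<^sub>v (dim_row A) \<and>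
     (\<forall>z\<in>carrier_vec (dim_row A). r \<bullet> poly_act A ([:- c, 1:] ^ k) z = 0) \<and>
     r \<bullet> poly_act A ([:- c, 1:] ^ (k - 1)) x \<noteq> 0)"

lemma jordan_block_witnessE:
  assumes "jordan_block_witness A c k" and A: "A \<in> carrier_mat n n"
  obtains x r where "x \<in> carrier_vec n" "r \<in> carrier_vec n" "poly_act A ([:- c, 1:] ^ k) x = 0\<^sub>v n"
    "\<And>z. z \<in> carrier_vec n \<Longrightarrow> r \<bullet> poly_act A ([:- c, 1:] ^ k) z = 0"
    "r \<bullet> poly_act A ([:- c, 1:] ^ (k - 1)) x \<noteq> 0"
proof -
  have "dim_row A = n" using A by simp
  with assms(1) show ?thesis using that unfolding jordan_block_witness_def by auto
qed

lemma jordan_block_witnessI: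
  assumes A: "A \<in> carrier_mat n n" and "x \<in> carrier_vec n" "r \<in> carrier_vec n"
    "poly_act A ([:- c, 1:] ^ k) x = 0\<^sub>v n"
    "\<And>z. z \<in> carrier_vec n \<Longrightarrow> r \<bullet> poly_act A ([:- c, 1:] ^ k) z = 0"
    "r \<bullet> poly_act A ([:- c, 1:] ^ (k - 1)) x \<noteq> 0"
  shows "jordan_block_witness A c k"
proof -
  have "dim_row A = n" using A by simp
  with assms show ?thesis unfolding jordan_block_witness_def by blast
qed

lemma degree_linear_power: "Polynomial.degree ([:c, 1:] ^ k :: 'a :: field poly) = k"
  by (simp add: degree_power_eq)

lemma monic_linear_power: "Polynomial.lead_coeff ([:c, 1:] ^ k :: 'a :: field poly) = 1"
  by (simp only: lead_coeff_power) simp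

text \<open>The vector is the class of \<open>1\<close> and the functional reads the coefficient of
  \<open>t^(k-1)\<close>; it takes the value \<open>1\<close> on the monic polynomial
  \<open>(t - c)^(k-1)\<close>.\<close>

lemma jordan_block_witness_companion:
  fixes c :: "'a :: field"
  assumes k: "0 < k"
  shows "jordan_block_witness (companion_mat ([:- c, 1:] ^ k)) c k"
proof -
  define h where "h = [:- c, 1:] ^ k"
  have deg: "Polynomial.degree h = k" unfolding h_def by (rule degree_linear_power)
  have monic: "Polynomial.lead_coeff h = 1" unfolding h_def by (rule monic_linear_power)
  have h0: "h \<noteq> 0" using monic by auto
  have C: "companion_mat h \<in> carrier_mat k k" using companion_mat_closed[of h] deg by simp
  have zero: "poly_act (companion_mat h) h z = 0\<^sub>v k" if "z \<in> carrier_vec k" for z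
  proof -
    have "z \<in> carrier_vec (Polynomial.degree h)" using that deg by simp
    then obtain s where "z = residue_vec h s" by (rule residue_vec_surj)
    then show ?thesis
      using poly_act_companion_mat[OF monic, of h s] residue_vec_eq_0_iff[OF h0, of "h * s"] deg by simp
  qed
  have x: "residue_vec h 1 \<in> carrier_vec k" using residue_vec_closed[of h 1] deg by simp
  have lt: "Polynomial.degree ([:- c, 1:] ^ (k - 1)) < Polynomial.degree h"
    unfolding degree_linear_power deg using k by simp
  have lead: "Polynomial.coeff ([:- c, 1:] ^ (k - 1)) (k - 1) = 1"
    using monic_linear_power[of "- c" "k - 1"] unfolding degree_linear_power .
  have "poly_act (companion_mat h) ([:- c, 1:] ^ (k - 1)) (residue_vec h 1) $ (k - 1) = 1"
    using poly_act_companion_mat[OF monic, of "[:- c, 1:] ^ (k - 1)" 1] k lead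
    by (simp add: residue_vec_def[of h "[:- c, 1:] ^ (k - Suc 0)"] mod_poly_less[OF lt[simplified]] deg)
  then have "unit_vec k (k - 1) \<bullet> poly_act (companion_mat h) ([:- c, 1:] ^ (k - 1)) (residue_vec h 1) \<noteq> 0"
    using k scalar_prod_left_unit[OF poly_act_closed[OF C x]] by simp
  then show ?thesis
    using jordan_block_witnessI[OF C x, of "unit_vec k (k - 1)" c k] zero x unfolding h_def
    by (simp add: h_def[symmetric])
qed

lemma vec_append_cases:
  assumes "z \<in> carrier_vec (n + m)"
  obtains u v where "z = u @\<^sub>v v" "u \<in> carrier_vec n" "v \<in> carrier_vec m"
  using that[of "vec_first z n" "vec_last z m"] vec_first_last_append[OF assms] by simp

lemma append_zero_vec: "0\<^sub>v n @\<^sub>v 0\<^sub>v m = (0\<^sub>v (n + m) :: 'a :: zero vec)"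
  by auto

lemma jordan_block_witness_four_block:
  assumes A: "A \<in> carrier_mat n n" and B: "B \<in> carrier_mat m m"
    and wit: "jordan_block_witness A c k \<or> jordan_block_witness B c k"
  shows "jordan_block_witness (four_block_mat A (0\<^sub>m n m) (0\<^sub>m m n) B) c k" (is "jordan_block_witness ?M c k")
proof -
  have M: "?M \<in> carrier_mat (n + m) (n + m)" using A B by simp
  note split = poly_act_four_block[OF A B]
  note closed = poly_act_closed[OF A] poly_act_closed[OF B]
  let ?p = "[:- c, 1:] ^ k" and ?p' = "[:- c, 1:] ^ (k - 1)"
  \<comment> \<open>Both cases are brought into one form by zero vectors in the idle block, so that
    the concatenation below is done once.\<close>
  have "\<exists>x\<in>carrier_vec n. \<exists>y\<in>carrier_vec m. \<exists>r\<in>carrier_vec n. \<exists>s\<in>carrier_vec m.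
    poly_act A ?p x = 0\<^sub>v n \<and> poly_act B ?p y = 0\<^sub>v m \<and>
    (\<forall>z\<in>carrier_vec n. r \<bullet> poly_act A ?p z = 0) \<and> (\<forall>z\<in>carrier_vec m. s \<bullet> poly_act B ?p z = 0) \<and>
    r \<bullet> poly_act A ?p' x + s \<bullet> poly_act B ?p' y \<noteq> 0"
    using wit
  proof
    assume "jordan_block_witness A c k"
    then obtain x r where w: "x \<in> carrier_vec n" "r \<in> carrier_vec n" "poly_act A ?p x = 0\<^sub>v n"
      "\<And>z. z \<in> carrier_vec n \<Longrightarrow> r \<bullet> poly_act A ?p z = 0" "r \<bullet> poly_act A ?p' x \<noteq> 0"
      using jordan_block_witnessE[OF _ A] by metis
    show ?thesis
      by (rule bexI[of _ "x"], rule bexI[of _ "0\<^sub>v m"], rule bexI[of _ "r"], rule bexI[of _ "0\<^sub>v m"])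
        (use w in \<open>auto simp: poly_act_zero_vec[OF B] scalar_prod_left_zero[OF closed(2)]\<close>)
  next
    assume "jordan_block_witness B c k"
    then obtain x r where w: "x \<in> carrier_vec m" "r \<in> carrier_vec m" "poly_act B ?p x = 0\<^sub>v m"
      "\<And>z. z \<in> carrier_vec m \<Longrightarrow> r \<bullet> poly_act B ?p z = 0" "r \<bullet> poly_act B ?p' x \<noteq> 0"
      using jordan_block_witnessE[OF _ B] by metis
    show ?thesis
      by (rule bexI[of _ "0\<^sub>v n"], rule bexI[of _ "x"], rule bexI[of _ "0\<^sub>v n"], rule bexI[of _ "r"])
        (use w in \<open>auto simp: poly_act_zero_vec[OF A] scalar_prod_left_zero[OF closed(1)]\<close>)
  qed
  then obtain x y r s where c: "x \<in> carrier_vec n" "y \<in> carrier_vec m" "r \<in> carrier_vec n" "s \<in> carrier_vec m"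
    and ker: "poly_act A ?p x = 0\<^sub>v n" "poly_act B ?p y = 0\<^sub>v m"
    and im: "\<And>z. z \<in> carrier_vec n \<Longrightarrow> r \<bullet> poly_act A ?p z = 0" "\<And>z. z \<in> carrier_vec m \<Longrightarrow> s \<bullet> poly_act B ?p z = 0"
    and nz: "r \<bullet> poly_act A ?p' x + s \<bullet> poly_act B ?p' y \<noteq> 0" by blast
  have prod: "(r @\<^sub>v s) \<bullet> poly_act ?M f (u @\<^sub>v v) = r \<bullet> poly_act A f u + s \<bullet> poly_act B f v"
    if "u \<in> carrier_vec n" "v \<in> carrier_vec m" for f u v
    unfolding split[OF that] by (rule scalar_prod_append[OF c(3,4) closed(1)[OF that(1)] closed(2)[OF that(2)]])
  show ?thesis
  proof (rule jordan_block_witnessI[OF M, of "x @\<^sub>v y" "r @\<^sub>v s"])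
    show "poly_act ?M ?p (x @\<^sub>v y) = 0\<^sub>v (n + m)" unfolding split[OF c(1,2)] ker by (rule append_zero_vec)
    show "(r @\<^sub>v s) \<bullet> poly_act ?M ?p z = 0" if z: "z \<in> carrier_vec (n + m)" for z
    proof -
      obtain u v where uv: "z = u @\<^sub>v v" "u \<in> carrier_vec n" "v \<in> carrier_vec m"
        using z by (rule vec_append_cases)
      then show ?thesis using prod[OF uv(2,3)] im by simp
    qed
    show "(r @\<^sub>v s) \<bullet> poly_act ?M ?p' (x @\<^sub>v y) \<noteq> 0" unfolding prod[OF c(1,2)] by (rule nz)
  qed (use c in auto)
qed

lemma diag_companion_closed:
  "\<exists>m. diag_block_mat (map companion_mat fs) \<in> carrier_mat m m"
proof -
  have "dim_row (diag_block_mat (map companion_mat fs)) = dim_col (diag_block_mat (map companion_mat fs))"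
    by (induction fs) (simp_all add: Let_def companion_mat_def)
  then show ?thesis by (metis carrier_mat_triv)
qed

lemma diag_companion_Cons:
  assumes "diag_block_mat (map companion_mat fs) \<in> carrier_mat m m"
  shows "diag_block_mat (map companion_mat (f # fs)) = four_block_mat (companion_mat f)
    (0\<^sub>m (Polynomial.degree f) m) (0\<^sub>m m (Polynomial.degree f)) (diag_block_mat (map companion_mat fs))"
  using assms by (simp add: Let_def companion_mat_def)

lemma jordan_block_witness_diag:
  assumes k: "0 < k"
  shows "[:- c, 1:] ^ k \<in> set fs \<Longrightarrow> jordan_block_witness (diag_block_mat (map companion_mat fs)) c k"
proof (induction fs)
  case (Cons f fs)
  obtain m where m: "diag_block_mat (map companion_mat fs) \<in> carrier_mat m m"
    using diag_companion_closed by blast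
  show ?case
    unfolding diag_companion_Cons[OF m]
    by (rule jordan_block_witness_four_block[OF companion_mat_closed m])
      (use Cons jordan_block_witness_companion[OF k, of c] in auto)
qed simp

lemma jordan_block_witness_similar:
  assumes sim: "similar_mat A B" and wit: "jordan_block_witness B c k"
  shows "jordan_block_witness A c k"
proof -
  obtain n P Q where A: "A \<in> carrier_mat n n" and B: "B \<in> carrier_mat n n" and P: "P \<in> carrier_mat n n"
    and Q: "Q \<in> carrier_mat n n" and AP: "A * P = P * B" and QA: "B * Q = Q * A"
    and QP: "\<And>v. v \<in> carrier_vec n \<Longrightarrow> Q *\<^sub>v (P *\<^sub>v v) = v"
    using similar_mat_intertwiner[OF sim] by metis
  note actP = poly_act_similar[OF A A P B AP] and actQ = poly_act_similar[OF B B Q A QA]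
  obtain x r where x: "x \<in> carrier_vec n" and r: "r \<in> carrier_vec n"
    and w: "poly_act B ([:- c, 1:] ^ k) x = 0\<^sub>v n"
      "\<And>z. z \<in> carrier_vec n \<Longrightarrow> r \<bullet> poly_act B ([:- c, 1:] ^ k) z = 0"
      "r \<bullet> poly_act B ([:- c, 1:] ^ (k - 1)) x \<noteq> 0" using jordan_block_witnessE[OF wit B] by metis
  have Px: "P *\<^sub>v x \<in> carrier_vec n" using P x by simp
  have rQ: "(transpose_mat Q *\<^sub>v r) \<bullet> poly_act A p z = r \<bullet> poly_act B p (Q *\<^sub>v z)"
    if z: "z \<in> carrier_vec n" for p z
    using transpose_vec_mult_scalar[OF Q poly_act_closed[OF A z] r] actQ[OF z] by simp
  show ?thesis
  proof (rule jordan_block_witnessI[OF A Px, of "transpose_mat Q *\<^sub>v r"])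
    show "transpose_mat Q *\<^sub>v r \<in> carrier_vec n" using Q r by (simp add: mult_mat_vec_carrier[of _ n n])
    show "poly_act A ([:- c, 1:] ^ k) (P *\<^sub>v x) = 0\<^sub>v n"
      unfolding actP[OF x] w(1) by (rule mult_mat_zero_vec[OF P])
    show "(transpose_mat Q *\<^sub>v r) \<bullet> poly_act A ([:- c, 1:] ^ k) z = 0" if z: "z \<in> carrier_vec n" for z
      unfolding rQ[OF z] by (rule w(2)) (use Q z in simp)
    show "(transpose_mat Q *\<^sub>v r) \<bullet> poly_act A ([:- c, 1:] ^ (k - 1)) (P *\<^sub>v x) \<noteq> 0"
      unfolding rQ[OF Px] QP[OF x] by (rule w(3))
  qed
qed

lemma elementary_divisor_jordan_block_witness:
  assumes "elementary_divisors A fs" "[:- c, 1:] ^ k \<in> set fs" "0 < k"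
  shows "jordan_block_witness A c k"
  using jordan_block_witness_similar jordan_block_witness_diag assms unfolding elementary_divisors_def by blast

text \<open>In odd characteristic and for \<open>s = t\<^sup>2 - 1\<close> this says that \<open>(t - 1)^k\<close> and \<open>(t + 1)^k\<close> are not elementary divisors.\<close>

definition kernel_lifts :: "'a :: field mat \<Rightarrow> 'a poly \<Rightarrow> nat \<Rightarrow> bool" where
  "kernel_lifts A s k \<longleftrightarrow> (\<forall>x\<in>carrier_vec (dim_row A). poly_act A (s ^ k) x = 0\<^sub>v (dim_row A) \<longrightarrow>
     (\<exists>y\<in>carrier_vec (dim_row A). poly_act A (s ^ (k - 1)) x = poly_act A (s ^ k) y))"

lemma kernel_lifts_iff:
  "A \<in> carrier_mat n n \<Longrightarrow> kernel_lifts A s k \<longleftrightarrow>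
    (\<forall>x\<in>carrier_vec n. poly_act A (s ^ k) x = 0\<^sub>v n \<longrightarrow>
      (\<exists>y\<in>carrier_vec n. poly_act A (s ^ (k - 1)) x = poly_act A (s ^ k) y))"
  unfolding kernel_lifts_def by simp

text \<open>Powers of \<open>p\<close> are peeled off one at a time: a nonzero vector killed by both
  \<open>p\<close> and \<open>s\<close> would force \<open>p\<close> to divide
  \<open>s\<close>.\<close>

lemma poly_act_coprime_injective:
  assumes A: "(A :: 'a :: field mat) \<in> carrier_mat n n" and x: "x \<in> carrier_vec n"
    and p: "Factorial_Ring.irreducible p" and ps: "\<not> p dvd s"
    and pj: "poly_act A (p ^ j) x = 0\<^sub>v n" and sx: "poly_act A s x = 0\<^sub>v n"
  shows "x = 0\<^sub>v n"
  using x pj sx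
proof (induction j arbitrary: x)
  case 0
  then show ?case using poly_act_1[OF A, of x] by simp
next
  case (Suc j)
  have px: "poly_act A p x \<in> carrier_vec n" by (rule poly_act_closed[OF A Suc.prems(1)])
  have "poly_act A (p ^ j) (poly_act A p x) = 0\<^sub>v n"
    using Suc.prems(2) poly_act_mult[OF A Suc.prems(1), of "p ^ j" p] by (simp add: mult.commute)
  moreover have "poly_act A s (poly_act A p x) = 0\<^sub>v n"
    using poly_act_commute[OF A Suc.prems(1), of s p] Suc.prems(3) poly_act_zero_vec[OF A] by simp
  ultimately have "poly_act A p x = 0\<^sub>v n" using Suc.IH[OF px] by blast
  then show ?case using irreducible_dvd_annihilator[OF A Suc.prems(1) _ p _ Suc.prems(3)] ps by blast
qed

lemma irreducible_monic_dvd_linear: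
  assumes p: "Factorial_Ring.irreducible p" "Polynomial.lead_coeff (p :: 'a :: field poly) = 1" and "p dvd [:c, 1:]"
  shows "p = [:c, 1:]"
proof -
  obtain q where q: "[:c, 1:] = p * q" using assms(3) by auto
  have p0: "p \<noteq> 0" "q \<noteq> 0" using q by auto
  have "0 < Polynomial.degree p"
    using is_unit_iff_degree[OF p0(1)] Factorial_Ring.irreducible_not_unit[OF p(1)] by simp
  moreover have "Polynomial.degree p + Polynomial.degree q = 1"
    using degree_mult_eq[OF p0] q by (metis degree_pCons_eq_if degree_0 one_neq_zero pCons_eq_0_iff One_nat_def)
  ultimately have "Polynomial.degree q = 0" by simp
  then obtain a where a: "q = [:a:]" by (cases q) (auto split: if_splits)
  have "Polynomial.lead_coeff [:c, 1:] = Polynomial.lead_coeff p * Polynomial.lead_coeff q"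
    unfolding q by (rule lead_coeff_mult)
  then have "a = 1" using p(2) a by simp
  then show ?thesis using q a by (simp add: one_pCons)
qed

lemma square_minus_one_factor:
  fixes c :: "'a :: field"
  assumes "c * c = 1"
  shows "[:-1, 0, 1:] = [:- c, 1:] * [:c, 1:]"
  using assms by simp

text \<open>If \<open>p\<close> is prime to \<open>t^2 - 1\<close>, the kernel is trivial. Otherwise
  \<open>p = t - c\<close> with \<open>c = 1\<close> or \<open>c = -1\<close>, and the excluded
  equality \<open>j = k\<close> leaves two cases: for \<open>j < k\<close> the left-hand vector
  vanishes, and for \<open>j > k\<close> an element killed by \<open>p^k\<close> is itself divisible
  by \<open>p\<close>.\<close>

lemma kernel_lifts_companion:
  fixes p :: "'a :: {field, finite} poly"
  assumes two: "(2 :: 'a) \<noteq> 0" and p: "Factorial_Ring.irreducible p" "Polynomial.lead_coeff p = 1" and k: "0 < k"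
    and ne: "p ^ j \<noteq> [:-1, 1:] ^ k" "p ^ j \<noteq> [:1, 1:] ^ k"
  shows "kernel_lifts (companion_mat (p ^ j)) [:-1, 0, 1:] k"
proof -
  define h where "h = p ^ j"
  define n where "n = Polynomial.degree h"
  define s :: "'a poly" where "s = [:-1, 0, 1:]"
  have monic: "Polynomial.lead_coeff h = 1" unfolding h_def using p(2) by (simp only: lead_coeff_power power_one)
  have h0: "h \<noteq> 0" using monic by auto
  have C: "companion_mat h \<in> carrier_mat n n" by (simp add: n_def)
  let ?act = "poly_act (companion_mat h)"
  have pj: "?act (p ^ j) x = 0\<^sub>v n" if x: "x \<in> carrier_vec n" for x
  proof -
    obtain r where "x = residue_vec h r" using x unfolding n_def by (rule residue_vec_surj)
    then show ?thesis
      using poly_act_companion_mat[OF monic, of h r] residue_vec_eq_0_iff[OF h0, of "h * r"]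
      by (simp add: h_def[symmetric] n_def)
  qed
  have inj: "x = 0\<^sub>v n" if "\<not> p dvd u" "x \<in> carrier_vec n" "?act u x = 0\<^sub>v n" for u x
    by (rule poly_act_coprime_injective[OF C that(2) p(1) that(1) pj[OF that(2)] that(3)])
  have prime: "prime_elem p" by (rule field_poly_irreducible_imp_prime[OF p(1)])
  have "kernel_lifts (companion_mat h) s k"
    unfolding kernel_lifts_iff[OF C]
  proof (intro ballI impI)
    fix x assume x: "x \<in> carrier_vec n" and sx: "?act (s ^ k) x = 0\<^sub>v n"
    have zero: "?act (s ^ k) (0\<^sub>v n) = 0\<^sub>v n" by (rule poly_act_zero_vec[OF C])
    show "\<exists>y\<in>carrier_vec n. ?act (s ^ (k - 1)) x = ?act (s ^ k) y"
    proof (cases "p dvd s")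
      case False
      then have "\<not> p dvd s ^ k" using prime_elem_dvd_power[OF prime] by blast
      then have "x = 0\<^sub>v n" using inj x sx by blast
      then show ?thesis using zero poly_act_zero_vec[OF C] by (intro bexI[of _ "0\<^sub>v n"]) auto
    next
      case True
      obtain c where c: "c * c = 1" "p = [:- c, 1:]" "c = 1 \<or> c = -1"
      proof -
        have "p dvd [:- 1, 1:] * [:1, 1:]" using True square_minus_one_factor[of 1] by (simp add: s_def)
        then have "p dvd [:- 1, 1:] \<or> p dvd [:1, 1:]" using prime_elem_dvd_mult_iff[OF prime] by blast
        then have "p = [:- 1, 1:] \<or> p = [:1, 1:]" using irreducible_monic_dvd_linear[OF p] by blast
        then show thesis using that[of 1] that[of "-1"] by auto
      qed
      define u where "u = [:c, 1:]"
      have s: "s = p * u" unfolding s_def c(2) u_def by (rule square_minus_one_factor[OF c(1)])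
      \<comment> \<open>Odd characteristic is used here: it separates \<open>t - c\<close> from the
        other factor \<open>t + c\<close>.\<close>
      have pu: "\<not> p dvd u"
      proof
        assume "p dvd u"
        then have "p = [:c, 1:]" unfolding u_def by (rule irreducible_monic_dvd_linear[OF p])
        then have "c + c = 0" using c(2) by (simp add: neg_eq_iff_add_eq_0)
        then have "2 * (c * c) = 0" by (simp add: distrib_right[symmetric] flip: mult_2)
        then show False using two c by simp
      qed
      have puk: "\<not> p dvd u ^ l" for l using pu prime_elem_dvd_power[OF prime] by blast
      have jk: "j \<noteq> k" using ne c by auto
      show ?thesis
      proof (cases "j < k")
        case True
        \<comment> \<open>As \<open>j \<le> k - 1\<close>, already \<open>s^(k-1)\<close> is a
          multiple of \<open>p^j\<close>, which acts as zero.\<close>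
        have e: "k - 1 = (k - 1 - j) + j" using True by simp
        have "s ^ (k - 1) = (u ^ (k - 1) * p ^ (k - 1 - j)) * p ^ j"
          unfolding s power_mult_distrib by (subst (1) e) (simp add: power_add mult_ac)
        then have "?act (s ^ (k - 1)) x = 0\<^sub>v n"
          using pj[OF x] by (simp add: poly_act_mult[OF C x] poly_act_zero_vec[OF C])
        then show ?thesis using zero by (intro bexI[of _ "0\<^sub>v n"]) auto
      next
        case False
        then have kj: "k < j" using jk by simp
        have "?act (u ^ k) (?act (p ^ k) x) = 0\<^sub>v n"
          using sx unfolding s power_mult_distrib by (simp add: poly_act_mult[OF C x, symmetric] mult.commute)
        then have pkx: "?act (p ^ k) x = 0\<^sub>v n"
          by (rule inj[OF puk poly_act_closed[OF C x]])
        obtain r where r: "x = residue_vec h r" using x unfolding n_def by (rule residue_vec_surj)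
        have "h dvd p ^ k * r"
          using pkx residue_vec_eq_0_iff[OF h0] unfolding r poly_act_companion_mat[OF monic] n_def by blast
        moreover have "h = p ^ k * p ^ (j - k)" unfolding h_def using kj by (simp flip: power_add)
        moreover have "p ^ k \<noteq> 0" using p(2) by auto
        ultimately have "p ^ (j - k) dvd r" by (simp only: dvd_mult_cancel_left simp_thms)
        moreover have "p dvd p ^ (j - k)" using kj by (intro dvd_power) simp
        ultimately obtain r' where r': "r = p * r'" using dvd_trans by blast
        have x': "residue_vec h r' \<in> carrier_vec n" by (simp add: n_def)
        \<comment> \<open>Being prime to \<open>p\<close>, the factor \<open>u\<close> acts
          injectively on a finite space and hence surjectively, so \<open>x\<close>, which is
          \<open>p\<close> times some vector, is also \<open>s\<close> times some vector.\<close>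
        have "inj_on (?act u) (carrier_vec n)"
        proof (rule inj_onI)
          fix y z assume y: "y \<in> carrier_vec n" and z: "z \<in> carrier_vec n" and eq: "?act u y = ?act u z"
          have "?act u (y + (-1) \<cdot>\<^sub>v z) = ?act u y + (-1) \<cdot>\<^sub>v ?act u z"
            using poly_act_add_vec[OF C y, of "(-1) \<cdot>\<^sub>v z"] z poly_act_smult_vec[OF C z] by simp
          also have "\<dots> = 0\<^sub>v n" unfolding eq using poly_act_closed[OF C z, of u] by (intro eq_vecI) auto
          finally have "y + (-1) \<cdot>\<^sub>v z = 0\<^sub>v n" using inj[OF pu] y z by simp
          show "y = z"
          proof (rule eq_vecI)
            fix i assume i: "i < dim_vec z"
            have "(y + (-1) \<cdot>\<^sub>v z) $ i = 0" using \<open>y + (-1) \<cdot>\<^sub>v z = 0\<^sub>v n\<close> i z by simp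
            then show "y $ i = z $ i" using i y z by simp
          qed (use y z in simp)
        qed
        moreover have "?act u ` carrier_vec n \<subseteq> carrier_vec n" using poly_act_closed[OF C] by blast
        ultimately have "?act u ` carrier_vec n = carrier_vec n" by (intro endo_inj_surj) simp_all
        then obtain z where z: "z \<in> carrier_vec n" "residue_vec h r' = ?act u z" using x' by blast
        have "x = ?act p (residue_vec h r')" by (simp add: r r' poly_act_companion_mat[OF monic])
        also have "\<dots> = ?act s z" unfolding z(2) s by (rule poly_act_mult[OF C z(1), symmetric])
        finally have xz: "x = ?act s z" .
        have "?act (s ^ (k - 1)) x = ?act (s ^ k) z"
          unfolding xz poly_act_mult[OF C z(1), symmetric] by (simp only: power_minus_mult[OF k])
        then show ?thesis using z(1) by blast
      qed
    qed
  qed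
  then show ?thesis by (simp add: h_def s_def)
qed

lemma kernel_lifts_four_block:
  assumes A: "A \<in> carrier_mat n n" and B: "B \<in> carrier_mat m m"
    and lift: "kernel_lifts A s k" "kernel_lifts B s k"
  shows "kernel_lifts (four_block_mat A (0\<^sub>m n m) (0\<^sub>m m n) B) s k" (is "kernel_lifts ?M s k")
proof -
  have M: "?M \<in> carrier_mat (n + m) (n + m)" using A B by simp
  note split = poly_act_four_block[OF A B]
  show ?thesis
    unfolding kernel_lifts_iff[OF M]
  proof (intro ballI impI)
    fix x assume x: "x \<in> carrier_vec (n + m)" and 0: "poly_act ?M (s ^ k) x = 0\<^sub>v (n + m)"
    from x obtain u v where uv: "x = u @\<^sub>v v" "u \<in> carrier_vec n" "v \<in> carrier_vec m"
      by (rule vec_append_cases)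
    have "poly_act A (s ^ k) u @\<^sub>v poly_act B (s ^ k) v = 0\<^sub>v n @\<^sub>v 0\<^sub>v m"
      using 0 unfolding uv(1) split[OF uv(2,3)] append_zero_vec .
    then have "poly_act A (s ^ k) u = 0\<^sub>v n \<and> poly_act B (s ^ k) v = 0\<^sub>v m"
      unfolding append_vec_eq[OF poly_act_closed[OF A uv(2)] zero_carrier_vec] .
    then obtain y z where y: "y \<in> carrier_vec n" "poly_act A (s ^ (k - 1)) u = poly_act A (s ^ k) y"
      and z: "z \<in> carrier_vec m" "poly_act B (s ^ (k - 1)) v = poly_act B (s ^ k) z"
      using lift uv(2,3) unfolding kernel_lifts_iff[OF A] kernel_lifts_iff[OF B] by blast
    show "\<exists>y\<in>carrier_vec (n + m). poly_act ?M (s ^ (k - 1)) x = poly_act ?M (s ^ k) y"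
    proof (rule bexI)
      show "poly_act ?M (s ^ (k - 1)) x = poly_act ?M (s ^ k) (y @\<^sub>v z)"
        unfolding uv(1) split[OF uv(2,3)] split[OF y(1) z(1)] y(2) z(2) ..
    qed (use y z in simp)
  qed
qed

lemma kernel_lifts_similar:
  assumes sim: "similar_mat A B" and lift: "kernel_lifts B s k"
  shows "kernel_lifts A s k"
proof -
  obtain n P Q where A: "A \<in> carrier_mat n n" and B: "B \<in> carrier_mat n n" and P: "P \<in> carrier_mat n n"
    and Q: "Q \<in> carrier_mat n n" and AP: "A * P = P * B"
    and PQv: "\<And>v. v \<in> carrier_vec n \<Longrightarrow> P *\<^sub>v (Q *\<^sub>v v) = v" "\<And>v. v \<in> carrier_vec n \<Longrightarrow> Q *\<^sub>v (P *\<^sub>v v) = v"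
    using similar_mat_intertwiner[OF sim] by metis
  note actP = poly_act_similar[OF A A P B AP]
  show ?thesis
    unfolding kernel_lifts_iff[OF A]
  proof (intro ballI impI)
    fix x assume x: "x \<in> carrier_vec n" and 0: "poly_act A (s ^ k) x = 0\<^sub>v n"
    have Qx: "Q *\<^sub>v x \<in> carrier_vec n" using Q x by simp
    have "P *\<^sub>v poly_act B (s ^ k) (Q *\<^sub>v x) = 0\<^sub>v n" using actP[OF Qx] 0 PQv[OF x] by simp
    then have "Q *\<^sub>v (P *\<^sub>v poly_act B (s ^ k) (Q *\<^sub>v x)) = 0\<^sub>v n" using mult_mat_zero_vec[OF Q] by simp
    then have "poly_act B (s ^ k) (Q *\<^sub>v x) = 0\<^sub>v n" using PQv(2)[OF poly_act_closed[OF B Qx]] by simp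
    then obtain y where y: "y \<in> carrier_vec n" "poly_act B (s ^ (k - 1)) (Q *\<^sub>v x) = poly_act B (s ^ k) y"
      using lift Qx unfolding kernel_lifts_iff[OF B] by blast
    have "poly_act A (s ^ (k - 1)) x = P *\<^sub>v poly_act B (s ^ (k - 1)) (Q *\<^sub>v x)"
      using actP[OF Qx] PQv[OF x] by simp
    also have "\<dots> = poly_act A (s ^ k) (P *\<^sub>v y)" unfolding y(2) by (rule actP[OF y(1), symmetric])
    finally show "\<exists>y\<in>carrier_vec n. poly_act A (s ^ (k - 1)) x = poly_act A (s ^ k) y"
      using P y(1) by (intro bexI[of _ "P *\<^sub>v y"]) simp_all
  qed
qed

lemma kernel_lifts_of_elementary_divisors:
  fixes A :: "'a :: {field, finite} mat"
  assumes two: "(2 :: 'a) \<noteq> 0" and ed: "elementary_divisors A fs" and k: "0 < k"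
    and ne: "[:-1, 1:] ^ k \<notin> set fs" "[:1, 1:] ^ k \<notin> set fs"
  shows "kernel_lifts A [:-1, 0, 1:] k"
proof -
  have form: "\<exists>p j. Polynomial.lead_coeff p = 1 \<and> Factorial_Ring.irreducible p \<and> 1 \<le> j \<and> f = p ^ j"
    if "f \<in> set fs" for f using ed that unfolding elementary_divisors_def by blast
  have "set gs \<subseteq> set fs \<Longrightarrow> kernel_lifts (diag_block_mat (map companion_mat gs)) [:-1, 0, 1:] k" for gs
  proof (induction gs)
    case Nil
    have D: "diag_block_mat (map companion_mat []) \<in> carrier_mat 0 0" by simp
    have eq: "u = v" if "u \<in> carrier_vec 0" "v \<in> carrier_vec 0" for u v :: "'a vec"
      using that by (intro eq_vecI) auto
    show ?case
      unfolding kernel_lifts_iff[OF D] using eq poly_act_closed[OF D] by blast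
  next
    case (Cons f gs)
    obtain m where m: "diag_block_mat (map companion_mat gs) \<in> carrier_mat m m"
      using diag_companion_closed by blast
    have "f \<in> set fs" using Cons.prems by simp
    then obtain p j where p: "Polynomial.lead_coeff p = 1" "Factorial_Ring.irreducible p" and f: "f = p ^ j"
      using form by blast
    have "kernel_lifts (companion_mat f) [:-1, 0, 1:] k"
      unfolding f by (rule kernel_lifts_companion[OF two p(2,1) k]) (use ne \<open>f \<in> set fs\<close> f in auto)
    then show ?case
      unfolding diag_companion_Cons[OF m]
      by (rule kernel_lifts_four_block[OF companion_mat_closed m]) (use Cons in simp)
  qed
  then show ?thesis using kernel_lifts_similar ed unfolding elementary_divisors_def by blast
qed

section \<open>Involutions over a finite field\<close>

text \<open>Takes the place of the rank-nullity theorem: for a linear map the fibres are cosets of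
  the kernel.\<close>

lemma card_eq_card_image_times_fibre:
  assumes "finite S" and "\<And>y. y \<in> f ` S \<Longrightarrow> card {x \<in> S. f x = y} = c"
  shows "card S = card (f ` S) * c"
proof -
  have "card S = (\<Sum>y\<in>f ` S. card {x \<in> S. f x = y})"
    using sum.image_gen[OF assms(1), of "\<lambda>_. 1 :: nat" f] by simp
  also have "\<dots> = card (f ` S) * c" using assms(2) by simp
  finally show ?thesis .
qed

definition eigenvectors :: "'a :: field mat \<Rightarrow> 'a \<Rightarrow> 'a vec set" where
  "eigenvectors M c = {x \<in> carrier_vec (dim_row M). M *\<^sub>v x = c \<cdot>\<^sub>v x}"

text \<open>The dimensions \<open>a\<close> and \<open>b\<close> of the two eigenspaces are recorded
  through cardinalities, which are invariant under similarity and multiplicative on block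
  sums.\<close>

definition involution_split :: "'a :: {field, finite} mat \<Rightarrow> nat \<Rightarrow> nat \<Rightarrow> bool" where
  "involution_split M a b \<longleftrightarrow> a + b = dim_row M \<and> card (eigenvectors M 1) = CARD('a) ^ a \<and>
     card (eigenvectors M (-1)) = CARD('a) ^ b \<and> det M = (-1) ^ b"

lemma involution_split_scalar:
  fixes c :: "'a :: {field, finite}"
  assumes two: "(2 :: 'a) \<noteq> 0" and c: "c = 1 \<or> c = -1"
  shows "involution_split (companion_mat [:- c, 1:]) (if c = 1 then 1 else 0) (if c = 1 then 0 else 1)"
proof -
  let ?M = "companion_mat [:- c, 1:]"
  have M: "?M = mat 1 1 (\<lambda>_. c)" by (rule eq_matI) (simp_all add: companion_mat_def)
  have Mx: "?M *\<^sub>v x = c \<cdot>\<^sub>v x" if "x \<in> carrier_vec 1" for x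
    unfolding M using that by (intro eq_vecI) (auto simp: scalar_prod_def)
  have self: "eigenvectors ?M c = carrier_vec 1"
    using Mx by (auto simp: eigenvectors_def M)
  have other: "eigenvectors ?M (- c) = {0\<^sub>v 1}"
  proof -
    have "x = 0\<^sub>v 1" if x: "x \<in> carrier_vec 1" and eq: "c \<cdot>\<^sub>v x = (- c) \<cdot>\<^sub>v x" for x
    proof (rule eq_vecI)
      fix i assume "i < dim_vec (0\<^sub>v 1 :: 'a vec)"
      then have i: "i < dim_vec x" using x by simp
      have "(c \<cdot>\<^sub>v x) $ i = ((- c) \<cdot>\<^sub>v x) $ i" using eq by simp
      then have "c * x $ i + c * x $ i = 0" using i by (simp add: eq_neg_iff_add_eq_0)
      then have "2 * (c * x $ i) = 0" by (simp flip: mult_2)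
      then show "x $ i = 0\<^sub>v 1 $ i" using two c i x by auto
    qed (use x in simp)
    moreover have "?M *\<^sub>v 0\<^sub>v 1 = (- c) \<cdot>\<^sub>v 0\<^sub>v 1"
      unfolding Mx[OF zero_carrier_vec] by (intro eq_vecI) auto
    ultimately show ?thesis using Mx by (fastforce simp: eigenvectors_def M)
  qed
  have "det ?M = c" unfolding M by (subst det_single) auto
  moreover have "c \<noteq> - c"
    using two c by (auto simp: eq_neg_iff_add_eq_0)
  ultimately show ?thesis
    using c self other by (auto simp: involution_split_def card_carrier_vec M)
qed

lemma eigenvectors_four_block:
  assumes A: "A \<in> carrier_mat n n" and B: "B \<in> carrier_mat m m"
  shows "card (eigenvectors (four_block_mat A (0\<^sub>m n m) (0\<^sub>m m n) B) c)
    = card (eigenvectors A c) * card (eigenvectors B c)"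
proof -
  let ?M = "four_block_mat A (0\<^sub>m n m) (0\<^sub>m m n) B"
  let ?app = "\<lambda>(u, v). u @\<^sub>v v"
  have eq: "?M *\<^sub>v (u @\<^sub>v v) = c \<cdot>\<^sub>v (u @\<^sub>v v) \<longleftrightarrow> A *\<^sub>v u = c \<cdot>\<^sub>v u \<and> B *\<^sub>v v = c \<cdot>\<^sub>v v"
    if u: "u \<in> carrier_vec n" and v: "v \<in> carrier_vec m" for u v
  proof -
    have "c \<cdot>\<^sub>v (u @\<^sub>v v) = c \<cdot>\<^sub>v u @\<^sub>v c \<cdot>\<^sub>v v" using u v by (intro eq_vecI) auto
    then show ?thesis
      using mult_mat_vec_split[OF A B u v] append_vec_eq[of "A *\<^sub>v u" n "c \<cdot>\<^sub>v u"] u A by simp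
  qed
  have "eigenvectors ?M c = ?app ` (eigenvectors A c \<times> eigenvectors B c)"
  proof (intro equalityI subsetI)
    fix x assume x: "x \<in> eigenvectors ?M c"
    then have "x \<in> carrier_vec (n + m)" using A B by (simp add: eigenvectors_def)
    then obtain u v where uv: "x = u @\<^sub>v v" "u \<in> carrier_vec n" "v \<in> carrier_vec m"
      by (rule vec_append_cases)
    have "(u, v) \<in> eigenvectors A c \<times> eigenvectors B c"
      using x eq[OF uv(2,3)] uv A B by (simp add: eigenvectors_def)
    then show "x \<in> ?app ` (eigenvectors A c \<times> eigenvectors B c)" using uv(1) by force
  next
    fix x assume "x \<in> ?app ` (eigenvectors A c \<times> eigenvectors B c)"
    then obtain u v where "x = u @\<^sub>v v" "u \<in> eigenvectors A c" "v \<in> eigenvectors B c" by auto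
    then show "x \<in> eigenvectors ?M c" using A B eq[of u v] by (simp add: eigenvectors_def)
  qed
  moreover have "inj_on ?app (eigenvectors A c \<times> eigenvectors B c)"
  proof (rule inj_onI, clarify)
    fix u v u' v' assume "u \<in> eigenvectors A c" "u' \<in> eigenvectors A c" "u @\<^sub>v v = u' @\<^sub>v v'"
    then show "u = u' \<and> v = v'" using append_vec_eq[of u n u' v v'] A by (simp add: eigenvectors_def)
  qed
  ultimately show ?thesis by (simp add: card_image card_cartesian_product)
qed

lemma involution_split_four_block:
  assumes A: "A \<in> carrier_mat n n" and B: "B \<in> carrier_mat m m"
    and "involution_split A a b" "involution_split B a' b'"
  shows "involution_split (four_block_mat A (0\<^sub>m n m) (0\<^sub>m m n) B) (a + a') (b + b')"
  using assms eigenvectors_four_block[OF A B]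
    det_four_block_mat_lower_left_zero[OF A zero_carrier_mat refl B]
  by (simp add: involution_split_def power_add)

lemma involution_split_similar:
  assumes sim: "similar_mat A B" and B: "involution_split B a b"
  shows "involution_split A a b"
proof -
  have incl: "(\<lambda>v. Q *\<^sub>v v) ` eigenvectors N c \<subseteq> eigenvectors M c"
    if N: "N \<in> carrier_mat n n" and M: "M \<in> carrier_mat n n" and Q: "Q \<in> carrier_mat n n" and QN: "M * Q = Q * N"
    for M N Q n c
  proof (rule image_subsetI)
    fix v assume "v \<in> eigenvectors N c"
    then have v: "v \<in> carrier_vec n" and e: "N *\<^sub>v v = c \<cdot>\<^sub>v v" using N by (auto simp: eigenvectors_def)
    have "M *\<^sub>v (Q *\<^sub>v v) = Q *\<^sub>v (N *\<^sub>v v)"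
      unfolding assoc_mult_mat_vec[OF M Q v, symmetric] assoc_mult_mat_vec[OF Q N v, symmetric] QN ..
    also have "\<dots> = c \<cdot>\<^sub>v (Q *\<^sub>v v)" unfolding e by (rule mult_mat_vec[OF Q v])
    finally show "Q *\<^sub>v v \<in> eigenvectors M c" using Q M v by (simp add: eigenvectors_def)
  qed
  obtain n P Q where A: "A \<in> carrier_mat n n" and B': "B \<in> carrier_mat n n" and P: "P \<in> carrier_mat n n"
    and Q: "Q \<in> carrier_mat n n" and AP: "A * P = P * B" and BQ: "B * Q = Q * A"
    and PQv: "\<And>v. v \<in> carrier_vec n \<Longrightarrow> P *\<^sub>v (Q *\<^sub>v v) = v" "\<And>v. v \<in> carrier_vec n \<Longrightarrow> Q *\<^sub>v (P *\<^sub>v v) = v"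
    using similar_mat_intertwiner[OF sim] by metis
  have "bij_betw (\<lambda>v. Q *\<^sub>v v) (eigenvectors A c) (eigenvectors B c)" for c
    by (rule bij_betw_byWitness[OF _ _ incl[OF A B' Q BQ] incl[OF B' A P AP]])
      (use PQv A B' in \<open>auto simp: eigenvectors_def\<close>)
  then have card: "card (eigenvectors A c) = card (eigenvectors B c)" for c by (rule bij_betw_same_card)
  show ?thesis
    using B card det_similar[OF sim] A B' by (simp add: involution_split_def)
qed

lemma four_block_involution:
  assumes A: "(A :: 'a :: field mat) \<in> carrier_mat n n" and B: "B \<in> carrier_mat m m"
    and sq: "four_block_mat A (0\<^sub>m n m) (0\<^sub>m m n) B * four_block_mat A (0\<^sub>m n m) (0\<^sub>m m n) B = 1\<^sub>m (n + m)"
  shows "A * A = 1\<^sub>m n" "B * B = 1\<^sub>m m"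
proof -
  let ?M = "four_block_mat A (0\<^sub>m n m) (0\<^sub>m m n) B"
  have M: "?M \<in> carrier_mat (n + m) (n + m)" using A B by simp
  have "(A * A) *\<^sub>v u = 1\<^sub>m n *\<^sub>v u \<and> (B * B) *\<^sub>v v = 1\<^sub>m m *\<^sub>v v"
    if u: "u \<in> carrier_vec n" and v: "v \<in> carrier_vec m" for u v
  proof -
    have uv: "u @\<^sub>v v \<in> carrier_vec (n + m)" using u v by simp
    have Au: "A *\<^sub>v u \<in> carrier_vec n" and Bv: "B *\<^sub>v v \<in> carrier_vec m" using A B u v by auto
    have "u @\<^sub>v v = ?M *\<^sub>v (?M *\<^sub>v (u @\<^sub>v v))"
      unfolding assoc_mult_mat_vec[OF M M uv, symmetric] sq using uv by simp
    also have "\<dots> = A *\<^sub>v (A *\<^sub>v u) @\<^sub>v B *\<^sub>v (B *\<^sub>v v)"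
      unfolding mult_mat_vec_split[OF A B u v] mult_mat_vec_split[OF A B Au Bv] ..
    finally have "u = A *\<^sub>v (A *\<^sub>v u) \<and> v = B *\<^sub>v (B *\<^sub>v v)"
      using append_vec_eq[of u n "A *\<^sub>v (A *\<^sub>v u)"] u A Au by simp
    then show ?thesis
      using u v assoc_mult_mat_vec[OF A A u] assoc_mult_mat_vec[OF B B v] by simp
  qed
  note both = this
  show "A * A = 1\<^sub>m n"
    by (rule mat_eq_by_vec[of _ n n]) (use A both[OF _ zero_carrier_vec] in auto)
  show "B * B = 1\<^sub>m m"
    by (rule mat_eq_by_vec[of _ m m]) (use B both[OF zero_carrier_vec] in auto)
qed

lemma residue_vec_diff: "residue_vec f (r - s) = residue_vec f r - residue_vec f s"
  by (auto simp: residue_vec_def poly_mod_diff_left)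

text \<open>Applied to the class of \<open>1\<close>, the equation says \<open>t^2 = 1\<close> in
  \<open>F[t]/(p^j)\<close>, so \<open>p^j\<close> divides \<open>t^2 - 1\<close>. In odd
  characteristic this is squarefree, and the block has size one.\<close>

lemma involution_companion:
  fixes p :: "'a :: {field, finite} poly"
  assumes two: "(2 :: 'a) \<noteq> 0" and p: "Factorial_Ring.irreducible p" "Polynomial.lead_coeff p = 1" and j: "0 < j"
    and sq: "companion_mat (p ^ j) * companion_mat (p ^ j) = 1\<^sub>m (Polynomial.degree (p ^ j))"
  shows "\<exists>a b. involution_split (companion_mat (p ^ j)) a b"
proof -
  define h where "h = p ^ j"
  have monic: "Polynomial.lead_coeff h = 1" unfolding h_def using p(2) by (simp only: lead_coeff_power power_one)
  have h0: "h \<noteq> 0" using monic by auto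
  have "residue_vec h 1 = (companion_mat h * companion_mat h) *\<^sub>v residue_vec h 1"
    using sq residue_vec_closed[of h 1] by (simp add: h_def)
  also have "\<dots> = companion_mat h *\<^sub>v (companion_mat h *\<^sub>v residue_vec h 1)"
    by (rule assoc_mult_mat_vec[OF companion_mat_closed companion_mat_closed residue_vec_closed])
  also have "\<dots> = residue_vec h (pCons 0 (pCons 0 1))" by (simp only: companion_mat_residue_vec[OF monic])
  finally have "residue_vec h (pCons 0 (pCons 0 1) - 1) = 0\<^sub>v (Polynomial.degree h)"
    unfolding residue_vec_diff using minus_cancel_vec[OF residue_vec_closed] by metis
  then have "h dvd [:0, 0, 1:] - 1" using residue_vec_eq_0_iff[OF h0] by (simp add: one_pCons)
  moreover have "[:0, 0, 1:] - 1 = [:-1, 0, (1::'a):]" by (simp add: one_pCons)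
  ultimately have hs: "h dvd [:-1, 0, 1:]" by simp
  have prime: "prime_elem p" by (rule field_poly_irreducible_imp_prime[OF p(1)])
  have "p dvd h" unfolding h_def using j by (intro dvd_power) simp
  then have "p dvd [:-1, 0, 1:]" using hs by (rule dvd_trans)
  also have "[:-1, 0, 1:] = [:- 1, 1:] * [:1, 1 :: 'a:]" by simp
  finally have "p dvd [:- 1, 1:] * [:1, 1:]" .
  then have "p dvd [:- 1, 1:] \<or> p dvd [:1, 1:]" using prime_elem_dvd_mult_iff[OF prime] by blast
  then have "p = [:- 1, 1:] \<or> p = [:1, 1:]" using irreducible_monic_dvd_linear[OF p] by blast
  then obtain c where c: "c * c = 1" "p = [:- c, 1:]" "c = 1 \<or> c = -1"
    using that[of 1] that[of "-1"] by auto
  have "j = 1"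
  proof (rule ccontr)
    assume "j \<noteq> 1"
    then obtain i where i: "j = Suc (Suc i)" using j by (cases j; cases "j - 1") auto
    have "p * p dvd h" unfolding h_def i by simp
    then have "p * p dvd p * [:c, 1:]"
      using hs square_minus_one_factor[OF c(1)] unfolding c(2) by (metis dvd_trans)
    moreover have "p \<noteq> 0" using p(2) by auto
    ultimately have "p dvd [:c, 1:]" by (simp only: dvd_mult_cancel_left simp_thms)
    then have "p = [:c, 1:]" by (rule irreducible_monic_dvd_linear[OF p])
    then have "c + c = 0" using c(2) by (simp add: neg_eq_iff_add_eq_0)
    then have "2 * (c * c) = 0" by (simp add: distrib_right[symmetric] flip: mult_2)
    then show False using two c by simp
  qed
  then show ?thesis using involution_split_scalar[OF two c(3)] c(2) by auto
qed

text \<open>Diagonalisability of an involution in odd characteristic, obtained from a decomposition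
  of \<open>M\<close> into companion blocks, each of which is itself an involution.\<close>

lemma involution_split_exists:
  fixes M :: "'a :: {field, finite} mat"
  assumes two: "(2 :: 'a) \<noteq> 0" and M: "M \<in> carrier_mat n n" and sq: "M * M = 1\<^sub>m n"
  shows "\<exists>a b. involution_split M a b"
proof -
  obtain fs where ed: "elementary_divisors M fs" using elementary_divisors_exist[OF M] by blast
  have form: "\<exists>p j. Polynomial.lead_coeff p = 1 \<and> Factorial_Ring.irreducible p \<and> 1 \<le> j \<and> f = p ^ j"
    if "f \<in> set fs" for f using ed that unfolding elementary_divisors_def by blast
  have main: "set gs \<subseteq> set fs \<Longrightarrow> diag_block_mat (map companion_mat gs) \<in> carrier_mat m m \<Longrightarrow>
      diag_block_mat (map companion_mat gs) * diag_block_mat (map companion_mat gs) = 1\<^sub>m m \<Longrightarrow>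
      \<exists>a b. involution_split (diag_block_mat (map companion_mat gs)) a b" for gs m
  proof (induction gs arbitrary: m)
    case Nil
    have "eigenvectors (0\<^sub>m 0 0) c = {0\<^sub>v 0 :: 'a vec}" for c
      by (auto simp: eigenvectors_def)
    then have "involution_split (0\<^sub>m 0 0 :: 'a mat) 0 0"
      by (simp add: involution_split_def)
    then show ?case by auto
  next
    case (Cons f gs)
    obtain l where l: "diag_block_mat (map companion_mat gs) \<in> carrier_mat l l"
      using diag_companion_closed by blast
    let ?d = "Polynomial.degree f"
    have "diag_block_mat (map companion_mat (f # gs)) \<in> carrier_mat (?d + l) (?d + l)"
      unfolding diag_companion_Cons[OF l] by (rule four_block_carrier_mat[OF companion_mat_closed l])
    then have m: "m = ?d + l" using Cons.prems(2) by auto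
    note sq' = four_block_involution[OF companion_mat_closed l Cons.prems(3)[unfolded diag_companion_Cons[OF l] m]]
    have "f \<in> set fs" using Cons.prems(1) by simp
    then obtain p j where p: "Polynomial.lead_coeff p = 1" "Factorial_Ring.irreducible p" and j: "1 \<le> j" and f: "f = p ^ j"
      using form by blast
    obtain a b where "involution_split (companion_mat f) a b"
      using involution_companion[OF two p(2,1), of j] j sq'(1) unfolding f by auto
    moreover obtain a' b' where "involution_split (diag_block_mat (map companion_mat gs)) a' b'"
      using Cons.IH[OF _ l sq'(2)] Cons.prems(1) by auto
    ultimately show ?case
      unfolding diag_companion_Cons[OF l] using involution_split_four_block[OF companion_mat_closed l] by blast
  qed
  let ?D = "diag_block_mat (map companion_mat fs)"
  have sim: "similar_mat M ?D" using ed by (simp add: elementary_divisors_def)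
  obtain n' P Q where c': "{?D, M, P, Q} \<subseteq> carrier_mat n' n'"
    and PQ': "P * Q = 1\<^sub>m n'" "Q * P = 1\<^sub>m n'" and D: "?D = P * M * Q"
    using similar_matD[OF similar_mat_sym[OF sim]] by blast
  have n': "n' = n" using c' M by auto
  have c: "?D \<in> carrier_mat n n" "P \<in> carrier_mat n n" "Q \<in> carrier_mat n n"
    using c' unfolding n' by auto
  have PQ: "Q * P = 1\<^sub>m n" "P * Q = 1\<^sub>m n" using PQ' unfolding n' by auto
  have "?D * ?D = 1\<^sub>m n"
  proof -
    have PM: "P * M \<in> carrier_mat n n" and MQ: "M * Q \<in> carrier_mat n n" using c M by auto
    have "?D * ?D = (P * M) * (Q * ((P * M) * Q))"
      unfolding D by (rule assoc_mult_mat[OF PM c(3), of _ n]) (use PM c in simp)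
    also have "(P * M) * Q = P * (M * Q)" by (rule assoc_mult_mat[OF c(2) M c(3)])
    also have "Q * (P * (M * Q)) = M * Q"
      unfolding assoc_mult_mat[OF c(3,2) MQ, symmetric] PQ by (rule left_mult_one_mat[OF MQ])
    also have "(P * M) * (M * Q) = P * (M * (M * Q))" by (rule assoc_mult_mat[OF c(2) M MQ])
    also have "M * (M * Q) = Q"
      unfolding assoc_mult_mat[OF M M c(3), symmetric] sq by (rule left_mult_one_mat[OF c(3)])
    finally show ?thesis using PQ by simp
  qed
  then show ?thesis using main[OF order.refl c(1)] involution_split_similar[OF sim] by blast
qed

section \<open>Gradings by an involution\<close>

text \<open>Write an annihilating polynomial as \<open>t^e g\<close> with
  \<open>g(0) \<noteq> 0\<close>. For \<open>l \<ge> e\<close> and \<open>u^(l+1) x = 0\<close>, the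
  vector \<open>u^l x\<close> is killed by the coprime polynomials \<open>t\<close> and
  \<open>g\<close>.\<close>

lemma kernel_power_stabilises:
  assumes u: "(u :: 'a :: {field, finite} mat) \<in> carrier_mat n n"
  shows "\<exists>e. \<forall>l\<ge>e. \<forall>x\<in>carrier_vec n. poly_act u ([:0, 1:] ^ Suc l) x = 0\<^sub>v n \<longrightarrow> poly_act u ([:0, 1:] ^ l) x = 0\<^sub>v n"
proof -
  obtain f where f: "f \<noteq> 0" and fv: "\<And>v. v \<in> carrier_vec n \<Longrightarrow> poly_act u f v = 0\<^sub>v n"
    using exists_annihilating_poly[OF u] by blast
  define e where "e = Polynomial.order 0 f"
  obtain g where g: "f = [:0, 1:] ^ e * g" "\<not> [:0, 1:] dvd g"
    using order_decomp[OF f, of 0] unfolding e_def by auto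
  have irr: "Factorial_Ring.irreducible [:0, 1 :: 'a:]" by (rule irreducible_linear_field_poly) simp
  show ?thesis
  proof (intro exI allI impI ballI)
    fix l x assume l: "e \<le> l" and x: "x \<in> carrier_vec n" and 0: "poly_act u ([:0, 1:] ^ Suc l) x = 0\<^sub>v n"
    define y where "y = poly_act u ([:0, 1:] ^ l) x"
    have y: "y \<in> carrier_vec n" unfolding y_def by (rule poly_act_closed[OF u x])
    have y0: "poly_act u [:0, 1:] y = 0\<^sub>v n"
      using 0 unfolding y_def poly_act_mult[OF u x, symmetric] power_Suc .
    have "g * [:0, 1:] ^ l = [:0, 1:] ^ (l - e) * f"
    proof -
      have "[:0, 1 :: 'a:] ^ l = [:0, 1:] ^ (l - e) * [:0, 1:] ^ e" using l by (simp flip: power_add)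
      then show ?thesis unfolding g(1) by (simp only: mult_ac)
    qed
    then have "poly_act u g y = poly_act u ([:0, 1:] ^ (l - e)) (poly_act u f x)"
      unfolding y_def poly_act_mult[OF u x, symmetric] by simp
    also have "\<dots> = 0\<^sub>v n" unfolding fv[OF x] by (rule poly_act_zero_vec[OF u])
    finally have gy: "poly_act u g y = 0\<^sub>v n" .
    show "poly_act u ([:0, 1:] ^ l) x = 0\<^sub>v n"
      using irreducible_dvd_annihilator[OF u y _ irr y0 gy] g(2) unfolding y_def by blast
  qed
qed

text \<open>The eigenspaces of \<open>h\<close> for \<open>1\<close> and \<open>-1\<close> form a
  grading by \<open>Z/2\<close> for which \<open>u\<close> is odd, that is, \<open>u\<close> maps
  each of them into the other.\<close>

locale anticommuting_involution =
  fixes n :: nat and u h :: "'a :: {field, finite} mat"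
  assumes u: "u \<in> carrier_mat n n" and h: "h \<in> carrier_mat n n"
    and hh: "h * h = 1\<^sub>m n" and hu: "h * u = - u * h" and two: "(2 :: 'a) \<noteq> 0"
begin

definition "U j = poly_act u ([:0, 1:] ^ j)"

definition graded_kernel :: "nat \<Rightarrow> 'a \<Rightarrow> 'a vec set" where
  "graded_kernel j c = {x \<in> carrier_vec n. U j x = 0\<^sub>v n \<and> h *\<^sub>v x = c \<cdot>\<^sub>v x}"

lemma U_closed [simp]: "x \<in> carrier_vec n \<Longrightarrow> U j x \<in> carrier_vec n"
  unfolding U_def by (rule poly_act_closed[OF u])

lemma U_dim [simp]: "x \<in> carrier_vec n \<Longrightarrow> dim_vec (U j x) = n"
  by (rule carrier_vecD[OF U_closed])

lemma U_0: "x \<in> carrier_vec n \<Longrightarrow> U 0 x = x"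
  unfolding U_def by (simp add: poly_act_1[OF u])

lemma U_1: "x \<in> carrier_vec n \<Longrightarrow> U 1 x = u *\<^sub>v x"
  unfolding U_def using poly_act_linear[OF u, of x 0] zero_smult_vec[OF u, of x] u by simp

lemma U_add: "x \<in> carrier_vec n \<Longrightarrow> U (i + j) x = U i (U j x)"
  unfolding U_def by (simp add: power_add poly_act_mult[OF u])

lemma U_zero [simp]: "U j (0\<^sub>v n) = 0\<^sub>v n"
  unfolding U_def by (rule poly_act_zero_vec[OF u])

lemma U_plus: "x \<in> carrier_vec n \<Longrightarrow> y \<in> carrier_vec n \<Longrightarrow> U j (x + y) = U j x + U j y"
  unfolding U_def by (rule poly_act_add_vec[OF u])

lemma U_smult: "x \<in> carrier_vec n \<Longrightarrow> U j (c \<cdot>\<^sub>v x) = c \<cdot>\<^sub>v U j x"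
  unfolding U_def by (rule poly_act_smult_vec[OF u])

lemma U_minus:
  assumes x: "x \<in> carrier_vec n" and y: "y \<in> carrier_vec n"
  shows "U j (x - y) = U j x - U j y"
proof -
  have eq: "v - w = v + (-1) \<cdot>\<^sub>v w" if "v \<in> carrier_vec n" "w \<in> carrier_vec n" for v w :: "'a vec"
    using that by (intro eq_vecI) auto
  show ?thesis using x y by (simp add: eq U_plus U_smult)
qed

lemma h_U:
  assumes x: "x \<in> carrier_vec n"
  shows "h *\<^sub>v U j x = (-1) ^ j \<cdot>\<^sub>v U j (h *\<^sub>v x)"
  using x
proof (induction j arbitrary: x)
  case 0
  then show ?case using h by (simp add: U_0)
next
  case (Suc j)
  have ux: "u *\<^sub>v x \<in> carrier_vec n" and hx: "h *\<^sub>v x \<in> carrier_vec n" using u h Suc.prems by auto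
  have "h *\<^sub>v (u *\<^sub>v x) = (- u * h) *\<^sub>v x" using assoc_mult_mat_vec[OF h u Suc.prems] hu by simp
  also have "\<dots> = - u *\<^sub>v (h *\<^sub>v x)" by (rule assoc_mult_mat_vec[OF _ h Suc.prems]) (use u in simp)
  also have "\<dots> = (-1) \<cdot>\<^sub>v U 1 (h *\<^sub>v x)"
  proof -
    have "- u *\<^sub>v (h *\<^sub>v x) = - (u *\<^sub>v (h *\<^sub>v x))" using u carrier_vecD[OF hx] by simp
    also have "\<dots> = (-1) \<cdot>\<^sub>v (u *\<^sub>v (h *\<^sub>v x))" by (intro eq_vecI) auto
    finally show ?thesis unfolding U_1[OF hx] .
  qed
  finally have hux: "h *\<^sub>v (u *\<^sub>v x) = (-1) \<cdot>\<^sub>v U 1 (h *\<^sub>v x)" .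
  have "h *\<^sub>v U (Suc j) x = h *\<^sub>v U j (u *\<^sub>v x)" using U_add[OF Suc.prems, of j 1] U_1[OF Suc.prems] by simp
  also have "\<dots> = (-1) ^ j \<cdot>\<^sub>v U j ((-1) \<cdot>\<^sub>v U 1 (h *\<^sub>v x))" unfolding Suc.IH[OF ux] hux ..
  also have "\<dots> = (-1) ^ Suc j \<cdot>\<^sub>v U (Suc j) (h *\<^sub>v x)"
    using U_smult[OF U_closed[OF hx], of j "-1" 1] U_add[OF hx, of j 1] by (simp add: smult_smult_assoc)
  finally show ?case .
qed

lemma h_minus: "x \<in> carrier_vec n \<Longrightarrow> y \<in> carrier_vec n \<Longrightarrow> h *\<^sub>v (x - y) = h *\<^sub>v x - h *\<^sub>v y"
  by (rule mult_minus_distrib_mat_vec[OF h])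

lemma graded_kernel_plus:
  assumes "x \<in> graded_kernel j c" "y \<in> graded_kernel j c"
  shows "x + y \<in> graded_kernel j c"
  using assms mult_add_distrib_mat_vec[OF h, of x y] smult_add_distrib_vec[of x n y c]
  by (auto simp: graded_kernel_def U_plus)

lemma graded_kernel_minus:
  assumes "x \<in> graded_kernel j c" "y \<in> graded_kernel j c"
  shows "x - y \<in> graded_kernel j c"
proof -
  have xy: "x \<in> carrier_vec n" "y \<in> carrier_vec n" using assms by (auto simp: graded_kernel_def)
  have "c \<cdot>\<^sub>v x - c \<cdot>\<^sub>v y = c \<cdot>\<^sub>v (x - y)" using xy by (intro eq_vecI) (auto simp: algebra_simps)
  then show ?thesis using assms xy h_minus[OF xy] by (auto simp: graded_kernel_def U_minus)
qed

lemma graded_kernel_mono: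
  assumes x: "x \<in> graded_kernel j c"
  shows "x \<in> graded_kernel (Suc j) c"
proof -
  have "U (1 + j) x = 0\<^sub>v n" using x U_add[of x 1 j] by (simp add: graded_kernel_def)
  then show ?thesis using x by (simp add: graded_kernel_def)
qed

lemma U_1_eigen:
  assumes x: "x \<in> carrier_vec n" and hx: "h *\<^sub>v x = c \<cdot>\<^sub>v x"
  shows "h *\<^sub>v U 1 x = (- c) \<cdot>\<^sub>v U 1 x"
  using h_U[OF x, of 1] U_smult[OF x, of 1 c] unfolding hx by (simp add: smult_smult_assoc)

lemma U_even_eigen:
  assumes x: "x \<in> carrier_vec n" and hx: "h *\<^sub>v x = c \<cdot>\<^sub>v x" and "even j"
  shows "h *\<^sub>v U j x = c \<cdot>\<^sub>v U j x"
  using h_U[OF x, of j] U_smult[OF x, of j c] assms(3) unfolding hx by simp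

lemma graded_kernel_U:
  assumes x: "x \<in> graded_kernel (Suc j) c"
  shows "U 1 x \<in> graded_kernel j (- c)"
proof -
  have xc: "x \<in> carrier_vec n" and hx: "h *\<^sub>v x = c \<cdot>\<^sub>v x" and 0: "U (Suc j) x = 0\<^sub>v n"
    using x by (auto simp: graded_kernel_def)
  have "U j (U 1 x) = 0\<^sub>v n" using U_add[OF xc, of j 1] 0 by simp
  then show ?thesis using U_1_eigen[OF xc hx] xc by (simp add: graded_kernel_def)
qed

lemma finite_graded_kernel [simp]: "finite (graded_kernel j c)"
  unfolding graded_kernel_def by (rule finite_subset[of _ "carrier_vec n"]) auto

lemma zero_in_graded_kernel: "0\<^sub>v n \<in> graded_kernel j c"
  using mult_mat_zero_vec[OF h] by (auto simp: graded_kernel_def)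

text \<open>The projection \<open>(y + c h y)/2\<close> onto the \<open>c\<close>-eigenspace loses
  nothing: the odd power \<open>U j\<close> reverses the grading, so the image of the discarded
  component would lie in the wrong eigenspace and is zero.\<close>

lemma graded_component:
  assumes y: "y \<in> carrier_vec n" and c: "c * c = 1" and j: "odd j"
    and e: "h *\<^sub>v U j y = (- c) \<cdot>\<^sub>v U j y"
  obtains z where "z \<in> carrier_vec n" "h *\<^sub>v z = c \<cdot>\<^sub>v z" "U j z = U j y"
proof -
  define z where "z = inverse 2 \<cdot>\<^sub>v (y + c \<cdot>\<^sub>v (h *\<^sub>v y))"
  have hy: "h *\<^sub>v y \<in> carrier_vec n" using h y by simp
  have hhy: "h *\<^sub>v (h *\<^sub>v y) = y" unfolding assoc_mult_mat_vec[OF h h y, symmetric] hh using y by simp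
  have "h *\<^sub>v z = inverse 2 \<cdot>\<^sub>v (h *\<^sub>v y + c \<cdot>\<^sub>v y)"
    unfolding z_def
    using mult_mat_vec[OF h, of "y + c \<cdot>\<^sub>v (h *\<^sub>v y)" "inverse 2"] mult_add_distrib_mat_vec[OF h y, of "c \<cdot>\<^sub>v (h *\<^sub>v y)"]
      mult_mat_vec[OF h hy, of c] hhy y hy by simp
  also have "\<dots> = c \<cdot>\<^sub>v z"
  proof (rule eq_vecI)
    fix i assume "i < dim_vec (c \<cdot>\<^sub>v z)"
    then have i: "i < n" using h by (simp add: z_def)
    have "c * (c * (h *\<^sub>v y) $ i) = (h *\<^sub>v y) $ i" using c by (simp flip: mult.assoc)
    then show "(inverse 2 \<cdot>\<^sub>v (h *\<^sub>v y + c \<cdot>\<^sub>v y)) $ i = (c \<cdot>\<^sub>v z) $ i"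
      using i y hy carrier_vecD[OF hy] by (simp add: z_def algebra_simps del: index_mult_mat_vec)
  qed (use y h in \<open>simp add: z_def\<close>)
  finally have hz: "h *\<^sub>v z = c \<cdot>\<^sub>v z" .
  have "(-1) ^ j \<cdot>\<^sub>v U j (h *\<^sub>v y) = (- c) \<cdot>\<^sub>v U j y" using h_U[OF y, of j] e by simp
  then have Uhy: "c \<cdot>\<^sub>v U j (h *\<^sub>v y) = U j y"
  proof -
    assume "(-1) ^ j \<cdot>\<^sub>v U j (h *\<^sub>v y) = (- c) \<cdot>\<^sub>v U j y"
    then have "(- c) \<cdot>\<^sub>v ((-1) \<cdot>\<^sub>v U j (h *\<^sub>v y)) = (- c) \<cdot>\<^sub>v ((- c) \<cdot>\<^sub>v U j y)" using j by simp
    then show ?thesis using c by (simp add: smult_smult_assoc)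
  qed
  have "U j z = inverse 2 \<cdot>\<^sub>v (U j y + c \<cdot>\<^sub>v U j (h *\<^sub>v y))"
    unfolding z_def using y hy by (simp add: U_smult U_plus)
  also have "\<dots> = U j y"
  proof (rule eq_vecI)
    fix i assume i: "i < dim_vec (U j y)"
    have "inverse 2 * (a + a) = a" for a :: 'a using two by (simp flip: mult_2)
    then show "(inverse 2 \<cdot>\<^sub>v (U j y + c \<cdot>\<^sub>v U j (h *\<^sub>v y))) $ i = U j y $ i"
      unfolding Uhy using i by simp
  qed (simp add: Uhy)
  finally show ?thesis using that[of z] hz y hy by (simp add: z_def)
qed

text \<open>Consider \<open>(x, y) \<mapsto> x + u y\<close> from the product on the left to the
  \<open>(-c)\<close>-part of \<open>ker u^k\<close>. The hypothesis \<open>lift\<close> makes it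
  surjective, and each fibre is a translate of the \<open>c\<close>-part of \<open>ker u^k\<close>
  by \<open>w \<mapsto> (- u w, w)\<close>. In terms of Jordan blocks, none of size \<open>k\<close>
  occurs.\<close>

lemma card_graded_kernel_step:
  assumes k: "odd k" and c: "c * c = 1"
    and lift: "\<And>x. x \<in> carrier_vec n \<Longrightarrow> U k x = 0\<^sub>v n \<Longrightarrow> \<exists>y\<in>carrier_vec n. U (k - 1) x = U k y"
  shows "card (graded_kernel (k - 1) (- c)) * card (graded_kernel (Suc k) c)
    = card (graded_kernel k (- c)) * card (graded_kernel k c)"
proof -
  define j where "j = k - 1"
  have k': "k = Suc j" and evj: "even j" using k by (auto simp: j_def)
  let ?S = "graded_kernel j (- c) \<times> graded_kernel (Suc k) c"
  define f where "f = (\<lambda>(x, y). x + U 1 y)"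
  have img: "f ` ?S = graded_kernel k (- c)"
  proof (intro equalityI subsetI)
    fix z assume "z \<in> f ` ?S"
    then obtain x y where "z = x + U 1 y" "x \<in> graded_kernel j (- c)" "y \<in> graded_kernel (Suc k) c"
      by (auto simp: f_def)
    then show "z \<in> graded_kernel k (- c)"
      using graded_kernel_plus graded_kernel_mono graded_kernel_U k' by blast
  next
    fix z assume z: "z \<in> graded_kernel k (- c)"
    then have zc: "z \<in> carrier_vec n" and Uz: "U k z = 0\<^sub>v n" and hz: "h *\<^sub>v z = (- c) \<cdot>\<^sub>v z"
      by (auto simp: graded_kernel_def)
    obtain y0 where y0: "y0 \<in> carrier_vec n" "U j z = U k y0" using lift[OF zc Uz] by (auto simp: j_def)
    \<comment> \<open>The lift \<open>y0\<close> need not be homogeneous. But \<open>k - 1\<close>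
      is even, so \<open>U k y0\<close> stays in the eigenspace of \<open>z\<close>, and
      \<open>y0\<close> may be replaced by its \<open>c\<close>-component.\<close>
    have "h *\<^sub>v U k y0 = (- c) \<cdot>\<^sub>v U k y0" using U_even_eigen[OF zc hz evj] y0(2) by simp
    then obtain y where y: "y \<in> carrier_vec n" "h *\<^sub>v y = c \<cdot>\<^sub>v y" "U k y = U k y0"
      using graded_component[OF y0(1) c k] by blast
    have "U (1 + k) y = U (1 + j) z" using U_add[OF y(1), of 1 k] U_add[OF zc, of 1 j] y(3) y0(2) by simp
    then have yk: "y \<in> graded_kernel (Suc k) c" using y(1,2) Uz k' by (simp add: graded_kernel_def)
    have Uy: "U 1 y \<in> graded_kernel k (- c)" by (rule graded_kernel_U[OF yk])
    have "U j (U 1 y) = U j z" using U_add[OF y(1), of j 1] y(3) y0(2) k' by simp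
    then have "U j (z - U 1 y) = 0\<^sub>v n" using zc y(1) U_minus[OF zc, of "U 1 y" j] by simp
    then have "z - U 1 y \<in> graded_kernel j (- c)"
      using graded_kernel_minus[OF z Uy] by (simp add: graded_kernel_def)
    moreover have "z = (z - U 1 y) + U 1 y" using zc U_closed[OF y(1), of 1] by (intro eq_vecI) auto
    ultimately show "z \<in> f ` ?S" using yk by (auto simp: f_def intro!: image_eqI[of _ _ "(z - U 1 y, y)"])
  qed
  have fibre: "card {p \<in> ?S. f p = z} = card (graded_kernel k c)" if "z \<in> f ` ?S" for z
  proof -
    obtain x0 y0 where z: "z = x0 + U 1 y0" and x0: "x0 \<in> graded_kernel j (- c)" and y0: "y0 \<in> graded_kernel (Suc k) c"
      using \<open>z \<in> f ` ?S\<close> by (auto simp: f_def)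
    have c0: "x0 \<in> carrier_vec n" "y0 \<in> carrier_vec n" using x0 y0 by (auto simp: graded_kernel_def)
    have "bij_betw (\<lambda>w. (x0 - U 1 w, y0 + w)) (graded_kernel k c) {p \<in> ?S. f p = z}"
    proof (rule bij_betw_byWitness[where f' = "\<lambda>(x, y). y - y0"])
      show "\<forall>w\<in>graded_kernel k c. (\<lambda>(x, y). y - y0) (x0 - U 1 w, y0 + w) = w"
        using c0 by (auto simp: graded_kernel_def intro!: eq_vecI)
      show "\<forall>p\<in>{p \<in> ?S. f p = z}. (x0 - U 1 ((\<lambda>(x, y). y - y0) p), y0 + (\<lambda>(x, y). y - y0) p) = p"
      proof (rule ballI)
        fix p assume p: "p \<in> {p \<in> ?S. f p = z}"
        obtain x y where xy: "p = (x, y)" by (cases p)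
        have cc: "x \<in> carrier_vec n" "y \<in> carrier_vec n" using p xy by (auto simp: graded_kernel_def)
        have "x + U 1 y = x0 + U 1 y0" using p xy z by (simp add: f_def)
        then have eq: "x $ i + U 1 y $ i = x0 $ i + U 1 y0 $ i" if "i < n" for i
          using that cc c0 carrier_vecD[OF U_closed] by (metis index_add_vec(1))
        have "x0 - (U 1 y - U 1 y0) = x"
        proof (rule eq_vecI)
          fix i assume "i < dim_vec x"
          then have i: "i < n" using cc by simp
          then have "(x0 - (U 1 y - U 1 y0)) $ i = x0 $ i - (U 1 y $ i - U 1 y0 $ i)"
            using c0 carrier_vecD[OF U_closed[OF c0(2), of 1]] by simp
          then show "(x0 - (U 1 y - U 1 y0)) $ i = x $ i"
            by (simp only: diff_diff_eq2 eq[OF i, symmetric] add_diff_cancel_right')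
        qed (use cc c0 carrier_vecD[OF U_closed[OF c0(2)]] in simp)
        moreover have "y0 + (y - y0) = y" using cc c0 by (intro eq_vecI) auto
        ultimately show "(x0 - U 1 ((\<lambda>(x, y). y - y0) p), y0 + (\<lambda>(x, y). y - y0) p) = p"
          using cc c0 by (simp add: U_minus xy)
      qed
      show "(\<lambda>w. (x0 - U 1 w, y0 + w)) ` graded_kernel k c \<subseteq> {p \<in> ?S. f p = z}"
      proof (rule image_subsetI)
        fix w assume w: "w \<in> graded_kernel k c"
        have wc: "w \<in> carrier_vec n" using w by (simp add: graded_kernel_def)
        have "x0 - U 1 w \<in> graded_kernel j (- c)"
          using graded_kernel_minus[OF x0 graded_kernel_U] w k' by simp
        moreover have "y0 + w \<in> graded_kernel (Suc k) c"
          using graded_kernel_plus[OF y0 graded_kernel_mono[OF w]] .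
        moreover have "x0 - U 1 w + U 1 (y0 + w) = z"
          unfolding z U_plus[OF c0(2) wc]
          using c0 wc by (intro eq_vecI) auto
        ultimately show "(x0 - U 1 w, y0 + w) \<in> {p \<in> ?S. f p = z}" by (simp add: f_def)
      qed
      show "(\<lambda>(x, y). y - y0) ` {p \<in> ?S. f p = z} \<subseteq> graded_kernel k c"
      proof (rule image_subsetI)
        fix p assume p: "p \<in> {p \<in> ?S. f p = z}"
        obtain x y where xy: "p = (x, y)" by (cases p)
        have x: "x \<in> graded_kernel j (- c)" and y: "y \<in> graded_kernel (Suc k) c" using p xy by auto
        have cc: "x \<in> carrier_vec n" "y \<in> carrier_vec n" using x y by (auto simp: graded_kernel_def)
        have "x + U 1 y = x0 + U 1 y0" using p xy z by (simp add: f_def)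
        then have eq: "x $ i + U 1 y $ i = x0 $ i + U 1 y0 $ i" if "i < n" for i
          using that cc c0 carrier_vecD[OF U_closed] by (metis index_add_vec(1))
        have "U 1 (y - y0) = x0 - x"
          unfolding U_minus[OF cc(2) c0(2)]
        proof (rule eq_vecI)
          fix i assume "i < dim_vec (x0 - x)"
          then have i: "i < n" using cc by simp
          have "U 1 y $ i - U 1 y0 $ i = x0 $ i - x $ i"
            by (metis add_diff_cancel_left add_diff_cancel_right eq[OF i])
          then show "(U 1 y - U 1 y0) $ i = (x0 - x) $ i"
            using i cc carrier_vecD[OF U_closed[OF c0(2), of 1]] by simp
        qed (use cc c0 carrier_vecD[OF U_closed[OF c0(2)]] in simp)
        moreover have "U j (x0 - x) = 0\<^sub>v n" using graded_kernel_minus[OF x0 x] by (simp add: graded_kernel_def)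
        moreover have "y - y0 \<in> carrier_vec n" using cc c0 by simp
        ultimately have "U k (y - y0) = 0\<^sub>v n" using U_add[of "y - y0" j 1] k' by simp
        then show "(\<lambda>(x, y). y - y0) p \<in> graded_kernel k c"
          using graded_kernel_minus[OF y y0] by (simp add: graded_kernel_def xy)
      qed
    qed
    then show ?thesis by (rule bij_betw_same_card[symmetric])
  qed
  have "card ?S = card (f ` ?S) * card (graded_kernel k c)"
    by (rule card_eq_card_image_times_fibre[OF _ fibre]) simp_all
  then show ?thesis unfolding img by (simp add: card_cartesian_product j_def)
qed

text \<open>The step formulas for \<open>c = 1\<close> and \<open>c = -1\<close> have the same
  right-hand side, so equality at exponent \<open>2m\<close> passes to
  \<open>2m + 2\<close>.\<close>

lemma card_graded_kernel_even:
  assumes lift: "\<And>k x. odd k \<Longrightarrow> x \<in> carrier_vec n \<Longrightarrow> U k x = 0\<^sub>v n \<Longrightarrow> \<exists>y\<in>carrier_vec n. U (k - 1) x = U k y"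
  shows "card (graded_kernel (2 * m) 1) = card (graded_kernel (2 * m) (-1))"
proof (induction m)
  case 0
  have "graded_kernel 0 c = {0\<^sub>v n}" for c
    using zero_in_graded_kernel[of 0 c] by (auto simp: graded_kernel_def U_0)
  then show ?case by simp
next
  case (Suc m)
  let ?k = "Suc (2 * m)"
  have pos: "card (graded_kernel (2 * m) (-1)) \<noteq> 0"
    using zero_in_graded_kernel[of "2 * m" "-1"] by auto
  have k: "odd ?k" by simp
  have "card (graded_kernel (2 * m) (-1)) * card (graded_kernel (Suc ?k) 1)
      = card (graded_kernel (2 * m) 1) * card (graded_kernel (Suc ?k) (-1))"
    using card_graded_kernel_step[OF k, of 1] card_graded_kernel_step[OF k, of "-1"] lift[OF k] by (simp add: mult.commute)
  then show ?case using pos Suc by simp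
qed

text \<open>Beyond the stabilisation index \<open>u\<close> is injective on the image of
  \<open>U M\<close> and exchanges its two graded parts. Using this for both signs gives
  equality.\<close>

lemma card_image_U_le:
  assumes stab: "\<And>x. x \<in> carrier_vec n \<Longrightarrow> U (Suc M) x = 0\<^sub>v n \<Longrightarrow> U M x = 0\<^sub>v n"
  shows "card (U M ` eigenvectors h c) \<le> card (U M ` eigenvectors h (- c))"
proof (rule card_inj_on_le[of "U 1"])
  have E: "eigenvectors h d = {x \<in> carrier_vec n. h *\<^sub>v x = d \<cdot>\<^sub>v x}" for d
    using h by (simp add: eigenvectors_def)
  show "inj_on (U 1) (U M ` eigenvectors h c)"
  proof (rule inj_onI, clarify)
    fix x y assume "x \<in> eigenvectors h c" "y \<in> eigenvectors h c" and eq: "U 1 (U M x) = U 1 (U M y)"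
    then have x: "x \<in> carrier_vec n" and y: "y \<in> carrier_vec n" by (auto simp: E)
    have xy: "x - y \<in> carrier_vec n" using x y by simp
    have "U (1 + M) (x - y) = U 1 (U M x) - U 1 (U M y)"
      unfolding U_add[OF xy] using U_minus[OF x y] U_minus[OF U_closed[OF x] U_closed[OF y]] by simp
    also have "\<dots> = 0\<^sub>v n" unfolding eq using U_closed[OF U_closed[OF y]] by simp
    finally have "U M (x - y) = 0\<^sub>v n" using stab[OF xy] by simp
    then have 0: "U M x - U M y = 0\<^sub>v n" using U_minus[OF x y] by simp
    show "U M x = U M y"
    proof (rule eq_vecI)
      fix i assume "i < dim_vec (U M y)"
      then have i: "i < n" using carrier_vecD[OF U_closed[OF y]] by simp
      have "(U M x - U M y) $ i = 0" using 0 i by simp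
      then show "U M x $ i = U M y $ i" using i carrier_vecD[OF U_closed[OF y]] by simp
    qed (use carrier_vecD[OF U_closed[OF x]] carrier_vecD[OF U_closed[OF y]] in simp)
  qed
  show "U 1 ` U M ` eigenvectors h c \<subseteq> U M ` eigenvectors h (- c)"
  proof clarify
    fix x assume "x \<in> eigenvectors h c"
    then have x: "x \<in> carrier_vec n" and hx: "h *\<^sub>v x = c \<cdot>\<^sub>v x" by (auto simp: E)
    have "U 1 (U M x) = U M (U 1 x)" using U_add[OF x, of 1 M] U_add[OF x, of M 1] by simp
    moreover have "U 1 x \<in> eigenvectors h (- c)" using U_1_eigen[OF x hx] x by (simp add: E)
    ultimately show "U 1 (U M x) \<in> U M ` eigenvectors h (- c)" by blast
  qed
  show "finite (U M ` eigenvectors h (- c))" unfolding E by (intro finite_imageI) simp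
qed

text \<open>Fitting's decomposition in counted form: on each eigenspace \<open>U M\<close> has the
  nilpotent part as kernel and the part where \<open>u\<close> is bijective as image, and the two
  parts are matched separately.\<close>

lemma card_eigenvectors_eq:
  assumes lift: "\<And>k x. odd k \<Longrightarrow> x \<in> carrier_vec n \<Longrightarrow> U k x = 0\<^sub>v n \<Longrightarrow> \<exists>y\<in>carrier_vec n. U (k - 1) x = U k y"
  shows "card (eigenvectors h 1) = card (eigenvectors h (-1))"
proof -
  have E: "eigenvectors h d = {x \<in> carrier_vec n. h *\<^sub>v x = d \<cdot>\<^sub>v x}" for d
    using h by (simp add: eigenvectors_def)
  obtain e where e: "\<And>l x. e \<le> l \<Longrightarrow> x \<in> carrier_vec n \<Longrightarrow> U (Suc l) x = 0\<^sub>v n \<Longrightarrow> U l x = 0\<^sub>v n"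
    using kernel_power_stabilises[OF u] unfolding U_def by blast
  \<comment> \<open>Doubling stays beyond the stabilisation index and gives an even exponent, where
    the graded kernels have equal size.\<close>
  define M where "M = 2 * e"
  have stab: "U M x = 0\<^sub>v n" if "x \<in> carrier_vec n" "U (Suc M) x = 0\<^sub>v n" for x
    using e[of M x] that by (simp add: M_def)
  have "card (eigenvectors h d) = card (U M ` eigenvectors h d) * card (graded_kernel M d)" for d
  proof (rule card_eq_card_image_times_fibre)
    show "finite (eigenvectors h d)" unfolding E by simp
    fix z assume "z \<in> U M ` eigenvectors h d"
    then obtain x0 where x0: "x0 \<in> carrier_vec n" "h *\<^sub>v x0 = d \<cdot>\<^sub>v x0" and z: "z = U M x0" by (auto simp: E)
    have "bij_betw (\<lambda>w. x0 + w) (graded_kernel M d) {x \<in> eigenvectors h d. U M x = z}"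
    proof (rule bij_betw_byWitness[where f' = "\<lambda>x. x - x0"])
      show "\<forall>w\<in>graded_kernel M d. x0 + w - x0 = w"
        using x0 by (auto simp: graded_kernel_def intro!: eq_vecI)
      show "\<forall>x\<in>{x \<in> eigenvectors h d. U M x = z}. x0 + (x - x0) = x"
        using x0 by (auto simp: E intro!: eq_vecI)
      show "(\<lambda>w. x0 + w) ` graded_kernel M d \<subseteq> {x \<in> eigenvectors h d. U M x = z}"
        using x0 z mult_add_distrib_mat_vec[OF h x0(1)] smult_add_distrib_vec[OF x0(1)]
        by (auto simp: graded_kernel_def E U_plus)
      show "(\<lambda>x. x - x0) ` {x \<in> eigenvectors h d. U M x = z} \<subseteq> graded_kernel M d"
      proof clarify
        fix x assume "x \<in> eigenvectors h d" and Ux: "z = U M x"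
        then have x: "x \<in> carrier_vec n" "h *\<^sub>v x = d \<cdot>\<^sub>v x" by (auto simp: E)
        have "d \<cdot>\<^sub>v x - d \<cdot>\<^sub>v x0 = d \<cdot>\<^sub>v (x - x0)" using x x0 by (intro eq_vecI) (auto simp: algebra_simps)
        moreover have "U M (x - x0) = 0\<^sub>v n"
          unfolding U_minus[OF x(1) x0(1)] using z Ux minus_cancel_vec[OF U_closed[OF x(1), of M]] by metis
        ultimately show "x - x0 \<in> graded_kernel M d"
          using h_minus[OF x(1) x0(1)] x x0 by (simp add: graded_kernel_def)
      qed
    qed
    then show "card {x \<in> eigenvectors h d. U M x = z} = card (graded_kernel M d)"
      by (rule bij_betw_same_card[symmetric])
  qed
  moreover have "card (U M ` eigenvectors h 1) = card (U M ` eigenvectors h (-1))"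
    using card_image_U_le[of M 1] card_image_U_le[of M "-1"] stab by simp
  moreover have "card (graded_kernel M 1) = card (graded_kernel M (-1))"
    unfolding M_def by (rule card_graded_kernel_even[OF lift])
  ultimately show ?thesis by simp
qed

end

text \<open>The lifting hypothesis for \<open>t^2 - 1\<close> at \<open>A\<close> becomes one for
  powers of \<open>u = A - Ai\<close>, since both differ by powers of the invertible
  \<open>A\<close>. The equal eigenspaces of \<open>h\<close> then have dimension \<open>n/2\<close>
  each.\<close>

lemma det_reversing_involution:
  fixes A h :: "'a :: {field, finite} mat"
  assumes two: "(2 :: 'a) \<noteq> 0" and A: "A \<in> carrier_mat n n" and Ai: "Ai \<in> carrier_mat n n" and h: "h \<in> carrier_mat n n"
    and AAi: "A * Ai = 1\<^sub>m n" "Ai * A = 1\<^sub>m n" and hh: "h * h = 1\<^sub>m n" and hA: "h * A = Ai * h"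
    and lift: "\<And>k. odd k \<Longrightarrow> kernel_lifts A [:-1, 0, 1:] k"
  shows "even n \<and> det h = (-1) ^ (n div 2)"
proof -
  define u where "u = A - Ai"
  have u: "u \<in> carrier_mat n n" unfolding u_def using A Ai by (simp add: minus_carrier_mat)
  have hAi: "h * Ai = A * h"
  proof -
    have hAc: "h * A \<in> carrier_mat n n" "A * h \<in> carrier_mat n n" "h * Ai \<in> carrier_mat n n" using h A Ai by auto
    have "A * h = A * h * (A * Ai)" unfolding AAi right_mult_one_mat[OF hAc(2)] ..
    also have "\<dots> = A * (h * A) * Ai"
      using assoc_mult_mat[OF hAc(2) A Ai] assoc_mult_mat[OF A h A] by simp
    also have "A * (h * A) = h"
      unfolding hA assoc_mult_mat[OF A Ai h, symmetric] AAi by (rule left_mult_one_mat[OF h])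
    finally show ?thesis ..
  qed
  have "h * u = h * A - h * Ai" unfolding u_def by (rule mult_minus_distrib_mat[OF h A Ai])
  also have "\<dots> = - u * h"
  proof (rule mat_eq_by_vec)
    fix x :: "'a vec" assume x: "x \<in> carrier_vec n"
    have hx: "h *\<^sub>v x \<in> carrier_vec n" using h x by simp
    have "- u *\<^sub>v (h *\<^sub>v x) = - (u *\<^sub>v (h *\<^sub>v x))"
      by (rule uminus_mult_mat_vec) (use u h in simp)
    also have "u *\<^sub>v (h *\<^sub>v x) = A *\<^sub>v (h *\<^sub>v x) - Ai *\<^sub>v (h *\<^sub>v x)"
      unfolding u_def by (rule minus_mult_distrib_mat_vec[OF A Ai hx])
    also have "- (A *\<^sub>v (h *\<^sub>v x) - Ai *\<^sub>v (h *\<^sub>v x)) = Ai *\<^sub>v (h *\<^sub>v x) - A *\<^sub>v (h *\<^sub>v x)" using A Ai by (intro eq_vecI) auto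
    finally have uh: "- u *\<^sub>v (h *\<^sub>v x) = Ai *\<^sub>v (h *\<^sub>v x) - A *\<^sub>v (h *\<^sub>v x)" .
    have c: "h * A \<in> carrier_mat n n" "h * Ai \<in> carrier_mat n n" "- u \<in> carrier_mat n n" using h A Ai u by auto
    show "(h * A - h * Ai) *\<^sub>v x = (- u * h) *\<^sub>v x"
      unfolding minus_mult_distrib_mat_vec[OF c(1,2) x] assoc_mult_mat_vec[OF c(3) h x] uh
      unfolding hA hAi assoc_mult_mat_vec[OF Ai h x] assoc_mult_mat_vec[OF A h x] ..
  qed (use h A Ai u in \<open>auto simp: minus_carrier_mat\<close>)
  finally have hu: "h * u = - u * h" .
  interpret anticommuting_involution n u h by unfold_locales (use u h hh hu two in auto)
  have uA: "u * A = A * u"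
    unfolding u_def minus_mult_distrib_mat[OF A Ai A] mult_minus_distrib_mat[OF A A Ai] AAi ..
  have UA: "U j (A *\<^sub>v x) = A *\<^sub>v U j x" if "x \<in> carrier_vec n" for j x
    unfolding U_def by (rule poly_act_similar[OF u u A u uA that])
  let ?a = "\<lambda>j. poly_act A ([:0, 1:] ^ j)"
  have a_Suc: "?a (Suc j) x = ?a j (A *\<^sub>v x)" "?a (Suc j) x = A *\<^sub>v ?a j x" if x: "x \<in> carrier_vec n" for j x
  proof -
    have X: "poly_act A [:0, 1:] y = A *\<^sub>v y" if y: "y \<in> carrier_vec n" for y
      using poly_act_linear[OF A y, of 0] zero_smult_vec[OF A y] A y by simp
    show "?a (Suc j) x = A *\<^sub>v ?a j x"
      unfolding power_Suc poly_act_mult[OF A x] by (rule X[OF poly_act_closed[OF A x]])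
    show "?a (Suc j) x = ?a j (A *\<^sub>v x)"
      unfolding power_Suc2 poly_act_mult[OF A x] X[OF x] ..
  qed
  have a_inj: "x = 0\<^sub>v n" if "x \<in> carrier_vec n" "?a j x = 0\<^sub>v n" for j x
    using that
  proof (induction j)
    case 0
    then show ?case by (simp add: poly_act_1[OF A])
  next
    case (Suc j)
    have c: "?a j x \<in> carrier_vec n" by (rule poly_act_closed[OF A Suc.prems(1)])
    have "?a j x = Ai *\<^sub>v (A *\<^sub>v ?a j x)"
      unfolding assoc_mult_mat_vec[OF Ai A c, symmetric] AAi using c by simp
    also have "\<dots> = 0\<^sub>v n"
      using Suc.prems(2) a_Suc(2)[OF Suc.prems(1), of j] mult_mat_zero_vec[OF Ai] by simp
    finally show ?case using Suc by blast
  qed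
  \<comment> \<open>\<open>A^2 - 1 = A u\<close> and \<open>A\<close> commutes with
    \<open>u\<close>, so \<open>(t^2 - 1)^j\<close> acts as \<open>A^j u^j\<close>.\<close>
  have sU: "poly_act A ([:-1, 0, 1:] ^ j) x = ?a j (U j x)" if x: "x \<in> carrier_vec n" for j x
    using x
  proof (induction j arbitrary: x)
    case 0
    then show ?case by (simp add: poly_act_1[OF A] U_0)
  next
    case (Suc j)
    note x = Suc.prems
    have Ax: "A *\<^sub>v x \<in> carrier_vec n" and Aix: "Ai *\<^sub>v x \<in> carrier_vec n" and ux: "u *\<^sub>v x \<in> carrier_vec n"
      using A Ai u x by auto
    have AAx: "A *\<^sub>v (A *\<^sub>v x) \<in> carrier_vec n" using A Ax by simp
    have "A *\<^sub>v (u *\<^sub>v x) = A *\<^sub>v (A *\<^sub>v x) - A *\<^sub>v (Ai *\<^sub>v x)"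
      unfolding u_def minus_mult_distrib_mat_vec[OF A Ai x] by (rule mult_minus_distrib_mat_vec[OF A Ax Aix])
    also have "A *\<^sub>v (Ai *\<^sub>v x) = x" unfolding assoc_mult_mat_vec[OF A Ai x, symmetric] AAi using x by simp
    finally have Aux: "A *\<^sub>v (u *\<^sub>v x) = A *\<^sub>v (A *\<^sub>v x) - x" .
    have "poly_act A [:-1, 0, 1:] x = (-1) \<cdot>\<^sub>v x + A *\<^sub>v (0 \<cdot>\<^sub>v x + A *\<^sub>v x)"
      unfolding poly_act_pCons[OF A x, of "-1"] poly_act_linear[OF A x] ..
    also have "0 \<cdot>\<^sub>v x + A *\<^sub>v x = A *\<^sub>v x" unfolding zero_smult_vec[OF A x] using Ax by simp
    also have "(-1) \<cdot>\<^sub>v x + A *\<^sub>v (A *\<^sub>v x) = A *\<^sub>v (A *\<^sub>v x) - x" using x A by (intro eq_vecI) auto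
    finally have s: "poly_act A [:-1, 0, 1:] x = A *\<^sub>v (u *\<^sub>v x)" using Aux by simp
    have "poly_act A ([:-1, 0, 1:] ^ Suc j) x = ?a j (U j (A *\<^sub>v (u *\<^sub>v x)))"
      unfolding power_Suc2 poly_act_mult[OF A x] s by (rule Suc.IH) (use A ux in simp)
    also have "\<dots> = ?a (Suc j) (U j (u *\<^sub>v x))" unfolding UA[OF ux] by (rule a_Suc(1)[symmetric]) (use ux in simp)
    also have "U j (u *\<^sub>v x) = U (Suc j) x" using U_add[OF x, of j 1] U_1[OF x] by simp
    finally show ?case .
  qed
  have lifts: "\<exists>y\<in>carrier_vec n. U (k - 1) x = U k y"
    if k: "odd k" and x: "x \<in> carrier_vec n" and Ux: "U k x = 0\<^sub>v n" for k x
  proof -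
    have "poly_act A ([:-1, 0, 1:] ^ k) x = 0\<^sub>v n" unfolding sU[OF x] Ux by (rule poly_act_zero_vec[OF A])
    then obtain y where y: "y \<in> carrier_vec n"
      and eq: "poly_act A ([:-1, 0, 1:] ^ (k - 1)) x = poly_act A ([:-1, 0, 1:] ^ k) y"
      using lift[OF k] x unfolding kernel_lifts_iff[OF A] by blast
    have Ay: "A *\<^sub>v y \<in> carrier_vec n" using A y by simp
    obtain j where j: "k = Suc j" using k by (cases k) auto
    \<comment> \<open>The exponents of \<open>A\<close> on the two sides differ by one; the spare
      factor is absorbed into the vector so that \<open>A^j\<close> cancels.\<close>
    have "?a j (U j x) = ?a j (U k (A *\<^sub>v y))"
      using eq unfolding sU[OF x] sU[OF y] UA[OF y] j diff_Suc_1 a_Suc(1)[OF U_closed[OF y]] .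
    then have "?a j (U j x + (-1) \<cdot>\<^sub>v U k (A *\<^sub>v y)) = ?a j (U j x) + (-1) \<cdot>\<^sub>v ?a j (U j x)"
      using poly_act_add_vec[OF A U_closed[OF x], of "(-1) \<cdot>\<^sub>v U k (A *\<^sub>v y)"] poly_act_smult_vec[OF A U_closed[OF Ay]]
        U_closed[OF Ay] by simp
    also have "\<dots> = 0\<^sub>v n" using poly_act_closed[OF A U_closed[OF x, of j], of "[:0, 1:] ^ j"] by (intro eq_vecI) auto
    finally have z: "U j x + (-1) \<cdot>\<^sub>v U k (A *\<^sub>v y) = 0\<^sub>v n" by (rule a_inj[rotated]) (use x Ay in simp)
    have "U j x = U k (A *\<^sub>v y)"
    proof (rule eq_vecI)
      fix i assume "i < dim_vec (U k (A *\<^sub>v y))"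
      then have i: "i < n" using Ay by simp
      have "(U j x + (-1) \<cdot>\<^sub>v U k (A *\<^sub>v y)) $ i = 0" using z i by simp
      then show "U j x $ i = U k (A *\<^sub>v y) $ i" using i x Ay by simp
    qed (use x Ay in simp)
    then show ?thesis using Ay j by auto
  qed
  obtain a b where split: "involution_split h a b" using involution_split_exists[OF two h hh] by blast
  have "card (eigenvectors h 1) = card (eigenvectors h (-1))" by (rule card_eigenvectors_eq) (rule lifts)
  then have "CARD('a) ^ a = CARD('a) ^ b" using split unfolding involution_split_def by metis
  moreover have "1 < CARD('a)"
    using card_mono[of "UNIV :: 'a set" "{0, 1}"] by simp
  ultimately have "a = b" by simp
  then show ?thesis using split h by (auto simp: involution_split_def)
qed

section \<open>Sylvester's determinant identity\<close>

lemma mat_minus_add_cancel: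
  fixes U V :: "'a :: ring mat"
  assumes "U \<in> carrier_mat n m" "V \<in> carrier_mat n m"
  shows "U + (V - U) = V" "V - U + U = V"
  using assms by (auto intro!: eq_matI)

text \<open>The block matrix with unit diagonal blocks and off-diagonal blocks \<open>B\<close>,
  \<open>C\<close> has two triangular factorisations, one for each side.\<close>

lemma det_sylvester:
  assumes B: "(B :: 'a :: idom mat) \<in> carrier_mat n k" and C: "C \<in> carrier_mat k n"
  shows "det (1\<^sub>m n - B * C) = det (1\<^sub>m k - C * B)"
proof -
  have BC: "B * C \<in> carrier_mat n n" and CB: "C * B \<in> carrier_mat k k" using B C by auto
  have d: "1\<^sub>m n - B * C \<in> carrier_mat n n" "1\<^sub>m k - C * B \<in> carrier_mat k k"
    using BC CB by (auto simp: minus_carrier_mat)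
  have o: "1\<^sub>m n \<in> carrier_mat n n" "1\<^sub>m k \<in> carrier_mat k k" "0\<^sub>m n k \<in> carrier_mat n k" "0\<^sub>m k n \<in> carrier_mat k n"
    for n k by auto
  let ?L = "four_block_mat (1\<^sub>m n) (0\<^sub>m n k) C (1\<^sub>m k)"
  let ?M1 = "four_block_mat (1\<^sub>m n) B (0\<^sub>m k n) (1\<^sub>m k - C * B)"
  let ?M2 = "four_block_mat (1\<^sub>m n - B * C) B (0\<^sub>m k n) (1\<^sub>m k)"
  have "?L * ?M1 = four_block_mat (1\<^sub>m n) B C (1\<^sub>m k)"
    unfolding mult_four_block_mat[OF o(1) o(3) C o(2) o(1) B o(4) d(2)]
  proof (rule cong_four_block_mat)
    show "C * B + 1\<^sub>m k * (1\<^sub>m k - C * B) = 1\<^sub>m k"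
      unfolding left_mult_one_mat[OF d(2)] by (rule mat_minus_add_cancel[OF CB]) simp
  qed (use B C d in \<open>auto intro!: eq_matI\<close>)
  moreover have "?M2 * ?L = four_block_mat (1\<^sub>m n) B C (1\<^sub>m k)"
    unfolding mult_four_block_mat[OF d(1) B o(4) o(2) o(1) o(3) C o(2)]
  proof (rule cong_four_block_mat)
    show "(1\<^sub>m n - B * C) * 1\<^sub>m n + B * C = 1\<^sub>m n"
      unfolding right_mult_one_mat[OF d(1)] by (rule mat_minus_add_cancel[OF BC]) simp
    show "(1\<^sub>m n - B * C) * 0\<^sub>m n k + B * 1\<^sub>m k = B"
      unfolding right_mult_zero_mat[OF d(1)] right_mult_one_mat[OF B] by (rule left_add_zero_mat[OF B])
  qed (use B C d in \<open>auto intro!: eq_matI\<close>)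
  moreover have L: "det ?L = 1" by (subst det_four_block_mat_upper_right_zero[OF o(1) refl C o(2)]) simp
  moreover have "det (?L * ?M1) = det ?L * det ?M1"
    by (rule det_mult[of _ "n + k"]) (use four_block_carrier_mat[OF o(1) o(2)] four_block_carrier_mat[OF o(1) d(2)] in auto)
  moreover have "det (?M2 * ?L) = det ?M2 * det ?L"
    by (rule det_mult[of _ "n + k"]) (use four_block_carrier_mat[OF o(1) o(2)] four_block_carrier_mat[OF d(1) o(2)] in auto)
  moreover have "det ?M1 = det (1\<^sub>m k - C * B)"
    by (subst det_four_block_mat_lower_left_zero[OF o(1) B refl d(2)]) simp
  moreover have "det ?M2 = det (1\<^sub>m n - B * C)"
    by (subst det_four_block_mat_lower_left_zero[OF d(1) B refl o(2)]) simp
  ultimately show ?thesis by simp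
qed

section \<open>Hermitian spaces over a finite field\<close>

text \<open>Only additivity of the \<open>q\<close>-th power is assumed, so that the finite field
  and its algebraic closure are both instances.\<close>

locale additive_power =
  fixes q :: nat and ty :: "'a :: field itself"
  assumes q_pos: "0 < q" and power_add_q: "\<And>x y :: 'a. (x + y) ^ q = x ^ q + y ^ q"
begin

sublocale frob: semiring_hom "\<lambda>x :: 'a. x ^ q"
  by unfold_locales (use q_pos in \<open>simp_all add: power_add_q power_mult_distrib\<close>)

definition star :: "'a mat \<Rightarrow> 'a mat" where
  "star M = transpose_mat (frob_mat q M)"

lemma star_closed [simp]: "M \<in> carrier_mat n m \<Longrightarrow> star M \<in> carrier_mat m n"
  by (simp add: star_def frob_mat_def)

lemma star_mult:
  assumes "A \<in> carrier_mat n m" "B \<in> carrier_mat m k"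
  shows "star (A * B) = star B * star A"
  using transpose_mult[of "frob_mat q A" n m "frob_mat q B" k] frob.mat_hom_mult[OF assms] assms
  by (simp add: star_def frob_mat_def)

lemma star_one: "star (1\<^sub>m n) = 1\<^sub>m n"
  by (simp add: star_def frob_mat_def frob.mat_hom_one)

end

locale hermitian_space = additive_power q ty for q and ty :: "'a :: {field, finite} itself" +
  fixes n :: nat and \<eta> :: "'a mat"
  assumes power_q_q: "\<And>x :: 'a. (x ^ q) ^ q = x"
    and eta: "\<eta> \<in> carrier_mat n n" and star_eta: "star \<eta> = \<eta>" and det_eta: "det \<eta> \<noteq> 0"
begin

lemma minus_one_power_q: "(-1 :: 'a) ^ q = -1"
proof -
  have "(1 + -1 :: 'a) ^ q = 1 ^ q + (-1) ^ q" by (rule power_add_q)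
  then show ?thesis using q_pos by (simp add: eq_neg_iff_add_eq_0 add.commute)
qed

lemma star_star: "star (star M) = M"
  by (rule eq_matI) (simp_all add: star_def frob_mat_def power_q_q)

definition conj_vec :: "'a vec \<Rightarrow> 'a vec" where "conj_vec v = map_vec (\<lambda>x. x ^ q) v"

definition form :: "'a vec \<Rightarrow> 'a vec \<Rightarrow> 'a" where "form x y = conj_vec x \<bullet> (\<eta> *\<^sub>v y)"

lemma conj_vec_closed [simp]: "x \<in> carrier_vec n \<Longrightarrow> conj_vec x \<in> carrier_vec n"
  by (simp add: conj_vec_def)

lemma eta_closed [simp]: "x \<in> carrier_vec n \<Longrightarrow> \<eta> *\<^sub>v x \<in> carrier_vec n"
  using eta by simp

lemma form_add_right: "x \<in> carrier_vec n \<Longrightarrow> y \<in> carrier_vec n \<Longrightarrow> z \<in> carrier_vec n \<Longrightarrow>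
    form x (y + z) = form x y + form x z"
  unfolding form_def mult_add_distrib_mat_vec[OF eta] by (rule scalar_prod_add_distrib[of _ n]) simp_all

lemma form_smult_right: "x \<in> carrier_vec n \<Longrightarrow> y \<in> carrier_vec n \<Longrightarrow> form x (c \<cdot>\<^sub>v y) = c * form x y"
  unfolding form_def mult_mat_vec[OF eta] by (rule scalar_prod_smult_right) (use eta in \<open>simp add: conj_vec_def\<close>)

lemma form_zero_right [simp]: "x \<in> carrier_vec n \<Longrightarrow> form x (0\<^sub>v n) = 0"
  unfolding form_def mult_mat_zero_vec[OF eta] by (rule scalar_prod_right_zero) simp

lemma form_commute:
  assumes x: "x \<in> carrier_vec n" and y: "y \<in> carrier_vec n"
  shows "form y x = form x y ^ q"
proof -
  have F: "frob_mat q \<eta> \<in> carrier_mat n n" using eta by (simp add: frob_mat_def)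
  have "form x y ^ q = (\<Sum>i\<in>{0..<n}. x $ i * (frob_mat q \<eta> *\<^sub>v conj_vec y) $ i)"
  proof -
    have "(\<eta> *\<^sub>v y) $ i ^ q = (frob_mat q \<eta> *\<^sub>v conj_vec y) $ i" if "i < n" for i
    proof -
      have "map_vec (\<lambda>x. x ^ q) (\<eta> *\<^sub>v y) $ i = (frob_mat q \<eta> *\<^sub>v conj_vec y) $ i"
        unfolding frob.mult_mat_vec_hom[OF eta y] frob_mat_def conj_vec_def ..
      then show ?thesis using that eta by simp
    qed
    moreover have "form x y = (\<Sum>i\<in>{0..<n}. conj_vec x $ i * (\<eta> *\<^sub>v y) $ i)"
      using eta by (simp add: form_def scalar_prod_def)
    ultimately show ?thesis
      using x by (simp add: frob.hom_sum power_mult_distrib conj_vec_def power_q_q)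
  qed
  also have "\<dots> = x \<bullet> (frob_mat q \<eta> *\<^sub>v conj_vec y)" using F by (simp add: scalar_prod_def)
  also have "\<dots> = (frob_mat q \<eta> *\<^sub>v conj_vec y) \<bullet> x"
    by (rule comm_scalar_prod[of _ n]) (use x y F in simp_all)
  also have "\<dots> = (transpose_mat \<eta> *\<^sub>v conj_vec y) \<bullet> x"
    using star_eta unfolding star_def by (metis transpose_transpose)
  also have "\<dots> = form y x" unfolding form_def by (rule transpose_vec_mult_scalar[OF eta x]) (use y in simp)
  finally show ?thesis ..
qed

lemma form_add_left: "x \<in> carrier_vec n \<Longrightarrow> y \<in> carrier_vec n \<Longrightarrow> z \<in> carrier_vec n \<Longrightarrow>
    form (x + y) z = form x z + form y z"
  using form_commute[of z "x + y"] form_commute[of z x] form_commute[of z y] form_add_right[of z x y]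
  by (simp add: power_add_q)

lemma form_smult_left: "x \<in> carrier_vec n \<Longrightarrow> y \<in> carrier_vec n \<Longrightarrow> form (c \<cdot>\<^sub>v x) y = c ^ q * form x y"
  using form_commute[of y "c \<cdot>\<^sub>v x"] form_commute[of y x] form_smult_right[of y x c]
  by (simp add: power_mult_distrib)

text \<open>Turns the functional of a block witness into a vector, so that it can be compared with
  the kernel of the adjoint.\<close>

lemma form_represents:
  assumes r: "r \<in> carrier_vec n"
  obtains y where "y \<in> carrier_vec n" "\<And>z. z \<in> carrier_vec n \<Longrightarrow> form y z = r \<bullet> z"
proof -
  obtain \<theta> where th: "\<theta> \<in> carrier_mat n n" and inv: "\<eta> * \<theta> = 1\<^sub>m n" "\<theta> * \<eta> = 1\<^sub>m n"
    using mat_inverse_of_det[OF eta det_eta] by blast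
  define y where "y = conj_vec (transpose_mat \<theta> *\<^sub>v r)"
  have w: "transpose_mat \<theta> *\<^sub>v r \<in> carrier_vec n" using th r by (simp add: mult_mat_vec_carrier[of _ n n])
  have y: "y \<in> carrier_vec n" unfolding y_def using w by simp
  have cy: "conj_vec y = transpose_mat \<theta> *\<^sub>v r"
    unfolding y_def conj_vec_def by (intro eq_vecI) (simp_all add: power_q_q)
  have "form y z = r \<bullet> z" if z: "z \<in> carrier_vec n" for z
  proof -
    have "form y z = r \<bullet> (\<theta> *\<^sub>v (\<eta> *\<^sub>v z))"
      unfolding form_def cy by (rule transpose_vec_mult_scalar[OF th _ r]) (use z in simp)
    also have "\<theta> *\<^sub>v (\<eta> *\<^sub>v z) = z" unfolding assoc_mult_mat_vec[OF th eta z, symmetric] inv using z by simp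
    finally show ?thesis .
  qed
  then show ?thesis using that[OF y] by blast
qed

lemma form_nondegenerate:
  assumes v: "v \<in> carrier_vec n" and w: "w \<in> carrier_vec n"
    and eq: "\<And>x. x \<in> carrier_vec n \<Longrightarrow> form x v = form x w"
  shows "v = w"
proof (rule eq_vecI)
  fix i assume "i < dim_vec w"
  then have i: "i < n" using w by simp
  obtain y where y: "y \<in> carrier_vec n" and f: "\<And>z. z \<in> carrier_vec n \<Longrightarrow> form y z = unit_vec n i \<bullet> z"
    using form_represents[OF unit_vec_carrier] by metis
  show "v $ i = w $ i" using eq[OF y] f[OF v] f[OF w] v w i by simp
qed (use v w in simp)

lemma form_cols:
  assumes B: "B \<in> carrier_mat n k" and ij: "i < k" "j < k"
  shows "(star B * (\<eta> * B)) $$ (i, j) = form (col B i) (col B j)"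
proof -
  have "row (star B) i = conj_vec (col B i)"
    using B ij by (intro eq_vecI) (auto simp: star_def frob_mat_def conj_vec_def)
  moreover have "col (\<eta> * B) j = \<eta> *\<^sub>v col B j" using col_mult2[OF eta B ij(2)] .
  moreover have "(star B * (\<eta> * B)) $$ (i, j) = row (star B) i \<bullet> col (\<eta> * B) j"
    by (rule index_mult_mat(1)) (use B ij in \<open>auto simp: star_def frob_mat_def\<close>)
  ultimately show ?thesis by (simp only: form_def)
qed

definition unitary :: "'a mat \<Rightarrow> bool" where
  "unitary M \<longleftrightarrow> M \<in> carrier_mat n n \<and> star M * (\<eta> * M) = \<eta>"

lemma unitary_iff_form:
  assumes M: "M \<in> carrier_mat n n"
  shows "unitary M \<longleftrightarrow> (\<forall>x\<in>carrier_vec n. \<forall>y\<in>carrier_vec n. form (M *\<^sub>v x) (M *\<^sub>v y) = form x y)"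
proof
  assume "unitary M"
  then have eq: "star M * (\<eta> * M) = \<eta>" by (simp add: unitary_def)
  have F: "frob_mat q M \<in> carrier_mat n n" using M by (simp add: frob_mat_def)
  show "\<forall>x\<in>carrier_vec n. \<forall>y\<in>carrier_vec n. form (M *\<^sub>v x) (M *\<^sub>v y) = form x y"
  proof (intro ballI)
    fix x y :: "'a vec" assume x: "x \<in> carrier_vec n" and y: "y \<in> carrier_vec n"
    have My: "M *\<^sub>v y \<in> carrier_vec n" using M y by simp
    have S: "star M \<in> carrier_mat n n" using M by simp
    have eM: "\<eta> * M \<in> carrier_mat n n" using M eta by simp
    have e: "star M *\<^sub>v (\<eta> *\<^sub>v (M *\<^sub>v y)) = \<eta> *\<^sub>v y"
      unfolding assoc_mult_mat_vec[OF eta M y, symmetric] assoc_mult_mat_vec[OF S eM y, symmetric] eq ..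
    have "form (M *\<^sub>v x) (M *\<^sub>v y) = (frob_mat q M *\<^sub>v conj_vec x) \<bullet> (\<eta> *\<^sub>v (M *\<^sub>v y))"
      unfolding form_def conj_vec_def frob.mult_mat_vec_hom[OF M x] frob_mat_def ..
    also have "\<dots> = (transpose_mat (star M) *\<^sub>v conj_vec x) \<bullet> (\<eta> *\<^sub>v (M *\<^sub>v y))"
      by (simp add: star_def)
    also have "\<dots> = conj_vec x \<bullet> (star M *\<^sub>v (\<eta> *\<^sub>v (M *\<^sub>v y)))"
      by (rule transpose_vec_mult_scalar[OF S]) (use x My in simp_all)
    finally show "form (M *\<^sub>v x) (M *\<^sub>v y) = form x y" unfolding e form_def .
  qed
next
  assume iso: "\<forall>x\<in>carrier_vec n. \<forall>y\<in>carrier_vec n. form (M *\<^sub>v x) (M *\<^sub>v y) = form x y"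
  have "star M * (\<eta> * M) = \<eta>"
  proof (rule eq_matI)
    fix i j assume "i < dim_row \<eta>" "j < dim_col \<eta>"
    then have ij: "i < n" "j < n" using eta by auto
    have colM: "col M l = M *\<^sub>v unit_vec n l" if "l < n" for l
      using M that by (intro eq_vecI) auto
    have "(star M * (\<eta> * M)) $$ (i, j) = form (unit_vec n i) (unit_vec n j)"
      unfolding form_cols[OF M ij] using iso ij by (simp add: colM)
    also have "\<dots> = (star (1\<^sub>m n) * (\<eta> * 1\<^sub>m n)) $$ (i, j)"
      using form_cols[of "1\<^sub>m n" n i j] ij by simp
    finally show "(star M * (\<eta> * M)) $$ (i, j) = \<eta> $$ (i, j)" using eta by (simp add: star_one)
  qed (use M eta in \<open>auto simp: star_def frob_mat_def\<close>)
  then show "unitary M" using M by (simp add: unitary_def)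
qed

end

section \<open>Changing the sign of the determinant of a reversing involution\<close>

context hermitian_space
begin

text \<open>The form \<open>form v (T w)\<close> is Hermitian and invariant under \<open>h\<close>.
  Averaging over \<open>h\<close> makes it nonzero on one eigenspace, and polarisation there yields
  an anisotropic vector.\<close>

lemma isotypic_vector:
  assumes two: "(2 :: 'a) \<noteq> 0" and T: "\<And>v. v \<in> N \<Longrightarrow> T v \<in> carrier_vec n"
    and N: "N \<subseteq> carrier_vec n" and N_add: "\<And>v w. v \<in> N \<Longrightarrow> w \<in> N \<Longrightarrow> v + w \<in> N"
    and N_smult: "\<And>v c. v \<in> N \<Longrightarrow> c \<cdot>\<^sub>v v \<in> N"
    and T_add: "\<And>v w. v \<in> N \<Longrightarrow> w \<in> N \<Longrightarrow> T (v + w) = T v + T w"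
    and T_smult: "\<And>v c. v \<in> N \<Longrightarrow> T (c \<cdot>\<^sub>v v) = c \<cdot>\<^sub>v T v"
    and T_herm: "\<And>v w. v \<in> N \<Longrightarrow> w \<in> N \<Longrightarrow> form w (T v) = form v (T w) ^ q"
    and h: "h \<in> carrier_mat n n" and hh: "h * h = 1\<^sub>m n" and hN: "\<And>v. v \<in> N \<Longrightarrow> h *\<^sub>v v \<in> N"
    and T_h: "\<And>v w. v \<in> N \<Longrightarrow> w \<in> N \<Longrightarrow> form (h *\<^sub>v v) (T (h *\<^sub>v w)) = form v (T w)"
    and x: "x \<in> N" and y: "y \<in> N" and xy: "form y (T x) \<noteq> 0"
  obtains z s where "z \<in> N" "s = 1 \<or> s = -1" "h *\<^sub>v z = s \<cdot>\<^sub>v z" "form z (T z) \<noteq> 0"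
proof -
  have Nc: "v \<in> carrier_vec n" if "v \<in> N" for v using N that by blast
  have hhv: "h *\<^sub>v (h *\<^sub>v v) = v" if v: "v \<in> carrier_vec n" for v
    unfolding assoc_mult_mat_vec[OF h h v, symmetric] hh using v by simp
  define pr where "pr s v = v + s \<cdot>\<^sub>v (h *\<^sub>v v)" for s v
  have prN: "pr s v \<in> N" if "v \<in> N" for s v
    unfolding pr_def using that N_add N_smult hN by blast
  have prh: "h *\<^sub>v pr s v = s \<cdot>\<^sub>v pr s v" if v: "v \<in> N" and s: "s * s = 1" for s v
  proof -
    note vc = Nc[OF v] and hvc = Nc[OF hN[OF v]]
    have "h *\<^sub>v pr s v = h *\<^sub>v v + s \<cdot>\<^sub>v v"
      unfolding pr_def mult_add_distrib_mat_vec[OF h vc smult_carrier_vec[THEN iffD2, OF hvc]]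
        mult_mat_vec[OF h hvc] hhv[OF vc] ..
    also have "\<dots> = s \<cdot>\<^sub>v pr s v"
    proof (rule eq_vecI)
      fix i assume "i < dim_vec (s \<cdot>\<^sub>v pr s v)"
      then have i: "i < n" using h by (simp add: pr_def)
      have "s * (s * (h *\<^sub>v v) $ i) = (h *\<^sub>v v) $ i" using s by (simp flip: mult.assoc)
      then show "(h *\<^sub>v v + s \<cdot>\<^sub>v v) $ i = (s \<cdot>\<^sub>v pr s v) $ i"
        using i vc carrier_vecD[OF hvc] by (simp add: pr_def algebra_simps del: index_mult_mat_vec)
    qed (use vc h in \<open>simp add: pr_def\<close>)
    finally show ?thesis .
  qed
  have expand: "form (pr s y) (T (pr s x))
      = form y (T x) + s * form y (T (h *\<^sub>v x)) + (s ^ q * form (h *\<^sub>v y) (T x) + s ^ q * (s * form y (T x)))" for s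
  proof -
    note c = Nc[OF y] Nc[OF hN[OF y]] T[OF x] T[OF hN[OF x]]
    have "T (pr s x) = T x + s \<cdot>\<^sub>v T (h *\<^sub>v x)"
      unfolding pr_def using T_add[OF x N_smult[OF hN[OF x]]] T_smult[OF hN[OF x]] by simp
    then show ?thesis
      unfolding pr_def using c T_h[OF y x] by (simp add: form_add_left form_add_right form_smult_left form_smult_right distrib_left)
  qed
  \<comment> \<open>The terms of \<open>expand\<close> that are odd in \<open>s\<close> cancel, so
    one sign \<open>s\<close> serves both projected vectors.\<close>
  have "form (pr 1 y) (T (pr 1 x)) + form (pr (-1) y) (T (pr (-1) x)) = 2 * (2 * form y (T x))"
    unfolding expand minus_one_power_q by simp
  then have "form (pr 1 y) (T (pr 1 x)) \<noteq> 0 \<or> form (pr (-1) y) (T (pr (-1) x)) \<noteq> 0"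
    using two xy by (metis add_0 mult_eq_0_iff)
  then obtain s :: 'a where s: "s = 1 \<or> s = -1" and nz: "form (pr s y) (T (pr s x)) \<noteq> 0" by blast
  then have ss: "s * s = 1" by auto
  define v where "v = pr s x"
  define w where "w = pr s y"
  define b where "b = form w (T v)"
  have v: "v \<in> N" "h *\<^sub>v v = s \<cdot>\<^sub>v v" and w: "w \<in> N" "h *\<^sub>v w = s \<cdot>\<^sub>v w"
    unfolding v_def w_def using prN prh x y ss by auto
  have b: "b \<noteq> 0" using nz by (simp add: b_def v_def w_def)
  \<comment> \<open>The scaling makes both cross terms of \<open>form z (T z)\<close> equal to
    \<open>1\<close>. Their sum \<open>2\<close> is nonzero, so the form cannot vanish at
    \<open>v\<close>, \<open>w\<close> and \<open>z\<close> at once.\<close>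
  define z where "z = w + inverse b \<cdot>\<^sub>v v"
  have z: "z \<in> N" unfolding z_def using N_add N_smult v w by blast
  have hz: "h *\<^sub>v z = s \<cdot>\<^sub>v z"
  proof -
    note vc = Nc[OF v(1)] and wc = Nc[OF w(1)]
    have "h *\<^sub>v z = s \<cdot>\<^sub>v w + inverse b \<cdot>\<^sub>v (s \<cdot>\<^sub>v v)"
      unfolding z_def mult_add_distrib_mat_vec[OF h wc smult_carrier_vec[THEN iffD2, OF vc]] mult_mat_vec[OF h vc] v(2) w(2) ..
    also have "\<dots> = s \<cdot>\<^sub>v z" unfolding z_def using vc wc by (intro eq_vecI) (auto simp: algebra_simps)
    finally show ?thesis .
  qed
  note c = Nc[OF v(1)] Nc[OF w(1)] T[OF v(1)] T[OF w(1)]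
  have "T z = T w + inverse b \<cdot>\<^sub>v T v" unfolding z_def using T_add[OF w(1) N_smult[OF v(1)]] T_smult[OF v(1)] by simp
  then have "form z (T z) = form w (T w) + inverse b * b + (inverse b ^ q * form v (T w) + inverse b ^ q * (inverse b * form v (T v)))"
    unfolding z_def b_def using c by (simp add: form_add_left form_add_right form_smult_left form_smult_right distrib_left)
  also have "form v (T w) = b ^ q" unfolding b_def by (rule T_herm[OF w(1) v(1)])
  also have "inverse b ^ q * b ^ q = 1" using b by (simp flip: power_mult_distrib)
  finally have "form z (T z) = form w (T w) + 2 + inverse b ^ q * (inverse b * form v (T v))" using b by simp
  then consider "form z (T z) \<noteq> 0" | "form w (T w) \<noteq> 0" | "form v (T v) \<noteq> 0" using two by fastforce
  then show ?thesis using that z hz v w s by cases blast+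
qed

text \<open>The new involution is \<open>h' = h R\<close> with \<open>R = 1 - 2 E\<close>, where
  \<open>E\<close> is the orthogonal projection onto the span of the \<open>T j z\<close>.
  \<open>R\<close> is a unitary involution commuting with \<open>g\<close> and \<open>h\<close>. The
  second part of \<open>e\<close> says that conjugation fixes \<open>- \<epsilon>\<close>, so that
  the adjoint of \<open>g - \<epsilon>\<close> is \<open>gi - \<epsilon>\<close>.\<close>

lemma reversing_involution_flip_det:
  assumes two: "(2 :: 'a) \<noteq> 0" and g: "unitary g" and gi: "gi \<in> carrier_mat n n"
    and ggi: "g * gi = 1\<^sub>m n" "gi * g = 1\<^sub>m n"
    and h: "unitary h" and hh: "h * h = 1\<^sub>m n" and hg: "h * g = gi * h"
    and e: "\<epsilon> * \<epsilon> = 1" "(- \<epsilon>) ^ q = - \<epsilon>" and k: "odd k" and wit: "jordan_block_witness g \<epsilon> k"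
  obtains h' where "unitary h'" "h' * h' = 1\<^sub>m n" "h' * g = gi * h'" "det h' = - det h"
proof -
  have gc: "g \<in> carrier_mat n n" and hc: "h \<in> carrier_mat n n" using g h by (auto simp: unitary_def)
  note V = mult_mat_vec_carrier[OF gc] mult_mat_vec_carrier[OF gi] mult_mat_vec_carrier[OF hc]
  have gg: "g *\<^sub>v (gi *\<^sub>v x) = x" "gi *\<^sub>v (g *\<^sub>v x) = x" "h *\<^sub>v (h *\<^sub>v x) = x" if x: "x \<in> carrier_vec n" for x
    unfolding assoc_mult_mat_vec[OF gc gi x, symmetric] assoc_mult_mat_vec[OF gi gc x, symmetric]
      assoc_mult_mat_vec[OF hc hc x, symmetric] ggi hh using x by simp_all
  have hgv: "h *\<^sub>v (g *\<^sub>v x) = gi *\<^sub>v (h *\<^sub>v x)" if x: "x \<in> carrier_vec n" for x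
    unfolding assoc_mult_mat_vec[OF gi hc x, symmetric] assoc_mult_mat_vec[OF hc gc x, symmetric] hg ..
  have gh: "g * h = h * gi"
  proof (rule mat_eq_by_vec)
    fix x :: "'a vec" assume x: "x \<in> carrier_vec n"
    have "h *\<^sub>v (gi *\<^sub>v x) = h *\<^sub>v (gi *\<^sub>v (h *\<^sub>v (h *\<^sub>v x)))" using gg(3)[OF x] by simp
    also have "\<dots> = g *\<^sub>v (h *\<^sub>v x)" unfolding hgv[OF V(3)[OF x], symmetric] by (rule gg(3)[OF V(1)[OF V(3)[OF x]]])
    finally show "(g * h) *\<^sub>v x = (h * gi) *\<^sub>v x"
      unfolding assoc_mult_mat_vec[OF gc hc x] assoc_mult_mat_vec[OF hc gi x] ..
  qed (use gc hc gi in auto)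
  have fg: "form (g *\<^sub>v x) (g *\<^sub>v y) = form x y" and fh: "form (h *\<^sub>v x) (h *\<^sub>v y) = form x y"
    if "x \<in> carrier_vec n" "y \<in> carrier_vec n" for x y
    using g h that unfolding unitary_iff_form[OF gc] unitary_iff_form[OF hc] by auto
  have form_g: "form (gi *\<^sub>v x) y = form x (g *\<^sub>v y)" if "x \<in> carrier_vec n" "y \<in> carrier_vec n" for x y
    using fg[OF V(2)[OF that(1)] that(2)] gg(1)[OF that(1)] by simp
  have form_gi: "form (g *\<^sub>v x) y = form x (gi *\<^sub>v y)" if "x \<in> carrier_vec n" "y \<in> carrier_vec n" for x y
    using fg[OF that(1) V(2)[OF that(2)]] gg(1)[OF that(2)] by simp
  have form_h: "form (h *\<^sub>v x) y = form x (h *\<^sub>v y)" if "x \<in> carrier_vec n" "y \<in> carrier_vec n" for x y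
    using fh[OF that(1) V(3)[OF that(2)]] gg(3)[OF that(2)] by simp

  \<comment> \<open>Powers of \<open>g - \<epsilon>\<close>, of its adjoint
    \<open>gi - \<epsilon>\<close>, and of \<open>gi\<close>. Conjugation by \<open>h\<close>
    exchanges the first two.\<close>
  define T where "T j = poly_act g ([:- \<epsilon>, 1:] ^ j)" for j
  define S where "S j = poly_act gi ([:- \<epsilon>, 1:] ^ j)" for j
  define G where "G j = poly_act gi ([:0, 1:] ^ j)" for j
  have Tc: "T j x \<in> carrier_vec n" and Sc: "S j x \<in> carrier_vec n" and Gc: "G j x \<in> carrier_vec n"
    if "x \<in> carrier_vec n" for j x
    unfolding T_def S_def G_def using that poly_act_closed[OF gc] poly_act_closed[OF gi] by auto
  have T_zero: "T j (0\<^sub>v n) = 0\<^sub>v n" and S_zero: "S j (0\<^sub>v n) = 0\<^sub>v n" and G_zero: "G j (0\<^sub>v n) = 0\<^sub>v n" for j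
    unfolding T_def S_def G_def using poly_act_zero_vec[OF gc] poly_act_zero_vec[OF gi] by auto
  have T_add: "T (i + j) x = T i (T j x)" and S_add: "S (i + j) x = S i (S j x)" if "x \<in> carrier_vec n" for i j x
    unfolding T_def S_def power_add poly_act_mult[OF gc that] poly_act_mult[OF gi that] by auto
  have T_1: "T 1 x = (- \<epsilon>) \<cdot>\<^sub>v x + g *\<^sub>v x" and S_1: "S 1 x = (- \<epsilon>) \<cdot>\<^sub>v x + gi *\<^sub>v x" if "x \<in> carrier_vec n" for x
    unfolding T_def S_def power_one_right poly_act_linear[OF gc that] poly_act_linear[OF gi that] by auto
  have T_0: "T 0 x = x" and S_0: "S 0 x = x" and G_0: "G 0 x = x" if "x \<in> carrier_vec n" for x
    unfolding T_def S_def G_def power_0 using poly_act_1[OF gc that] poly_act_1[OF gi that] by auto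
  have X: "poly_act gi [:0, 1:] x = gi *\<^sub>v x" if x: "x \<in> carrier_vec n" for x
    using poly_act_linear[OF gi x, of 0] zero_smult_vec[OF gi x] V(2)[OF x] by simp
  have G_Suc: "G (Suc j) x = gi *\<^sub>v G j x" if "x \<in> carrier_vec n" for j x
    unfolding G_def power_Suc poly_act_mult[OF gi that] by (rule X[OF poly_act_closed[OF gi that]])
  have S_gi: "S j (gi *\<^sub>v x) = gi *\<^sub>v S j x" if x: "x \<in> carrier_vec n" for j x
    unfolding S_def X[OF x, symmetric] X[OF poly_act_closed[OF gi x], symmetric] by (rule poly_act_commute[OF gi x])
  have S_smult: "S j (c \<cdot>\<^sub>v x) = c \<cdot>\<^sub>v S j x" and T_smult: "T j (c \<cdot>\<^sub>v x) = c \<cdot>\<^sub>v T j x"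
    and G_smult: "G j (c \<cdot>\<^sub>v x) = c \<cdot>\<^sub>v G j x" if "x \<in> carrier_vec n" for j c x
    unfolding S_def T_def G_def using poly_act_smult_vec[OF gi that] poly_act_smult_vec[OF gc that] by auto
  have T_plus: "T j (x + y) = T j x + T j y" if "x \<in> carrier_vec n" "y \<in> carrier_vec n" for j x y
    unfolding T_def by (rule poly_act_add_vec[OF gc that])
  have hT: "h *\<^sub>v T j x = S j (h *\<^sub>v x)" and hS: "h *\<^sub>v S j x = T j (h *\<^sub>v x)" if x: "x \<in> carrier_vec n" for j x
    unfolding T_def S_def using poly_act_similar[OF gi gi hc gc hg[symmetric] x] poly_act_similar[OF gc gc hc gi gh x] by auto
  have adj: "form (S j x) y = form x (T j y)" if "x \<in> carrier_vec n" "y \<in> carrier_vec n" for j x y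
    using that
  proof (induction j arbitrary: y)
    case 0
    then show ?case by (simp add: T_0 S_0)
  next
    case (Suc j)
    have u: "S j x \<in> carrier_vec n" using Suc.prems Sc by blast
    have "form (S 1 (S j x)) y = (- \<epsilon>) ^ q * form (S j x) y + form (gi *\<^sub>v S j x) y"
      unfolding S_1[OF u] using u V(2)[OF u] Suc.prems(2) by (simp add: form_add_left form_smult_left)
    also have "\<dots> = form (S j x) (T 1 y)"
      unfolding T_1[OF Suc.prems(2)] e(2) form_g[OF u Suc.prems(2)]
      using u V(1)[OF Suc.prems(2)] Suc.prems(2) by (simp add: form_add_right form_smult_right)
    also have "\<dots> = form x (T j (T 1 y))" by (rule Suc.IH[OF Suc.prems(1) Tc[OF Suc.prems(2)]])
    finally show ?case using S_add[OF Suc.prems(1), of 1 j] T_add[OF Suc.prems(2), of j 1] by simp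
  qed
  have adj': "form (T j x) y = form x (S j y)" if "x \<in> carrier_vec n" "y \<in> carrier_vec n" for j x y
    using adj[OF that(2,1), of j] form_commute[OF that(2) Tc[OF that(1)], of j] form_commute[OF Sc[OF that(2)] that(1), of j] by simp
  \<comment> \<open>Since \<open>\<epsilon>^2 = 1\<close>,
    \<open>gi - \<epsilon> = - \<epsilon> gi (g - \<epsilon>)\<close>: the adjoint differs from
    \<open>g - \<epsilon>\<close> by an invertible factor and has the same kernels.\<close>
  have ST: "S i y = (- \<epsilon>) ^ i \<cdot>\<^sub>v G i (T i y)" if "y \<in> carrier_vec n" for i y
    using that
  proof (induction i arbitrary: y)
    case 0
    then show ?case by (simp add: T_0 S_0 G_0)
  next
    case (Suc i)
    note y = Suc.prems
    define w where "w = T 1 y"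
    have w: "w \<in> carrier_vec n" unfolding w_def by (rule Tc[OF y])
    have "gi *\<^sub>v w = (- \<epsilon>) \<cdot>\<^sub>v (gi *\<^sub>v y) + y"
      unfolding w_def T_1[OF y] using mult_add_distrib_mat_vec[OF gi, of "(- \<epsilon>) \<cdot>\<^sub>v y" "g *\<^sub>v y"]
        mult_mat_vec[OF gi y] gg(2)[OF y] y V(1)[OF y] by simp
    then have "(- \<epsilon>) \<cdot>\<^sub>v (gi *\<^sub>v w) = (\<epsilon> * \<epsilon>) \<cdot>\<^sub>v (gi *\<^sub>v y) + (- \<epsilon>) \<cdot>\<^sub>v y"
      using smult_add_distrib_vec[of "(- \<epsilon>) \<cdot>\<^sub>v (gi *\<^sub>v y)" n y "- \<epsilon>"] V(2)[OF y] y by (simp add: smult_smult_assoc)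
    also have "\<dots> = S 1 y" unfolding S_1[OF y] e(1) using y V(2)[OF y] by (simp add: comm_add_vec[of _ n])
    finally have S1: "S 1 y = (- \<epsilon>) \<cdot>\<^sub>v (gi *\<^sub>v w)" ..
    note Tw = Tc[OF w, of i]
    have "S (Suc i) y = S i (S 1 y)" using S_add[OF y, of i 1] by simp
    also have "\<dots> = (- \<epsilon>) \<cdot>\<^sub>v (gi *\<^sub>v S i w)" unfolding S1 S_smult[OF V(2)[OF w]] S_gi[OF w] ..
    also have "gi *\<^sub>v S i w = (- \<epsilon>) ^ i \<cdot>\<^sub>v (gi *\<^sub>v G i (T i w))"
      unfolding Suc.IH[OF w] by (rule mult_mat_vec[OF gi Gc[OF Tw]])
    also have "gi *\<^sub>v G i (T i w) = G (Suc i) (T (Suc i) y)"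
      using G_Suc[OF Tw, of i] T_add[OF y, of i 1] by (simp add: w_def)
    finally show ?case by (simp add: smult_smult_assoc)
  qed
  have G_inj: "x = 0\<^sub>v n" if "x \<in> carrier_vec n" "G j x = 0\<^sub>v n" for j x
    using that
  proof (induction j)
    case (Suc j)
    have "G j x = g *\<^sub>v (gi *\<^sub>v G j x)" using gg(1)[OF Gc[OF Suc.prems(1)]] by simp
    then have "G j x = 0\<^sub>v n" using Suc.prems(2) unfolding G_Suc[OF Suc.prems(1)] by (simp add: mult_mat_zero_vec[OF gc])
    then show ?case using Suc by blast
  qed (simp add: G_0)
  have smult_0: "v = 0\<^sub>v n" if "v \<in> carrier_vec n" "c \<cdot>\<^sub>v v = 0\<^sub>v n" "c \<noteq> 0" for v and c :: 'a
  proof (rule eq_vecI)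
    fix i assume "i < dim_vec (0\<^sub>v n :: 'a vec)"
    then have i: "i < n" by simp
    then have "(c \<cdot>\<^sub>v v) $ i = 0" using that(2) by simp
    then show "v $ i = 0\<^sub>v n $ i" using that(1,3) i by simp
  qed (use that in simp)
  have smult_zero: "c \<cdot>\<^sub>v 0\<^sub>v n = (0\<^sub>v n :: 'a vec)" for c by (intro eq_vecI) auto
  have e0: "\<epsilon> \<noteq> 0" using e by auto
  have ST_zero: "T j x = 0\<^sub>v n \<longleftrightarrow> S j x = 0\<^sub>v n" if x: "x \<in> carrier_vec n" for j x
  proof
    assume "S j x = 0\<^sub>v n"
    then have "G j (T j x) = 0\<^sub>v n" using smult_0[OF Gc[OF Tc[OF x]], of "(- \<epsilon>) ^ j" j j] e0 ST[OF x, of j] by simp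
    then show "T j x = 0\<^sub>v n" by (rule G_inj[OF Tc[OF x]])
  qed (simp add: ST[OF x] G_zero smult_zero)
  have G_fix: "G j w = \<epsilon> ^ j \<cdot>\<^sub>v w" if w: "w \<in> carrier_vec n" and w0: "T 1 w = 0\<^sub>v n" for j w
  proof -
    have gw: "gi *\<^sub>v w = \<epsilon> \<cdot>\<^sub>v w"
    proof (rule eq_vecI)
      fix i assume "i < dim_vec (\<epsilon> \<cdot>\<^sub>v w)"
      then have i: "i < n" using w by simp
      have "S 1 w = 0\<^sub>v n" using ST_zero[OF w] w0 by simp
      then have "((- \<epsilon>) \<cdot>\<^sub>v w + gi *\<^sub>v w) $ i = 0" unfolding S_1[OF w] using i by simp
      then show "(gi *\<^sub>v w) $ i = (\<epsilon> \<cdot>\<^sub>v w) $ i"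
        using i w carrier_vecD[OF V(2)[OF w]] by (simp del: index_mult_mat_vec)
    qed (use w gi in simp)
    show ?thesis
    proof (induction j)
      case 0
      show ?case using w by (simp add: G_0)
    next
      case (Suc j)
      show ?case unfolding G_Suc[OF w] Suc mult_mat_vec[OF gi w] gw by (simp add: smult_smult_assoc mult.commute)
    qed
  qed
  \<comment> \<open>This governs the antidiagonal of the Gram matrix. \<open>T (k - 1) x\<close>
    lies in the kernel of \<open>g - \<epsilon>\<close>, where \<open>gi\<close> is the scalar
    \<open>\<epsilon>\<close>, so only a sign remains.\<close>
  have top: "S i (T j x) = (-1) ^ i \<cdot>\<^sub>v T (k - 1) x"
    if x: "x \<in> carrier_vec n" and xk: "T k x = 0\<^sub>v n" and ij: "Suc (i + j) = k" for i j x
  proof -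
    have k1: "k - 1 = i + j" "k = 1 + (i + j)" using ij by auto
    have t: "T (i + j) x \<in> carrier_vec n" by (rule Tc[OF x])
    have t0: "T 1 (T (i + j) x) = 0\<^sub>v n" using xk T_add[OF x, of 1 "i + j"] k1(2) by simp
    have "S i (T j x) = (- \<epsilon>) ^ i \<cdot>\<^sub>v (\<epsilon> ^ i \<cdot>\<^sub>v T (i + j) x)"
      unfolding ST[OF Tc[OF x]] T_add[OF x, symmetric] G_fix[OF t t0] ..
    also have "\<dots> = ((- \<epsilon>) ^ i * \<epsilon> ^ i) \<cdot>\<^sub>v T (i + j) x" by (simp add: smult_smult_assoc)
    also have "(- \<epsilon>) ^ i * \<epsilon> ^ i = (-1) ^ i" using e(1) by (simp flip: power_mult_distrib)
    finally show ?thesis unfolding k1(1) .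
  qed
  have beyond: "S i (T j x) = 0\<^sub>v n" if x: "x \<in> carrier_vec n" and xk: "T k x = 0\<^sub>v n" and ij: "k \<le> i + j" for i j x
  proof -
    have "i + j = (i + j - k) + k" using ij by simp
    then have "T (i + j) x = T (i + j - k) (T k x)" using T_add[OF x] by metis
    then show ?thesis unfolding ST[OF Tc[OF x]] T_add[OF x, symmetric] xk by (simp add: T_zero G_zero smult_zero)
  qed

  define N where "N = {x \<in> carrier_vec n. T k x = 0\<^sub>v n}"
  have k0: "Suc (k - 1 + 0) = k" using k by (cases k) auto
  have evk: "even (k - 1)" using k by simp
  \<comment> \<open>For odd \<open>k\<close> the sign in \<open>top\<close> is \<open>1\<close>: on
    \<open>N\<close> the operator \<open>T (k - 1)\<close> agrees with its adjoint and so defines a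
    Hermitian form.\<close>
  have S_eq_T: "S (k - 1) x = T (k - 1) x" if "x \<in> N" for x
    using top[of x "k - 1" 0] that k0 evk by (simp add: N_def T_0)
  obtain x0 r where x0: "x0 \<in> carrier_vec n" and r: "r \<in> carrier_vec n" and w: "T k x0 = 0\<^sub>v n"
    "\<And>z. z \<in> carrier_vec n \<Longrightarrow> r \<bullet> T k z = 0" "r \<bullet> T (k - 1) x0 \<noteq> 0"
    using jordan_block_witnessE[OF wit gc] unfolding T_def by metis
  obtain y0 where y0: "y0 \<in> carrier_vec n" and fy0: "\<And>z. z \<in> carrier_vec n \<Longrightarrow> form y0 z = r \<bullet> z"
    using form_represents[OF r] by metis
  \<comment> \<open>\<open>r\<close> vanishes on the image of \<open>T k\<close>, so the vector
    representing it is killed by the adjoint \<open>S k\<close>. Hence \<open>y0\<close> lies in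
    \<open>N\<close>, like \<open>x0\<close>, and the two pair nontrivially.\<close>
  have "S k y0 = 0\<^sub>v n"
  proof (rule form_nondegenerate[OF Sc[OF y0] zero_carrier_vec])
    fix x :: "'a vec" assume x: "x \<in> carrier_vec n"
    have "form (S k y0) x = 0" unfolding adj[OF y0 x] fy0[OF Tc[OF x]] by (rule w(2)[OF x])
    then show "form x (S k y0) = form x (0\<^sub>v n)"
      using form_commute[OF Sc[OF y0] x] x q_pos by (simp add: power_0_left)
  qed
  then have y0N: "y0 \<in> N" using ST_zero[OF y0] y0 by (simp add: N_def)
  have x0N: "x0 \<in> N" using x0 w(1) by (simp add: N_def)
  obtain z s where zN: "z \<in> N" and s: "s = 1 \<or> s = -1" and hz: "h *\<^sub>v z = s \<cdot>\<^sub>v z" and fz: "form z (T (k - 1) z) \<noteq> 0"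
  proof (rule isotypic_vector[of N "T (k - 1)" h x0 y0])
    show "form y0 (T (k - 1) x0) \<noteq> 0" using w(3) fy0[OF Tc[OF x0]] by simp
    show "form w (T (k - 1) v) = form v (T (k - 1) w) ^ q" if "v \<in> N" "w \<in> N" for v w
    proof -
      have v: "v \<in> carrier_vec n" and w: "w \<in> carrier_vec n" using that by (auto simp: N_def)
      show ?thesis
        unfolding adj[OF w v, symmetric] S_eq_T[OF that(2)] by (rule form_commute[OF v Tc[OF w]])
    qed
    show "form (h *\<^sub>v v) (T (k - 1) (h *\<^sub>v w)) = form v (T (k - 1) w)" if "v \<in> N" "w \<in> N" for v w
    proof -
      have v: "v \<in> carrier_vec n" and w: "w \<in> carrier_vec n" using that by (auto simp: N_def)
      show ?thesis
        unfolding hS[OF w, symmetric] S_eq_T[OF that(2)] by (rule fh[OF v Tc[OF w]])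
    qed
    show "h *\<^sub>v v \<in> N" if "v \<in> N" for v
    proof -
      have v: "v \<in> carrier_vec n" "T k v = 0\<^sub>v n" using that by (auto simp: N_def)
      have "T k (h *\<^sub>v v) = h *\<^sub>v S k v" using hS[OF v(1)] by simp
      also have "S k v = 0\<^sub>v n" using ST_zero[OF v(1)] v(2) by simp
      finally show ?thesis using V(3)[OF v(1)] by (simp add: N_def mult_mat_zero_vec[OF hc])
    qed
    show "v + w \<in> N" if "v \<in> N" "w \<in> N" for v w using that by (simp add: N_def T_plus)
    show "c \<cdot>\<^sub>v v \<in> N" if "v \<in> N" for v c using that by (auto simp: N_def T_smult)
  qed (use two hc hh x0N y0N T_plus T_smult Tc in \<open>auto simp: N_def\<close>)
  have z: "z \<in> carrier_vec n" and Tkz: "T k z = 0\<^sub>v n" using zN by (auto simp: N_def)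

  define B where "B = mat n k (\<lambda>(i, j). T j z $ i)"
  have B: "B \<in> carrier_mat n k" by (simp add: B_def)
  have colB: "col B j = T j z" if "j < k" for j
    using that carrier_vecD[OF Tc[OF z]] by (intro eq_vecI) (auto simp: B_def)
  \<comment> \<open>\<open>C * B\<close> is the Gram matrix of the columns \<open>T j z\<close>:
    zero for \<open>k \<le> i + j\<close> by \<open>beyond\<close>, and up to sign
    \<open>form z (T (k - 1) z)\<close> on the antidiagonal by \<open>top\<close>.\<close>
  define C where "C = star B * \<eta>"
  have SB: "star B \<in> carrier_mat k n" using B by simp
  have C: "C \<in> carrier_mat k n" unfolding C_def using SB eta by simp
  have CB: "C * B \<in> carrier_mat k k" using C B by simp
  have CBe: "C * B = star B * (\<eta> * B)" unfolding C_def by (rule assoc_mult_mat[OF SB eta B])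
  have CBij: "(C * B) $$ (i, j) = form z (S i (T j z))" if "i < k" "j < k" for i j
    unfolding CBe form_cols[OF B that] colB[OF that(1)] colB[OF that(2)] by (rule adj'[OF z Tc[OF z]])
  obtain H where H: "H \<in> carrier_mat k k" and CBH: "C * B * H = 1\<^sub>m k" and HCB: "H * (C * B) = 1\<^sub>m k"
  proof (rule antitriangular_inverse[OF CB])
    fix i j assume ij: "i < k" "j < k"
    show "(C * B) $$ (i, j) = 0" if "k \<le> i + j"
      unfolding CBij[OF ij] beyond[OF z Tkz that] using z by simp
    show "(C * B) $$ (i, j) \<noteq> 0" if "Suc (i + j) = k"
      unfolding CBij[OF ij] top[OF z Tkz that] using form_smult_right[OF z Tc[OF z]] fz by simp
  qed
  have star_CB: "star (C * B) = C * B"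
  proof -
    have eB: "\<eta> * B \<in> carrier_mat n k" using eta B by simp
    have "star (C * B) = star B * star \<eta> * star (star B)"
      unfolding CBe star_mult[OF SB eB] star_mult[OF eta B] ..
    also have "\<dots> = C * B" unfolding star_star star_eta C_def ..
    finally show ?thesis .
  qed
  have star_H: "star H = H"
  proof -
    have Hs: "star H \<in> carrier_mat k k" using H by simp
    have "star H * (C * B) = star (C * B * H)" unfolding star_mult[OF CB H] star_CB ..
    then have "star H * (C * B) = 1\<^sub>m k" unfolding CBH star_one .
    then have "H = star H * (C * B) * H" using H by simp
    also have "\<dots> = star H" unfolding assoc_mult_mat[OF Hs CB H] CBH by (rule right_mult_one_mat[OF Hs])
    finally show ?thesis ..
  qed
  \<comment> \<open>\<open>E\<close> is the orthogonal projection onto the span of the vectors \<open>T j z\<close>.\<close>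
  define E where "E = B * (H * C)"
  have HC: "H * C \<in> carrier_mat k n" using H C by simp
  have E: "E \<in> carrier_mat n n" unfolding E_def using B HC by simp
  have HCB': "H * C * B = 1\<^sub>m k" unfolding assoc_mult_mat[OF H C B] by (rule HCB)
  have EB: "E * B = B" unfolding E_def assoc_mult_mat[OF B HC B] HCB' by (rule right_mult_one_mat[OF B])
  note VE = mult_mat_vec_carrier[OF E]
  have Ev: "E *\<^sub>v v = B *\<^sub>v ((H * C) *\<^sub>v v)" if "v \<in> carrier_vec n" for v
    unfolding E_def by (rule assoc_mult_mat_vec[OF B HC that])
  have EE: "E *\<^sub>v (E *\<^sub>v v) = E *\<^sub>v v" if v: "v \<in> carrier_vec n" for v
  proof -
    have "(H * C) *\<^sub>v v \<in> carrier_vec k" using HC v by simp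
    then show ?thesis unfolding Ev[OF v] using assoc_mult_mat_vec[OF E B] EB by metis
  qed
  define F where "F = {v \<in> carrier_vec n. E *\<^sub>v v = v}"
  have F_smult: "c \<cdot>\<^sub>v v \<in> F" if "v \<in> F" for c v
    using that mult_mat_vec[OF E, of v c] by (simp add: F_def)
  have F_add: "v + w \<in> F" if "v \<in> F" "w \<in> F" for v w
    using that mult_add_distrib_mat_vec[OF E, of v w] by (simp add: F_def)
  have TF: "T j z \<in> F" for j
  proof (cases "j < k")
    case True
    have "E *\<^sub>v T j z = col (E * B) j" unfolding colB[OF True, symmetric] using col_mult2[OF E B True] by simp
    then show ?thesis using Tc[OF z] by (simp add: F_def EB colB[OF True])
  next
    case False
    then have "j = (j - k) + k" by simp
    then have "T j z = T (j - k) (T k z)" using T_add[OF z] by metis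
    then show ?thesis unfolding Tkz T_zero by (simp add: F_def mult_mat_zero_vec[OF E])
  qed
  \<comment> \<open>\<open>F\<close> is the span of the columns of \<open>B\<close>, so stability
    need only be checked on the vectors \<open>T j z\<close>.\<close>
  have stable: "M *\<^sub>v v \<in> F" if M: "M \<in> carrier_mat n n" and cols: "\<And>j. M *\<^sub>v T j z \<in> F" and v: "v \<in> F" for M v
  proof -
    have vc: "v \<in> carrier_vec n" and vE: "E *\<^sub>v v = v" using v by (auto simp: F_def)
    define y where "y = (H * C) *\<^sub>v v"
    have y: "y \<in> carrier_vec k" unfolding y_def using HC vc by simp
    have vy: "v = B *\<^sub>v y" using Ev[OF vc] vE by (simp add: y_def)
    have MB: "M * B \<in> carrier_mat n k" using M B by simp
    have "E * (M * B) = M * B"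
    proof (rule mat_col_eqI)
      fix j assume "j < dim_col (M * B)"
      then have j: "j < k" using B by simp
      have "col (E * (M * B)) j = E *\<^sub>v (M *\<^sub>v T j z)"
        unfolding col_mult2[OF E MB j] col_mult2[OF M B j] colB[OF j] ..
      also have "\<dots> = M *\<^sub>v T j z" using cols[of j] by (simp add: F_def)
      finally show "col (E * (M * B)) j = col (M * B) j" unfolding col_mult2[OF M B j] colB[OF j] .
    qed (use E MB in auto)
    then have "E *\<^sub>v (M *\<^sub>v v) = M *\<^sub>v v"
      unfolding vy assoc_mult_mat_vec[OF M B y, symmetric] assoc_mult_mat_vec[OF E MB y, symmetric] by simp
    then show ?thesis using M vc by (simp add: F_def)
  qed
  have gT: "g *\<^sub>v T j z \<in> F" for j
  proof -
    note t = Tc[OF z, of j]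
    have "g *\<^sub>v T j z = T (1 + j) z + \<epsilon> \<cdot>\<^sub>v T j z"
      unfolding T_add[OF z] T_1[OF t] using t gc by (intro eq_vecI) (simp_all del: index_mult_mat_vec)
    then show ?thesis using F_add[OF TF F_smult[OF TF]] by simp
  qed
  have gF: "g *\<^sub>v v \<in> F" if "v \<in> F" for v by (rule stable[OF gc gT that])
  \<comment> \<open>By finiteness \<open>g\<close> maps \<open>F\<close> onto itself, so its inverse
    preserves \<open>F\<close>.\<close>
  have giF: "gi *\<^sub>v v \<in> F" if v: "v \<in> F" for v
  proof -
    have Fc: "F \<subseteq> carrier_vec n" by (auto simp: F_def)
    have "inj_on (\<lambda>v. g *\<^sub>v v) F" by (rule inj_on_inverseI[of _ "\<lambda>v. gi *\<^sub>v v"]) (use gg(2) Fc in blast)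
    moreover have "finite F" using Fc finite_subset finite_carrier_vec by blast
    ultimately have "(\<lambda>v. g *\<^sub>v v) ` F = F" using gF by (intro endo_inj_surj) auto
    then obtain w where "w \<in> F" "v = g *\<^sub>v w" using v by blast
    then show ?thesis using gg(2)[of w] Fc by auto
  qed
  \<comment> \<open>Here the eigenvector property of \<open>z\<close> is used: \<open>h\<close>
    sends \<open>T j z\<close> to \<open>S j (h z) = s S j z\<close>, and \<open>S j z\<close> is
    obtained from \<open>T j z\<close> by powers of \<open>gi\<close>.\<close>
  have hT': "h *\<^sub>v T j z \<in> F" for j
  proof -
    have GF: "G i v \<in> F" if "v \<in> F" for i v
    proof (induction i)
      case 0
      show ?case using that by (simp add: F_def G_0)
    next
      case (Suc i)
      have "v \<in> carrier_vec n" using that by (simp add: F_def)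
      then show ?case using giF[OF Suc] by (simp add: G_Suc)
    qed
    then have "S j z \<in> F" unfolding ST[OF z] by (intro F_smult GF TF)
    then show ?thesis unfolding hT[OF z] hz S_smult[OF z] by (rule F_smult)
  qed
  have hF: "h *\<^sub>v v \<in> F" if "v \<in> F" for v by (rule stable[OF hc hT' that])
  have EF: "E *\<^sub>v v \<in> F" if "v \<in> carrier_vec n" for v using EE[OF that] VE[OF that] by (simp add: F_def)
  have star_E: "star E * \<eta> = \<eta> * E"
  proof -
    have BH: "B * H \<in> carrier_mat n k" using B H by simp
    have eB: "\<eta> * B \<in> carrier_mat n k" using eta B by simp
    have "star C = \<eta> * B" unfolding C_def star_mult[OF SB eta] star_eta star_star ..
    then have "star E = \<eta> * B * H * star B"
      unfolding E_def star_mult[OF B HC] star_mult[OF H C] star_H by simp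
    then have "star E * \<eta> = \<eta> * B * H * star B * \<eta>" by simp
    also have "\<dots> = \<eta> * B * H * C"
      unfolding C_def by (rule assoc_mult_mat[OF _ SB eta, of _ n]) (use eB H in simp)
    also have "\<dots> = \<eta> * B * (H * C)" by (rule assoc_mult_mat[OF eB H C])
    also have "\<dots> = \<eta> * E" unfolding E_def by (rule assoc_mult_mat[OF eta B HC])
    finally show ?thesis .
  qed
  have form_E: "form (E *\<^sub>v x) y = form x (E *\<^sub>v y)" if x: "x \<in> carrier_vec n" and y: "y \<in> carrier_vec n" for x y
  proof -
    have Es: "star E \<in> carrier_mat n n" using E by simp
    have "form (E *\<^sub>v x) y = (transpose_mat (star E) *\<^sub>v conj_vec x) \<bullet> (\<eta> *\<^sub>v y)"
      unfolding form_def conj_vec_def frob.mult_mat_vec_hom[OF E x] star_def transpose_transpose frob_mat_def ..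
    also have "\<dots> = conj_vec x \<bullet> (star E *\<^sub>v (\<eta> *\<^sub>v y))"
      by (rule transpose_vec_mult_scalar[OF Es]) (use x y in simp_all)
    also have "star E *\<^sub>v (\<eta> *\<^sub>v y) = \<eta> *\<^sub>v (E *\<^sub>v y)"
      unfolding assoc_mult_mat_vec[OF Es eta y, symmetric] assoc_mult_mat_vec[OF eta E y, symmetric] star_E ..
    finally show ?thesis by (simp add: form_def)
  qed
  \<comment> \<open>A self-adjoint projection commutes with \<open>M\<close> as soon as
    \<open>M\<close> and its adjoint \<open>M'\<close> both preserve the range; for \<open>g\<close>
    the adjoint is \<open>gi\<close>, for \<open>h\<close> it is \<open>h\<close>.\<close>
  have E_comm: "E *\<^sub>v (M *\<^sub>v v) = M *\<^sub>v (E *\<^sub>v v)"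
    if M: "M \<in> carrier_mat n n" and M': "M' \<in> carrier_mat n n"
      and f: "\<And>x y. x \<in> carrier_vec n \<Longrightarrow> y \<in> carrier_vec n \<Longrightarrow> form (M' *\<^sub>v x) y = form x (M *\<^sub>v y)"
      and MF: "\<And>v. v \<in> F \<Longrightarrow> M *\<^sub>v v \<in> F" and M'F: "\<And>v. v \<in> F \<Longrightarrow> M' *\<^sub>v v \<in> F"
      and v: "v \<in> carrier_vec n" for M M' v
  proof (rule form_nondegenerate)
    note c = mult_mat_vec_carrier[OF M] mult_mat_vec_carrier[OF M']
    show "E *\<^sub>v (M *\<^sub>v v) \<in> carrier_vec n" "M *\<^sub>v (E *\<^sub>v v) \<in> carrier_vec n" using VE c v by auto
    fix x :: "'a vec" assume x: "x \<in> carrier_vec n"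
    have "form x (E *\<^sub>v (M *\<^sub>v v)) = form (E *\<^sub>v x) (M *\<^sub>v v)" by (rule form_E[OF x c(1)[OF v], symmetric])
    also have "\<dots> = form (M' *\<^sub>v (E *\<^sub>v x)) v" by (rule f[OF VE[OF x] v, symmetric])
    also have "\<dots> = form (E *\<^sub>v (M' *\<^sub>v (E *\<^sub>v x))) v" using M'F[OF EF[OF x]] by (simp add: F_def)
    also have "\<dots> = form (M' *\<^sub>v (E *\<^sub>v x)) (E *\<^sub>v v)" by (rule form_E[OF c(2)[OF VE[OF x]] v])
    also have "\<dots> = form (E *\<^sub>v x) (M *\<^sub>v (E *\<^sub>v v))" by (rule f[OF VE[OF x] VE[OF v]])
    also have "\<dots> = form x (E *\<^sub>v (M *\<^sub>v (E *\<^sub>v v)))" by (rule form_E[OF x c(1)[OF VE[OF v]]])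
    also have "E *\<^sub>v (M *\<^sub>v (E *\<^sub>v v)) = M *\<^sub>v (E *\<^sub>v v)" using MF[OF EF[OF v]] by (simp add: F_def)
    finally show "form x (E *\<^sub>v (M *\<^sub>v v)) = form x (M *\<^sub>v (E *\<^sub>v v))" .
  qed
  have Eg: "E *\<^sub>v (g *\<^sub>v v) = g *\<^sub>v (E *\<^sub>v v)" if "v \<in> carrier_vec n" for v
    by (rule E_comm[OF gc gi], rule form_g, assumption, assumption, rule gF, assumption, rule giF, assumption, rule that)
  have Eh: "E *\<^sub>v (h *\<^sub>v v) = h *\<^sub>v (E *\<^sub>v v)" if "v \<in> carrier_vec n" for v
    by (rule E_comm[OF hc hc], rule form_h, assumption, assumption, rule hF, assumption, rule hF, assumption, rule that)

  \<comment> \<open>In this factored form Sylvester's identity reduces \<open>det R\<close> to the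
    determinant of \<open>1 - 2 = -1\<close> in size \<open>k\<close>, which is \<open>-1\<close> as
    \<open>k\<close> is odd.\<close>
  define R where "R = 1\<^sub>m n - B * (2 \<cdot>\<^sub>m (H * C))"
  have HC2: "2 \<cdot>\<^sub>m (H * C) \<in> carrier_mat k n" using HC by simp
  have R: "R \<in> carrier_mat n n" unfolding R_def using B HC2 by (simp add: minus_carrier_mat)
  note VR = mult_mat_vec_carrier[OF R]
  have Rv: "R *\<^sub>v v = v + (-2) \<cdot>\<^sub>v (E *\<^sub>v v)" if v: "v \<in> carrier_vec n" for v
  proof -
    have BHC: "B * (2 \<cdot>\<^sub>m (H * C)) = 2 \<cdot>\<^sub>m E" unfolding E_def by (rule mult_smult_distrib[OF B HC])
    have "R *\<^sub>v v = 1\<^sub>m n *\<^sub>v v - (2 \<cdot>\<^sub>m E) *\<^sub>v v"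
      unfolding R_def BHC by (rule minus_mult_distrib_mat_vec[of _ n n]) (use E v in simp_all)
    also have "(2 \<cdot>\<^sub>m E) *\<^sub>v v = 2 \<cdot>\<^sub>v (E *\<^sub>v v)" using E v by (intro eq_vecI) auto
    finally show ?thesis using v VE[OF v] E by (auto intro!: eq_vecI)
  qed
  have RM: "R *\<^sub>v (M *\<^sub>v v) = M *\<^sub>v (R *\<^sub>v v)"
    if M: "M \<in> carrier_mat n n" and comm: "E *\<^sub>v (M *\<^sub>v v) = M *\<^sub>v (E *\<^sub>v v)" and v: "v \<in> carrier_vec n" for M v
  proof -
    have Mv: "M *\<^sub>v v \<in> carrier_vec n" using M v by simp
    show ?thesis
      unfolding Rv[OF Mv] Rv[OF v] comm
      using mult_add_distrib_mat_vec[OF M v, of "(-2) \<cdot>\<^sub>v (E *\<^sub>v v)"] mult_mat_vec[OF M VE[OF v]] VE[OF v] by simp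
  qed
  have RR: "R *\<^sub>v (R *\<^sub>v v) = v" if v: "v \<in> carrier_vec n" for v
  proof -
    have "E *\<^sub>v (R *\<^sub>v v) = E *\<^sub>v v + (-2) \<cdot>\<^sub>v (E *\<^sub>v v)"
      unfolding Rv[OF v] using mult_add_distrib_mat_vec[OF E v, of "(-2) \<cdot>\<^sub>v (E *\<^sub>v v)"]
        mult_mat_vec[OF E VE[OF v]] EE[OF v] VE[OF v] by simp
    then have "R *\<^sub>v (R *\<^sub>v v) = (v + (-2) \<cdot>\<^sub>v (E *\<^sub>v v)) + (-2) \<cdot>\<^sub>v (E *\<^sub>v v + (-2) \<cdot>\<^sub>v (E *\<^sub>v v))"
      using Rv[OF VR[OF v]] Rv[OF v] by simp
    also have "\<dots> = v"
      using v carrier_vecD[OF VE[OF v]] by (intro eq_vecI) (simp_all add: algebra_simps del: index_mult_mat_vec)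
    finally show ?thesis .
  qed
  have form_R: "form (R *\<^sub>v x) y = form x (R *\<^sub>v y)" if x: "x \<in> carrier_vec n" and y: "y \<in> carrier_vec n" for x y
  proof -
    have "(-2 :: 'a) ^ q = -2" using power_add_q[of "-1" "-1"] by (simp add: minus_one_power_q)
    then show ?thesis
      unfolding Rv[OF x] Rv[OF y] using x y VE[OF x] VE[OF y] form_E[OF x y]
      by (simp add: form_add_left form_add_right form_smult_left form_smult_right)
  qed
  have det_R: "det R = -1"
  proof -
    have "det R = det (1\<^sub>m k - 2 \<cdot>\<^sub>m (H * C) * B)" unfolding R_def by (rule det_sylvester[OF B HC2])
    also have "2 \<cdot>\<^sub>m (H * C) * B = 2 \<cdot>\<^sub>m 1\<^sub>m k" unfolding mult_smult_assoc_mat[OF HC B] HCB' ..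
    also have "1\<^sub>m k - 2 \<cdot>\<^sub>m 1\<^sub>m k = (-1) \<cdot>\<^sub>m (1\<^sub>m k :: 'a mat)" by (rule eq_matI) auto
    finally show ?thesis using k by simp
  qed
  define h' where "h' = h * R"
  have h': "h' \<in> carrier_mat n n" unfolding h'_def using hc R by simp
  have h'v: "h' *\<^sub>v v = h *\<^sub>v (R *\<^sub>v v)" if "v \<in> carrier_vec n" for v
    unfolding h'_def by (rule assoc_mult_mat_vec[OF hc R that])
  have h'h': "h' *\<^sub>v (h' *\<^sub>v v) = v" if v: "v \<in> carrier_vec n" for v
    unfolding h'v[OF v] h'v[OF V(3)[OF VR[OF v]]] RM[OF hc Eh[OF VR[OF v]] VR[OF v]] RR[OF v] by (rule gg(3)[OF v])
  show ?thesis
  proof (rule that)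
    show "unitary h'"
      unfolding unitary_iff_form[OF h']
    proof (intro ballI)
      fix x y :: "'a vec" assume x: "x \<in> carrier_vec n" and y: "y \<in> carrier_vec n"
      show "form (h' *\<^sub>v x) (h' *\<^sub>v y) = form x y"
        unfolding h'v[OF x] h'v[OF y] fh[OF VR[OF x] VR[OF y]] form_R[OF x VR[OF y]] RR[OF y] ..
    qed
    show "h' * h' = 1\<^sub>m n"
    proof (rule mat_eq_by_vec)
      fix v assume v: "(v :: 'a vec) \<in> carrier_vec n"
      show "(h' * h') *\<^sub>v v = 1\<^sub>m n *\<^sub>v v"
        unfolding assoc_mult_mat_vec[OF h' h' v] h'h'[OF v] using v by simp
    qed (use h' in auto)
    show "h' * g = gi * h'"
    proof (rule mat_eq_by_vec)
      fix v assume v: "(v :: 'a vec) \<in> carrier_vec n"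
      show "(h' * g) *\<^sub>v v = (gi * h') *\<^sub>v v"
        unfolding assoc_mult_mat_vec[OF h' gc v] assoc_mult_mat_vec[OF gi h' v] h'v[OF v] h'v[OF V(1)[OF v]]
          RM[OF gc Eg[OF v] v] by (rule hgv[OF VR[OF v]])
    qed (use h' gc gi in auto)
    show "det h' = - det h" unfolding h'_def det_mult[OF hc R] det_R by simp
  qed
qed

end

section \<open>Unitary groups inside the algebraic closure\<close>

text \<open>Multiplication by a nonzero \<open>x\<close> permutes the nonzero elements; comparing
  their products gives the claim.\<close>

lemma power_card_eq_same:
  fixes x :: "'a :: {field, finite}"
  shows "x ^ CARD('a) = x"
proof (cases "x = 0")
  case True
  then show ?thesis by (simp add: power_0_left)
next
  case False
  let ?S = "UNIV - {0 :: 'a}"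
  have "(\<lambda>y. x * y) ` ?S = ?S"
    by (rule endo_inj_surj) (use False in \<open>auto simp: inj_on_def\<close>)
  then have "\<Prod>?S = (\<Prod>y\<in>?S. x * y)"
    using prod.reindex[of "\<lambda>y. x * y" ?S id] False by (auto simp: inj_on_def)
  also have "\<dots> = x ^ card ?S * \<Prod>?S" by (simp add: prod.distrib)
  finally have one: "x ^ card ?S = 1" by simp
  have card: "CARD('a) = Suc (card ?S)" by (subst card.remove[of _ 0]) simp_all
  show ?thesis by (simp only: card power_Suc one mult_1_right)
qed

lemma CHAR_of_card_primepow:
  assumes q: "primepow q" and card: "CARD('a :: {field, finite}) = q ^ 2"
  obtains p e where "Factorial_Ring.prime p" "CHAR('a) = p" "q = p ^ e" "0 < e"
proof -
  obtain p e where p: "Factorial_Ring.prime p" "0 < e" "q = p ^ e" using q unfolding primepow_def by blast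
  have "Factorial_Ring.prime (CHAR('a))"
    by (rule prime_CHAR_semidom) (use finite_imp_CHAR_pos[where 'a = 'a] in simp)
  moreover have "CHAR('a) dvd p ^ (e * 2)" using CHAR_dvd_CARD[where 'a = 'a] card p(3) by (simp add: power_mult)
  ultimately have "CHAR('a) = p" using p(1) by (meson prime_dvd_power primes_dvd_imp_eq)
  then show ?thesis using that p by blast
qed

text \<open>The polynomial \<open>t^N - t\<close>, with \<open>N\<close> the size of the finite
  field, has at most \<open>N\<close> roots, and the embedded finite field already supplies that
  many.\<close>

lemma root_in_range_to_ac:
  fixes x :: "'a :: {field, finite} alg_closure"
  assumes "x ^ CARD('a) = x"
  shows "x \<in> range to_ac"
proof -
  define p :: "'a alg_closure poly" where "p = Polynomial.monom 1 (CARD('a)) - [:0, 1:]"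
  have c: "1 < CARD('a)" using card_mono[of "UNIV :: 'a set" "{0, 1}"] by simp
  have lead: "Polynomial.coeff p (CARD('a)) = 1"
    using c by (simp add: p_def coeff_pCons split: nat.splits)
  have "Polynomial.degree p \<le> CARD('a)"
    unfolding p_def using c by (intro degree_diff_le degree_monom_le) simp
  moreover have p0: "p \<noteq> 0" using lead by auto
  ultimately have card: "card {y. poly p y = 0} \<le> CARD('a)" using card_poly_roots_bound[OF p0] by simp
  have roots: "poly p y = 0 \<longleftrightarrow> y ^ CARD('a) = y" for y by (simp add: p_def poly_monom)
  have "range to_ac \<subseteq> {y. poly p y = 0}"
    unfolding roots by (auto simp: power_card_eq_same simp flip: to_ac_power)
  moreover have "card (range (to_ac :: 'a \<Rightarrow> _)) = CARD('a)" by (rule card_image[OF inj_to_ac])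
  ultimately have "range to_ac = {y. poly p y = 0}"
    using card by (intro card_seteq) (simp_all add: poly_roots_finite[OF p0])
  then show ?thesis using assms roots by blast
qed

section \<open>Inverses and strong reality in groups of matrices\<close>

lemma carrier_GL_iff:
  "M \<in> carrier (GL n) \<longleftrightarrow> M \<in> carrier_mat n n \<and> (\<exists>N\<in>carrier_mat n n. M * N = 1\<^sub>m n \<and> N * M = 1\<^sub>m n)"
  unfolding GL_def units_of_carrier Units_def ring_mat_def by auto

lemma GL_simps [simp]: "mult (GL n) = (*)" "one (GL n) = 1\<^sub>m n"
  by (simp_all add: GL_def units_of_def ring_mat_def)

text \<open>Inverses are taken relative to the carrier, so this is stated for any structure with
  matrix multiplication in order to cover \<open>GL\<close>, \<open>GU\<close> and \<open>SU\<close>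
  alike.\<close>

lemma m_inv_eq:
  fixes G :: "('a :: field mat, 'b) monoid_scheme"
  assumes G: "mult G = (*)" "one G = 1\<^sub>m n" "carrier G \<subseteq> carrier_mat n n"
    and M: "M \<in> carrier G" and N: "N \<in> carrier G" and MN: "M * N = 1\<^sub>m n" "N * M = 1\<^sub>m n"
  shows "inv\<^bsub>G\<^esub> M = N"
  unfolding m_inv_def G(1,2)
proof (rule the_equality)
  show "N \<in> carrier G \<and> M * N = 1\<^sub>m n \<and> N * M = 1\<^sub>m n" using N MN by blast
  fix L assume L: "L \<in> carrier G \<and> M * L = 1\<^sub>m n \<and> L * M = 1\<^sub>m n"
  have c: "L \<in> carrier_mat n n" "M \<in> carrier_mat n n" "N \<in> carrier_mat n n" using L M N G(3) by auto
  have "L = L * (M * N)" unfolding MN using c by simp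
  also have "\<dots> = L * M * N" by (rule assoc_mult_mat[OF c(1,2,3), symmetric])
  also have "\<dots> = N" using L c by simp
  finally show "L = N" .
qed

text \<open>An involution is its own inverse, so conjugation becomes the inverse-free equation
  \<open>h * M = N * h\<close>, which can be tested over the finite field.\<close>

lemma strongly_real_iff:
  fixes G :: "('a :: field mat, 'b) monoid_scheme"
  assumes G: "mult G = (*)" "one G = 1\<^sub>m n" "carrier G \<subseteq> carrier_mat n n"
    and M: "M \<in> carrier G" and N: "N \<in> carrier G" and MN: "M * N = 1\<^sub>m n" "N * M = 1\<^sub>m n"
  shows "strongly_real G M \<longleftrightarrow> (\<exists>h\<in>carrier G. h * h = 1\<^sub>m n \<and> h * M = N * h)"
proof -
  have "h * M * inv\<^bsub>G\<^esub> h = N \<longleftrightarrow> h * M = N * h" if h: "h \<in> carrier G" and hh: "h * h = 1\<^sub>m n" for h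
  proof -
    have c: "h \<in> carrier_mat n n" "M \<in> carrier_mat n n" "N \<in> carrier_mat n n"
      using h M N G(3) by auto
    have hM: "h * M \<in> carrier_mat n n" using c by simp
    have inv: "inv\<^bsub>G\<^esub> h = h" by (rule m_inv_eq[OF G h h hh hh])
    show ?thesis
      unfolding inv
    proof
      assume "h * M * h = N"
      then have "N * h = h * M * h * h" by simp
      also have "\<dots> = h * M" unfolding assoc_mult_mat[OF hM c(1) c(1)] hh by (rule right_mult_one_mat[OF hM])
      finally show "h * M = N * h" by (rule sym)
    next
      assume "h * M = N * h"
      then have "h * M * h = N * h * h" by simp
      also have "\<dots> = N" unfolding assoc_mult_mat[OF c(3) c(1) c(1)] hh by (rule right_mult_one_mat[OF c(3)])
      finally show "h * M * h = N" .
    qed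
  qed
  then show ?thesis
    unfolding strongly_real_def m_inv_eq[OF G M N MN] G(1,2) using M by blast
qed

text \<open>Descent data: elements of the closure fixed by the \<open>q^2\<close>-th power come from
  the finite field.\<close>

locale closure_unitary = hermitian_space q ty n \<eta> + Kb: additive_power q ty'
  for q and ty :: "'a :: {field, finite} itself" and n \<eta> and ty' :: "'a alg_closure itself" +
  assumes fixed_in_range: "\<And>x :: 'a alg_closure. (x ^ q) ^ q = x \<Longrightarrow> x \<in> range to_ac"
begin

sublocale emb: comm_ring_hom "to_ac :: 'a \<Rightarrow> 'a alg_closure"
  by unfold_locales simp_all

abbreviation lift_mat :: "'a mat \<Rightarrow> 'a alg_closure mat" where "lift_mat \<equiv> map_mat to_ac"

lemma lift_mat_eq_iff [simp]: "lift_mat A = lift_mat B \<longleftrightarrow> A = B"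
  by (auto simp: mat_eq_iff)

lemma star_lift_mat: "Kb.star (lift_mat A) = lift_mat (star A)"
  by (rule eq_matI) (simp_all add: Kb.star_def star_def frob_mat_def)

lemma unitary_invertible:
  assumes A: "unitary A"
  obtains Ai where "unitary Ai" "A * Ai = 1\<^sub>m n" "Ai * A = 1\<^sub>m n"
proof -
  have Ac: "A \<in> carrier_mat n n" and eq: "star A * (\<eta> * A) = \<eta>" using A by (auto simp: unitary_def)
  have "det \<eta> = det (star A) * (det \<eta> * det A)"
    using det_mult[of "star A" n "\<eta> * A"] det_mult[OF eta Ac] Ac eta eq by simp
  then have "det A \<noteq> 0" using det_eta by auto
  then obtain Ai where Ai: "Ai \<in> carrier_mat n n" and inv: "A * Ai = 1\<^sub>m n" "Ai * A = 1\<^sub>m n"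
    using mat_inverse_of_det[OF Ac] by blast
  have cancel: "A *\<^sub>v (Ai *\<^sub>v x) = x" if x: "x \<in> carrier_vec n" for x
    unfolding assoc_mult_mat_vec[OF Ac Ai x, symmetric] inv using x by simp
  have "unitary Ai"
    unfolding unitary_iff_form[OF Ai]
  proof (intro ballI)
    fix x y :: "'a vec" assume x: "x \<in> carrier_vec n" and y: "y \<in> carrier_vec n"
    have "Ai *\<^sub>v x \<in> carrier_vec n" "Ai *\<^sub>v y \<in> carrier_vec n" using Ai x y by auto
    then have "form (A *\<^sub>v (Ai *\<^sub>v x)) (A *\<^sub>v (Ai *\<^sub>v y)) = form (Ai *\<^sub>v x) (Ai *\<^sub>v y)"
      using A unfolding unitary_iff_form[OF Ac] by blast
    then show "form (Ai *\<^sub>v x) (Ai *\<^sub>v y) = form x y" unfolding cancel[OF x] cancel[OF y] ..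
  qed
  then show ?thesis using that inv by blast
qed

text \<open>Clearing inverses turns the fixed-point equation into the statement that
  \<open>M\<close> preserves the Hermitian form of \<open>\<eta>\<close>.\<close>

lemma unitary_frob_fixed_iff:
  assumes M: "M \<in> carrier_mat n n" and N: "N \<in> carrier_mat n n" and MN: "M * N = 1\<^sub>m n" "N * M = 1\<^sub>m n"
  shows "unitary_frob n q \<eta> M = M \<longleftrightarrow> Kb.star M * (lift_mat \<eta> * M) = lift_mat \<eta>"
proof -
  let ?P = "lift_mat \<eta>"
  have P: "?P \<in> carrier_mat n n" using eta by simp
  obtain \<theta> where th: "\<theta> \<in> carrier_mat n n" and inv: "\<eta> * \<theta> = 1\<^sub>m n" "\<theta> * \<eta> = 1\<^sub>m n"
    using mat_inverse_of_det[OF eta det_eta] by blast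
  let ?Q = "lift_mat \<theta>"
  have Q: "?Q \<in> carrier_mat n n" using th by simp
  have PQ: "?P * ?Q = 1\<^sub>m n" "?Q * ?P = 1\<^sub>m n"
    unfolding emb.mat_hom_mult[OF eta th, symmetric] emb.mat_hom_mult[OF th eta, symmetric] inv emb.mat_hom_one by auto
  have sub: "carrier (GL n) \<subseteq> carrier_mat n n" by (auto simp: carrier_GL_iff)
  have invP: "inv\<^bsub>GL n\<^esub> ?P = ?Q"
    by (rule m_inv_eq[OF GL_simps sub _ _ PQ]) (use P Q PQ in \<open>auto simp: carrier_GL_iff\<close>)
  have F: "frob_mat q M \<in> carrier_mat n n" "frob_mat q N \<in> carrier_mat n n" using M N by (auto simp: frob_mat_def)
  have FF: "frob_mat q M * frob_mat q N = 1\<^sub>m n" "frob_mat q N * frob_mat q M = 1\<^sub>m n"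
    unfolding frob_mat_def Kb.frob.mat_hom_mult[OF M N, symmetric] Kb.frob.mat_hom_mult[OF N M, symmetric]
      MN Kb.frob.mat_hom_one by auto
  have invF: "inv\<^bsub>GL n\<^esub> (frob_mat q M) = frob_mat q N"
    by (rule m_inv_eq[OF GL_simps sub _ _ FF]) (use F FF in \<open>auto simp: carrier_GL_iff\<close>)
  have SM: "Kb.star M \<in> carrier_mat n n" "Kb.star N \<in> carrier_mat n n" using M N by auto
  have SS: "Kb.star M * Kb.star N = 1\<^sub>m n" "Kb.star N * Kb.star M = 1\<^sub>m n"
    unfolding Kb.star_mult[OF N M, symmetric] Kb.star_mult[OF M N, symmetric] MN Kb.star_one by auto
  have PM: "?P * M \<in> carrier_mat n n" and SP: "Kb.star N * ?P \<in> carrier_mat n n" using P M SM by auto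
  have "unitary_frob n q \<eta> M = ?Q * (Kb.star N * ?P)"
    unfolding unitary_frob_def invP invF Kb.star_def[symmetric] by (rule assoc_mult_mat[OF Q SM(2) P])
  also have "\<dots> = M \<longleftrightarrow> Kb.star N * ?P = ?P * M"
  proof
    assume "?Q * (Kb.star N * ?P) = M"
    then have "?P * M = ?P * (?Q * (Kb.star N * ?P))" by simp
    also have "\<dots> = Kb.star N * ?P"
      unfolding assoc_mult_mat[OF P Q SP, symmetric] PQ by (rule left_mult_one_mat[OF SP])
    finally show "Kb.star N * ?P = ?P * M" by (rule sym)
  next
    assume "Kb.star N * ?P = ?P * M"
    then have "?Q * (Kb.star N * ?P) = ?Q * (?P * M)" by simp
    also have "\<dots> = M" unfolding assoc_mult_mat[OF Q P M, symmetric] PQ by (rule left_mult_one_mat[OF M])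
    finally show "?Q * (Kb.star N * ?P) = M" .
  qed
  also have "\<dots> \<longleftrightarrow> Kb.star M * (?P * M) = ?P"
  proof
    assume "Kb.star N * ?P = ?P * M"
    then have "Kb.star M * (?P * M) = Kb.star M * (Kb.star N * ?P)" by simp
    also have "\<dots> = ?P" unfolding assoc_mult_mat[OF SM P, symmetric] SS by (rule left_mult_one_mat[OF P])
    finally show "Kb.star M * (?P * M) = ?P" .
  next
    assume "Kb.star M * (?P * M) = ?P"
    then have "Kb.star N * ?P = Kb.star N * (Kb.star M * (?P * M))" by simp
    also have "\<dots> = ?P * M" unfolding assoc_mult_mat[OF SM(2,1) PM, symmetric] SS by (rule left_mult_one_mat[OF PM])
    finally show "Kb.star N * ?P = ?P * M" .
  qed
  finally show ?thesis .
qed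

text \<open>With this description the algebraic closure disappears, and the counting arguments over
  the finite field become available.\<close>

lemma carrier_GU: "carrier (GU n q \<eta>) = lift_mat ` {A. unitary A}"
proof (intro equalityI subsetI)
  fix M assume "M \<in> carrier (GU n q \<eta>)"
  then have "M \<in> carrier (GL n)" and fixed: "unitary_frob n q \<eta> M = M" by (auto simp: GU_def)
  then obtain N where M: "M \<in> carrier_mat n n" and N: "N \<in> carrier_mat n n" and MN: "M * N = 1\<^sub>m n" "N * M = 1\<^sub>m n"
    unfolding carrier_GL_iff by blast
  let ?P = "lift_mat \<eta>"
  have P: "?P \<in> carrier_mat n n" using eta by simp
  obtain \<theta> where th: "\<theta> \<in> carrier_mat n n" and inv: "\<theta> * \<eta> = 1\<^sub>m n"
    using mat_inverse_of_det[OF eta det_eta] by blast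
  have Q: "lift_mat \<theta> \<in> carrier_mat n n" and QP: "lift_mat \<theta> * ?P = 1\<^sub>m n"
    using th unfolding emb.mat_hom_mult[OF th eta, symmetric] inv emb.mat_hom_one by auto
  have eq: "Kb.star M * (?P * M) = ?P" using unitary_frob_fixed_iff[OF M N MN] fixed by simp
  let ?M2 = "Kb.star (Kb.star M)"
  have S: "Kb.star M \<in> carrier_mat n n" "Kb.star N \<in> carrier_mat n n" "?M2 \<in> carrier_mat n n" using M N by auto
  have PM: "?P * M \<in> carrier_mat n n" and PM2: "?P * ?M2 \<in> carrier_mat n n" using P M S by auto
  have SS: "Kb.star N * Kb.star M = 1\<^sub>m n" unfolding Kb.star_mult[OF M N, symmetric] MN Kb.star_one ..
  have starP: "Kb.star ?P = ?P" unfolding star_lift_mat star_eta ..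
  \<comment> \<open>Applying the conjugate transpose to the Hermitian equation shows that \<open>M\<close> is fixed by \<open>x \<mapsto> x^(q^2)\<close>.\<close>
  have "Kb.star M * (?P * ?M2) = ?P"
  proof -
    have "Kb.star (Kb.star M * (?P * M)) = Kb.star M * ?P * ?M2"
      unfolding Kb.star_mult[OF S(1) PM] Kb.star_mult[OF P M] starP ..
    then show ?thesis unfolding eq starP assoc_mult_mat[OF S(1) P S(3)] by (rule sym)
  qed
  then have "Kb.star N * (Kb.star M * (?P * ?M2)) = Kb.star N * (Kb.star M * (?P * M))" using eq by simp
  then have "?P * ?M2 = ?P * M"
    unfolding assoc_mult_mat[OF S(2,1) PM, symmetric] assoc_mult_mat[OF S(2,1) PM2, symmetric] SS
      left_mult_one_mat[OF PM] left_mult_one_mat[OF PM2] .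
  then have "lift_mat \<theta> * (?P * ?M2) = lift_mat \<theta> * (?P * M)" by simp
  then have M2: "?M2 = M"
    unfolding assoc_mult_mat[OF Q P M, symmetric] assoc_mult_mat[OF Q P S(3), symmetric] QP
      left_mult_one_mat[OF M] left_mult_one_mat[OF S(3)] .
  define A where "A = map_mat of_ac M"
  have "M $$ (i, j) \<in> range to_ac" if "i < n" "j < n" for i j
  proof (rule fixed_in_range)
    have "?M2 $$ (i, j) = (M $$ (i, j) ^ q) ^ q" using that M by (simp add: Kb.star_def frob_mat_def)
    then show "(M $$ (i, j) ^ q) ^ q = M $$ (i, j)" unfolding M2 by simp
  qed
  then have MA: "M = lift_mat A"
    using M by (intro eq_matI) (auto simp: A_def to_ac_of_ac)
  have Ac: "A \<in> carrier_mat n n" using M by (simp add: A_def)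
  have eA: "\<eta> * A \<in> carrier_mat n n" and sA: "star A \<in> carrier_mat n n" using eta Ac by auto
  have "lift_mat (star A * (\<eta> * A)) = ?P"
    using eq unfolding MA star_lift_mat emb.mat_hom_mult[OF eta Ac, symmetric] emb.mat_hom_mult[OF sA eA, symmetric] .
  then have "unitary A" using Ac by (simp add: unitary_def)
  then show "M \<in> lift_mat ` {A. unitary A}" using MA by blast
next
  fix M assume "M \<in> lift_mat ` {A. unitary A}"
  then obtain A where A: "unitary A" and MA: "M = lift_mat A" by blast
  obtain Ai where Ai: "unitary Ai" and inv: "A * Ai = 1\<^sub>m n" "Ai * A = 1\<^sub>m n" by (rule unitary_invertible[OF A])
  have c: "A \<in> carrier_mat n n" "Ai \<in> carrier_mat n n" using A Ai by (auto simp: unitary_def)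
  have Mc: "M \<in> carrier_mat n n" "lift_mat Ai \<in> carrier_mat n n" using c MA by auto
  have MN: "M * lift_mat Ai = 1\<^sub>m n" "lift_mat Ai * M = 1\<^sub>m n"
    unfolding MA emb.mat_hom_mult[OF c, symmetric] emb.mat_hom_mult[OF c(2,1), symmetric] inv emb.mat_hom_one by auto
  have eA: "\<eta> * A \<in> carrier_mat n n" and sA: "star A \<in> carrier_mat n n" using eta c by auto
  have "Kb.star M * (lift_mat \<eta> * M) = lift_mat (star A * (\<eta> * A))"
    unfolding MA star_lift_mat emb.mat_hom_mult[OF eta c(1), symmetric] emb.mat_hom_mult[OF sA eA, symmetric] ..
  also have "\<dots> = lift_mat \<eta>" using A by (simp add: unitary_def)
  finally have "unitary_frob n q \<eta> M = M" using unitary_frob_fixed_iff[OF Mc MN] by simp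
  moreover have "M \<in> carrier (GL n)" unfolding carrier_GL_iff using Mc MN by blast
  ultimately show "M \<in> carrier (GU n q \<eta>)" by (simp add: GU_def)
qed

lemma carrier_SU: "carrier (SU n q \<eta>) = lift_mat ` {A. unitary A \<and> det A = 1}"
  unfolding SU_def carrier_GU by (auto simp: carrier_GU emb.hom_det)

lemma strongly_real_GU_SU:
  assumes A: "unitary A" "det A = 1" and Ai: "unitary Ai" and inv: "A * Ai = 1\<^sub>m n" "Ai * A = 1\<^sub>m n"
  shows "strongly_real (GU n q \<eta>) (lift_mat A) \<longleftrightarrow> (\<exists>h. unitary h \<and> h * h = 1\<^sub>m n \<and> h * A = Ai * h)"
    and "strongly_real (SU n q \<eta>) (lift_mat A) \<longleftrightarrow> (\<exists>h. unitary h \<and> h * h = 1\<^sub>m n \<and> h * A = Ai * h \<and> det h = 1)"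
proof -
  have c: "A \<in> carrier_mat n n" "Ai \<in> carrier_mat n n" using A Ai by (auto simp: unitary_def)
  have "det A * det Ai = 1" using det_mult[OF c] inv by simp
  then have detAi: "det Ai = 1" using A by simp
  have MN: "lift_mat A * lift_mat Ai = 1\<^sub>m n" "lift_mat Ai * lift_mat A = 1\<^sub>m n"
    unfolding emb.mat_hom_mult[OF c, symmetric] emb.mat_hom_mult[OF c(2,1), symmetric] inv emb.mat_hom_one by auto
  have eqs: "lift_mat h * lift_mat h = 1\<^sub>m n \<longleftrightarrow> h * h = 1\<^sub>m n"
    "lift_mat h * lift_mat A = lift_mat Ai * lift_mat h \<longleftrightarrow> h * A = Ai * h" if "unitary h" for h
  proof -
    have h: "h \<in> carrier_mat n n" using that by (simp add: unitary_def)
    show "lift_mat h * lift_mat h = 1\<^sub>m n \<longleftrightarrow> h * h = 1\<^sub>m n"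
      unfolding emb.mat_hom_mult[OF h h, symmetric] emb.mat_hom_one[of n, symmetric] by (rule lift_mat_eq_iff)
    show "lift_mat h * lift_mat A = lift_mat Ai * lift_mat h \<longleftrightarrow> h * A = Ai * h"
      unfolding emb.mat_hom_mult[OF h c(1), symmetric] emb.mat_hom_mult[OF c(2) h, symmetric] by (rule lift_mat_eq_iff)
  qed
  have GU: "mult (GU n q \<eta>) = (*)" "one (GU n q \<eta>) = 1\<^sub>m n" "carrier (GU n q \<eta>) \<subseteq> carrier_mat n n"
    by (auto simp: GU_def carrier_GL_iff)
  have SU: "mult (SU n q \<eta>) = (*)" "one (SU n q \<eta>) = 1\<^sub>m n" "carrier (SU n q \<eta>) \<subseteq> carrier_mat n n"
    using GU by (auto simp: SU_def)
  have inG: "lift_mat A \<in> carrier (GU n q \<eta>)" "lift_mat Ai \<in> carrier (GU n q \<eta>)"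
    and inS: "lift_mat A \<in> carrier (SU n q \<eta>)" "lift_mat Ai \<in> carrier (SU n q \<eta>)"
    unfolding carrier_GU carrier_SU using A Ai detAi by auto
  show "strongly_real (GU n q \<eta>) (lift_mat A) \<longleftrightarrow> (\<exists>h. unitary h \<and> h * h = 1\<^sub>m n \<and> h * A = Ai * h)"
    unfolding strongly_real_iff[OF GU inG MN] unfolding carrier_GU using eqs by blast
  show "strongly_real (SU n q \<eta>) (lift_mat A) \<longleftrightarrow> (\<exists>h. unitary h \<and> h * h = 1\<^sub>m n \<and> h * A = Ai * h \<and> det h = 1)"
    unfolding strongly_real_iff[OF SU inS MN] unfolding carrier_SU using eqs by blast
qed

lemma is_elementary_divisor_lift_mat:
  "is_elementary_divisor (lift_mat A) f \<longleftrightarrow> (\<exists>fs. elementary_divisors A fs \<and> f \<in> set fs)"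
  unfolding is_elementary_divisor_def by auto

end

theorem theorem7p1:
  fixes \<eta> :: "'a :: {field, finite} mat" and g :: "'a alg_closure mat" and n q :: nat
  assumes "n \<ge> 1"
    and "primepow q"
    and "CARD('a) = q ^ 2"
    and "invertible_hermitian n q \<eta>"
    and "g \<in> carrier (SU n q \<eta>)"
  shows "((n mod 4 \<noteq> 2 \<or> even q) \<longrightarrow>
            (strongly_real (SU n q \<eta>) g \<longleftrightarrow> strongly_real (GU n q \<eta>) g)) \<and>
         ((n mod 4 = 2 \<and> odd q) \<longrightarrow>
            (strongly_real (SU n q \<eta>) g \<longleftrightarrow>
               strongly_real (GU n q \<eta>) g \<and>
               (\<exists>k. odd k \<and> (is_elementary_divisor g ([:-1, 1:] ^ k) \<or>
                             is_elementary_divisor g ([:1, 1:] ^ k)))))"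
proof -
  obtain p e where p: "Factorial_Ring.prime p" "CHAR('a) = p" "q = p ^ e" "0 < e"
    by (rule CHAR_of_card_primepow[OF assms(2,3)])
  have eta: "\<eta> \<in> carrier_mat n n" "det \<eta> \<noteq> 0" "transpose_mat (frob_mat q \<eta>) = \<eta>"
  proof -
    have "\<eta> \<in> Units (ring_mat TYPE('a) n ())" "transpose_mat (frob_mat q \<eta>) = \<eta>"
      using assms(4) unfolding invertible_hermitian_def GL_def units_of_carrier by auto
    then show "\<eta> \<in> carrier_mat n n" "det \<eta> \<noteq> 0" "transpose_mat (frob_mat q \<eta>) = \<eta>"
      using unit_imp_det_non_zero by (auto simp: Units_def ring_mat_def)
  qed
  have q0: "0 < q" using p by (simp add: prime_gt_0_nat)
  interpret K: additive_power q "TYPE('a)"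
    by unfold_locales (use q0 p freshmans_dream'[where 'a = 'a] in auto)
  interpret closure_unitary q "TYPE('a)" n \<eta> "TYPE('a alg_closure)"
  proof unfold_locales
    show "(x + y) ^ q = x ^ q + y ^ q" for x y :: "'a alg_closure"
      by (rule freshmans_dream'[where n = e]) (use p in simp_all)
    show "(x ^ q) ^ q = x" for x :: 'a
      using power_card_eq_same[of x] assms(3) by (simp add: power2_eq_square power_mult)
    show "x \<in> range to_ac" if "(x ^ q) ^ q = x" for x :: "'a alg_closure"
      by (rule root_in_range_to_ac) (use that assms(3) in \<open>simp add: power2_eq_square power_mult\<close>)
    show "K.star \<eta> = \<eta>" unfolding K.star_def by (rule eta(3))
  qed (use eta q0 in auto)
  obtain A where A: "unitary A" "det A = 1" and g: "g = lift_mat A" using assms(5) unfolding carrier_SU by blast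
  obtain Ai where Ai: "unitary Ai" and inv: "A * Ai = 1\<^sub>m n" "Ai * A = 1\<^sub>m n" by (rule unitary_invertible[OF A(1)])
  have Ac: "A \<in> carrier_mat n n" and Aic: "Ai \<in> carrier_mat n n" using A Ai by (auto simp: unitary_def)
  define P where "P h \<longleftrightarrow> unitary h \<and> h * h = 1\<^sub>m n \<and> h * A = Ai * h" for h
  have GU_iff: "strongly_real (GU n q \<eta>) g \<longleftrightarrow> (\<exists>h. P h)"
    and SU_iff: "strongly_real (SU n q \<eta>) g \<longleftrightarrow> (\<exists>h. P h \<and> det h = 1)"
    unfolding g strongly_real_GU_SU[OF A Ai inv] P_def by auto
  have det_h: "det h = 1 \<or> det h = -1" if "P h" for h
  proof -
    have h: "h \<in> carrier_mat n n" "h * h = 1\<^sub>m n" using that by (auto simp: P_def unitary_def)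
    then have "det h * det h = 1" using det_mult[OF h(1) h(1)] by simp
    then show ?thesis by (simp add: square_eq_1_iff)
  qed
  have two: "(2 :: 'a) = 0 \<longleftrightarrow> even q"
  proof -
    have "(2 :: 'a) = 0 \<longleftrightarrow> of_nat 2 = (0 :: 'a)" by simp
    also have "\<dots> \<longleftrightarrow> p dvd 2" unfolding of_nat_eq_0_iff_char_dvd p(2) ..
    also have "\<dots> \<longleftrightarrow> even q"
    proof
      assume "p dvd 2"
      then have "p = 2" using primes_dvd_imp_eq[OF p(1) two_is_prime_nat] by blast
      then show "even q" using p(3,4) by simp
    next
      assume "even q"
      then have "2 dvd p" unfolding p(3) by (rule prime_dvd_power[OF two_is_prime_nat])
      then have "2 = p" using primes_dvd_imp_eq[OF two_is_prime_nat p(1)] by blast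
      then show "p dvd 2" by simp
    qed
    finally show ?thesis .
  qed
  define odd_block where "odd_block \<longleftrightarrow> (\<exists>k. odd k \<and> (is_elementary_divisor g ([:-1, 1:] ^ k) \<or>
    is_elementary_divisor g ([:1, 1:] ^ k)))"
  have flip: "\<exists>h'. P h' \<and> det h' = 1" if q: "odd q" and blk: odd_block and h: "P h" for h
  proof (cases "det h = 1")
    case True
    then show ?thesis using h by blast
  next
    case False
    then have dh: "det h = -1" using det_h[OF h] by blast
    have two': "(2 :: 'a) \<noteq> 0" using two q by simp
    obtain k fs where k: "odd k" and fs: "elementary_divisors A fs"
      and mem: "[:-1, 1:] ^ k \<in> set fs \<or> [:1, 1:] ^ k \<in> set fs"
      using blk unfolding odd_block_def g is_elementary_divisor_lift_mat by blast
    have k0: "0 < k" using k by (cases k) auto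
    have m1: "(-1 :: 'a) ^ q = -1" using q by simp
    \<comment> \<open>\<open>c\<close> is the eigenvalue of the odd block, \<open>1\<close> or
      \<open>-1\<close>; for \<open>c = 1\<close> the conjugation condition is where
      \<open>q\<close> odd is used.\<close>
    obtain c :: 'a where c: "c * c = 1" "(- c) ^ q = - c" and memc: "[:- c, 1:] ^ k \<in> set fs"
      using mem
    proof
      assume "[:-1, 1:] ^ k \<in> set fs"
      then show thesis using that[of 1] m1 by simp
    next
      assume "[:1, 1:] ^ k \<in> set fs"
      then show thesis using that[of "-1"] by simp
    qed
    have wit: "jordan_block_witness A c k"
      by (rule elementary_divisor_jordan_block_witness[OF fs memc k0])
    obtain h' where "unitary h'" "h' * h' = 1\<^sub>m n" "h' * A = Ai * h'" "det h' = - det h"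
      using reversing_involution_flip_det[OF two' A(1) Aic inv _ _ _ c k wit] h unfolding P_def by blast
    then show ?thesis using dh unfolding P_def by auto
  qed
  have balanced: "even n \<and> det h = (-1) ^ (n div 2)" if q: "odd q" and nblk: "\<not> odd_block" and h: "P h" for h
  proof -
    have two': "(2 :: 'a) \<noteq> 0" using two q by simp
    obtain fs where fs: "elementary_divisors A fs" using elementary_divisors_exist[OF Ac] by blast
    have lift: "kernel_lifts A [:-1, 0, 1:] k" if k: "odd k" for k
    proof (rule kernel_lifts_of_elementary_divisors[OF two' fs])
      show "0 < k" using k by (cases k) auto
      show "[:-1, 1:] ^ k \<notin> set fs"
        using nblk fs k unfolding odd_block_def g is_elementary_divisor_lift_mat by blast
      show "[:1, 1:] ^ k \<notin> set fs"
        using nblk fs k unfolding odd_block_def g is_elementary_divisor_lift_mat by blast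
    qed
    have hc: "h \<in> carrier_mat n n" "h * h = 1\<^sub>m n" "h * A = Ai * h" using h by (auto simp: P_def unitary_def)
    show ?thesis by (rule det_reversing_involution[OF two' Ac Aic hc(1) inv hc(2,3) lift])
  qed
  have part1: "strongly_real (SU n q \<eta>) g \<longleftrightarrow> strongly_real (GU n q \<eta>) g" if *: "n mod 4 \<noteq> 2 \<or> even q"
  proof
    assume "strongly_real (GU n q \<eta>) g"
    then obtain h where h: "P h" using GU_iff by blast
    show "strongly_real (SU n q \<eta>) g"
    proof (cases "even q")
      case True
      then have "(2 :: 'a) = 0" using two by simp
      \<comment> \<open>In characteristic 2 the two possible determinants of an involution
        coincide.\<close>
      then have "(-1 :: 'a) = 1" by (metis add_eq_0_iff one_add_one)
      then show ?thesis using h det_h[OF h] SU_iff by metis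
    next
      case False
      show ?thesis
      proof (cases odd_block)
        case True
        then show ?thesis using flip[OF False _ h] SU_iff by blast
      next
        case no: False
        then have d: "even n" "det h = (-1) ^ (n div 2)" using balanced[OF False no h] by auto
        \<comment> \<open>Without an odd block \<open>n\<close> is even; not being 2 modulo 4, it is
          divisible by 4, and the determinant is already \<open>1\<close>.\<close>
        have "even (n div 2)" using d(1) * False by presburger
        then show ?thesis using d(2) h SU_iff by auto
      qed
    qed
  qed (use GU_iff SU_iff in blast)
  have part2: "strongly_real (SU n q \<eta>) g \<longleftrightarrow> strongly_real (GU n q \<eta>) g \<and> odd_block" if *: "n mod 4 = 2" "odd q"
  proof
    assume "strongly_real (SU n q \<eta>) g"
    then obtain h where h: "P h" "det h = 1" using SU_iff by blast
    have "odd_block"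
    proof (rule ccontr)
      assume no: "\<not> odd_block"
      \<comment> \<open>For \<open>n\<close> congruent to 2 modulo 4 and no odd block, every
        reversing involution has determinant \<open>-1\<close>, so none lies in the special unitary
        group.\<close>
      have "odd (n div 2)" using *(1) by presburger
      then have "(-1 :: 'a) = 1" using balanced[OF *(2) no h(1)] h(2) by simp
      then have "(2 :: 'a) = 0" by (metis add.right_inverse one_add_one)
      then show False using two *(2) by simp
    qed
    then show "strongly_real (GU n q \<eta>) g \<and> odd_block" using h GU_iff by blast
  next
    assume "strongly_real (GU n q \<eta>) g \<and> odd_block"
    then show "strongly_real (SU n q \<eta>) g" using flip[OF *(2)] GU_iff SU_iff by blast
  qed
  show ?thesis using part1 part2 unfolding odd_block_def by blast
qed

end
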